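(* Let $1\le p,q\le\infty$ and $\max\{1/p-1/q;0\}<\alpha<\infty$. Then the Riemann-Liouville operator $R_\alpha$ satisfies $$e_n(R_\alpha:L_p[0,1]\to L_q[0,1])\sim n^{-\alpha}.$$
   Context: The Riemann-Liouville operator is $(R_\alpha f)(t)=\frac1{\Gamma(\alpha)}\int_0^t(t-x)^{\alpha-1}f(x)\,dx$, $0\le t\le1$, $\alpha>0$. For positive sequences, $x_n\sim y_n$ means that there are constants $c,C>0$ with $c\,y_n\le x_n\le C\,y_n$ for all $n\in\mathbb N$. Entropy numbers: for a bounded subset $A$ of a metric space $M$, $\varepsilon_n(A)=\inf\{\varepsilon\ge0:\exists x_1,\dots,x_n\in M,\ A\subset\bigcup_{i=1}^n B_M(x_i,\varepsilon)\}$ with closed balls, $e_n(A)=\varepsilon_{2^{n-1}}(A)$; for a bounded linear operator $T:X\to Y$ between Banach spaces, $e_n(T)=e_n(T(B_X))$ with $B_X$ the closed unit ball of $X$. *)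

theory Defs
  imports "HOL-Analysis.Analysis" "HOL-Probability.Essential_Supremum"
begin

section \<open>Real-valued measurable functions on the unit interval modulo null sets\<close>

abbreviation unit_lebesgue :: "real measure" where
  "unit_lebesgue \<equiv> lebesgue_on {0..1}"

definition ae_eq :: "(real \<Rightarrow> real) \<Rightarrow> (real \<Rightarrow> real) \<Rightarrow> bool" where
  "ae_eq f g \<longleftrightarrow> f \<in> borel_measurable unit_lebesgue \<and> g \<in> borel_measurable unit_lebesgue \<and>
     (AE x in unit_lebesgue. f x = g x)"

quotient_type L0 = "real \<Rightarrow> real" / partial: ae_eq
proof (rule part_equivpI)
  show "\<exists>f. ae_eq f f"
    by (rule exI[of _ "\<lambda>_. 0"]) (simp add: ae_eq_def)
  show "symp ae_eq"
    by (auto simp: symp_def ae_eq_def elim: eventually_mono)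
  show "transp ae_eq"
    by (auto simp: transp_def ae_eq_def elim: eventually_elim2)
qed

instantiation L0 :: real_vector
begin

lift_definition zero_L0 :: L0 is "\<lambda>_. 0"
  by (simp add: ae_eq_def)

lift_definition plus_L0 :: "L0 \<Rightarrow> L0 \<Rightarrow> L0" is "\<lambda>f g x. f x + g x"
  by (auto simp: ae_eq_def elim: eventually_elim2)

lift_definition minus_L0 :: "L0 \<Rightarrow> L0 \<Rightarrow> L0" is "\<lambda>f g x. f x - g x"
  by (auto simp: ae_eq_def elim: eventually_elim2)

lift_definition uminus_L0 :: "L0 \<Rightarrow> L0" is "\<lambda>f x. - f x"
  by (auto simp: ae_eq_def elim: eventually_mono)

lift_definition scaleR_L0 :: "real \<Rightarrow> L0 \<Rightarrow> L0" is "\<lambda>c f x. c * f x"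
  by (auto simp: ae_eq_def elim: eventually_mono)

instance
  by standard (transfer; auto simp: ae_eq_def algebra_simps)+

end

section \<open>The spaces \<open>L\<^sub>p[0,1]\<close>\<close>

text \<open>The exponent ranges over \<open>[1, \<infinity>]\<close>, as an extended real.\<close>

definition Lp_fun :: "ereal \<Rightarrow> (real \<Rightarrow> real) \<Rightarrow> bool" where
  "Lp_fun p f \<longleftrightarrow> f \<in> borel_measurable unit_lebesgue \<and>
     (if p = \<infinity> then esssup unit_lebesgue (\<lambda>x. ereal \<bar>f x\<bar>) < \<infinity>
      else integrable unit_lebesgue (\<lambda>x. \<bar>f x\<bar> powr real_of_ereal p))"

definition Lp_norm_fun :: "ereal \<Rightarrow> (real \<Rightarrow> real) \<Rightarrow> real" where
  "Lp_norm_fun p f =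
     (if p = \<infinity> then real_of_ereal (esssup unit_lebesgue (\<lambda>x. ereal \<bar>f x\<bar>))
      else (LINT x|unit_lebesgue. \<bar>f x\<bar> powr real_of_ereal p) powr (1 / real_of_ereal p))"

lemma Lp_fun_cong:
  assumes "ae_eq f g"
  shows "Lp_fun p f \<longleftrightarrow> Lp_fun p g"
proof -
  have [measurable]: "f \<in> borel_measurable unit_lebesgue" "g \<in> borel_measurable unit_lebesgue"
    and ae: "AE x in unit_lebesgue. f x = g x"
    using assms by (auto simp: ae_eq_def)
  have "esssup unit_lebesgue (\<lambda>x. ereal \<bar>f x\<bar>) = esssup unit_lebesgue (\<lambda>x. ereal \<bar>g x\<bar>)"
    using ae by (intro esssup_AE_cong) (auto elim: eventually_mono)
  moreover have "integrable unit_lebesgue (\<lambda>x. \<bar>f x\<bar> powr r) \<longleftrightarrow>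
      integrable unit_lebesgue (\<lambda>x. \<bar>g x\<bar> powr r)" for r
    using ae by (intro integrable_cong_AE) (auto elim: eventually_mono)
  ultimately show ?thesis
    by (simp add: Lp_fun_def)
qed

lemma Lp_norm_fun_cong:
  assumes "ae_eq f g"
  shows "Lp_norm_fun p f = Lp_norm_fun p g"
proof -
  have [measurable]: "f \<in> borel_measurable unit_lebesgue" "g \<in> borel_measurable unit_lebesgue"
    and ae: "AE x in unit_lebesgue. f x = g x"
    using assms by (auto simp: ae_eq_def)
  have "esssup unit_lebesgue (\<lambda>x. ereal \<bar>f x\<bar>) = esssup unit_lebesgue (\<lambda>x. ereal \<bar>g x\<bar>)"
    using ae by (intro esssup_AE_cong) (auto elim: eventually_mono)
  moreover have "(LINT x|unit_lebesgue. \<bar>f x\<bar> powr r) = (LINT x|unit_lebesgue. \<bar>g x\<bar> powr r)" for r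
    using ae by (intro integral_cong_AE) (auto elim: eventually_mono)
  ultimately show ?thesis
    by (simp add: Lp_norm_fun_def)
qed

lift_definition in_Lp :: "ereal \<Rightarrow> L0 \<Rightarrow> bool" is Lp_fun
  by (rule Lp_fun_cong)

lift_definition Lp_norm :: "ereal \<Rightarrow> L0 \<Rightarrow> real" is Lp_norm_fun
  by (rule Lp_norm_fun_cong)

lemma Lp_norm_fun_nonneg: "0 \<le> Lp_norm_fun p f"
proof -
  have "0 \<le> esssup unit_lebesgue (\<lambda>x. ereal \<bar>f x\<bar>)"
  proof (cases "(\<lambda>x. ereal \<bar>f x\<bar>) \<in> borel_measurable unit_lebesgue")
    case True
    have "esssup unit_lebesgue (\<lambda>_. 0::ereal) = 0"
      by (rule esssup_const) (simp add: emeasure_restrict_space space_restrict_space)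
    then show ?thesis
      using esssup_mono[of "\<lambda>_. 0::ereal" unit_lebesgue "\<lambda>x. ereal \<bar>f x\<bar>"] by simp
  qed (simp add: esssup_non_measurable top_ereal_def)
  then show ?thesis
    by (simp add: Lp_norm_fun_def real_of_ereal_pos)
qed

lemma Linf_bound:
  assumes "Lp_fun \<infinity> f"
  shows "AE x in unit_lebesgue. \<bar>f x\<bar> \<le> Lp_norm_fun \<infinity> f"
proof -
  let ?s = "esssup unit_lebesgue (\<lambda>x. ereal \<bar>f x\<bar>)"
  have [measurable]: "f \<in> borel_measurable unit_lebesgue" and fin: "?s < \<infinity>"
    using assms by (auto simp: Lp_fun_def)
  have "esssup unit_lebesgue (\<lambda>_. 0::ereal) = 0"
    by (rule esssup_const) (simp add: emeasure_restrict_space space_restrict_space)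
  then have "0 \<le> ?s"
    using esssup_mono[of "\<lambda>_. 0::ereal" unit_lebesgue "\<lambda>x. ereal \<bar>f x\<bar>"] by simp
  then have "?s = ereal (Lp_norm_fun \<infinity> f)"
    using fin by (cases ?s) (auto simp: Lp_norm_fun_def)
  then show ?thesis
    using esssup_AE[of "\<lambda>x. ereal \<bar>f x\<bar>" unit_lebesgue] by simp
qed

lemma Linf_I:
  assumes [measurable]: "f \<in> borel_measurable unit_lebesgue"
    and "AE x in unit_lebesgue. \<bar>f x\<bar> \<le> C"
  shows "Lp_fun \<infinity> f" "Lp_norm_fun \<infinity> f \<le> C"
proof -
  let ?s = "esssup unit_lebesgue (\<lambda>x. ereal \<bar>f x\<bar>)"
  have le: "?s \<le> ereal C"
    using assms(2) by (intro esssup_I) auto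
  then show mem: "Lp_fun \<infinity> f"
    using assms(1) by (auto simp: Lp_fun_def)
  have "esssup unit_lebesgue (\<lambda>_. 0::ereal) = 0"
    by (rule esssup_const) (simp add: emeasure_restrict_space space_restrict_space)
  then have "0 \<le> ?s"
    using esssup_mono[of "\<lambda>_. 0::ereal" unit_lebesgue "\<lambda>x. ereal \<bar>f x\<bar>"] by simp
  then show "Lp_norm_fun \<infinity> f \<le> C"
    using le by (cases ?s) (auto simp: Lp_norm_fun_def)
qed

lemma powr_convex_ineq:
  fixes a b u v p :: real
  assumes "1 \<le> p" "0 < a" "0 < b" "0 \<le> u" "0 \<le> v"
  shows "(u + v) powr p \<le> (a + b) powr p * (a / (a + b) * (u / a) powr p + b / (a + b) * (v / b) powr p)"
proof -
  have conv: "convex_on {0..} (\<lambda>x::real. x powr p)"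
  proof (rule convex_onI)
    fix t x y :: real
    assume t: "0 < t" "t < 1" and xy: "x \<in> {0..}" "y \<in> {0..}"
    have le1: "s powr p \<le> s" if "0 < s" "s < 1" for s :: real
      using powr_mono'[of 1 p s] that assms by simp
    consider "x = 0" | "y = 0" | "x > 0" "y > 0"
      using xy by fastforce
    then show "((1 - t) *\<^sub>R x + t *\<^sub>R y) powr p \<le> (1 - t) * x powr p + t * y powr p"
    proof cases
      case 1
      then show ?thesis
        using t xy le1[of t] by (auto simp: powr_mult intro!: mult_right_mono)
    next
      case 2
      then show ?thesis
        using t xy le1[of "1 - t"] by (auto simp: powr_mult intro!: mult_right_mono)
    next
      case 3
      then show ?thesis
        using convex_onD[OF powr_convex[OF assms(1)], of t x y] t by auto
    qed
  qed (simp add: convex_real_interval)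
  have "((1 - b / (a + b)) *\<^sub>R (u / a) + (b / (a + b)) *\<^sub>R (v / b)) powr p
      \<le> (1 - b / (a + b)) * (u / a) powr p + b / (a + b) * (v / b) powr p"
    using assms by (intro convex_onD[OF conv]) auto
  moreover have eq: "1 - b / (a + b) = a / (a + b)"
    using assms by (simp add: field_simps)
  moreover have "(a / (a + b)) * (u / a) + (b / (a + b)) * (v / b) = (u + v) / (a + b)"
    using assms by (simp add: add_divide_distrib)
  ultimately have "((u + v) / (a + b)) powr p
      \<le> a / (a + b) * (u / a) powr p + b / (a + b) * (v / b) powr p"
    by simp
  then show ?thesis
    using assms by (simp add: powr_divide pos_divide_le_eq mult.commute)
qed

lemma Lp_norm_fun_eq_0:
  assumes "1 \<le> p" "Lp_fun p f" "Lp_norm_fun p f = 0"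
  shows "AE x in unit_lebesgue. f x = 0"
proof (cases "p = \<infinity>")
  case True
  then show ?thesis
    using Linf_bound[of f] assms by auto
next
  case False
  define r where "r = real_of_ereal p"
  have r: "1 \<le> r"
    using assms(1) False unfolding r_def by (cases p) auto
  have int: "integrable unit_lebesgue (\<lambda>x. \<bar>f x\<bar> powr r)"
    using assms(2) False by (simp add: Lp_fun_def r_def)
  have "(LINT x|unit_lebesgue. \<bar>f x\<bar> powr r) = 0"
    using assms(3) False r by (simp add: Lp_norm_fun_def r_def)
  then have "AE x in unit_lebesgue. \<bar>f x\<bar> powr r = 0"
    using integral_nonneg_eq_0_iff_AE[OF int] by simp
  then show ?thesis
    by simp
qed

lemma Lp_triangle_fun:
  assumes p: "1 \<le> p" and f: "Lp_fun p f" and g: "Lp_fun p g"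
  shows "Lp_fun p (\<lambda>x. f x + g x)"
    and "Lp_norm_fun p (\<lambda>x. f x + g x) \<le> Lp_norm_fun p f + Lp_norm_fun p g"
proof -
  have [measurable]: "f \<in> borel_measurable unit_lebesgue" "g \<in> borel_measurable unit_lebesgue"
    using f g by (auto simp: Lp_fun_def)
  have "Lp_fun p (\<lambda>x. f x + g x) \<and>
      Lp_norm_fun p (\<lambda>x. f x + g x) \<le> Lp_norm_fun p f + Lp_norm_fun p g"
  proof (cases "p = \<infinity>")
    case True
    then have "AE x in unit_lebesgue. \<bar>f x + g x\<bar> \<le> Lp_norm_fun p f + Lp_norm_fun p g"
      using Linf_bound[of f] Linf_bound[of g] f g by (auto elim!: eventually_elim2)
    then show ?thesis
      using Linf_I[of "\<lambda>x. f x + g x"] True by auto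
  next
    case False
    define r where "r = real_of_ereal p"
    have r: "1 \<le> r"
      using p False unfolding r_def by (cases p) auto
    have nrm: "Lp_norm_fun p h = (LINT x|unit_lebesgue. \<bar>h x\<bar> powr r) powr (1 / r)" for h
      using False by (simp add: Lp_norm_fun_def r_def)
    have nrm': "Lp_norm_fun p h powr r = (LINT x|unit_lebesgue. \<bar>h x\<bar> powr r)" for h
      using r by (simp add: nrm powr_powr)
    have intf: "integrable unit_lebesgue (\<lambda>x. \<bar>f x\<bar> powr r)"
      and intg: "integrable unit_lebesgue (\<lambda>x. \<bar>g x\<bar> powr r)"
      using f g False by (auto simp: Lp_fun_def r_def)
    have key: "integrable unit_lebesgue (\<lambda>x. \<bar>f x + g x\<bar> powr r) \<and>
        Lp_norm_fun p (\<lambda>x. f x + g x) \<le> a + b"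
      if a: "a > 0" "Lp_norm_fun p f \<le> a" and b: "b > 0" "Lp_norm_fun p g \<le> b" for a b
    proof -
      define H where "H x = (a + b) powr r *
        (a / (a + b) * (\<bar>f x\<bar> powr r / a powr r) + b / (a + b) * (\<bar>g x\<bar> powr r / b powr r))" for x
      have intH: "integrable unit_lebesgue H"
        unfolding H_def by (intro integrable_mult_right Bochner_Integration.integrable_add
          integrable_divide intf intg)
      have le: "\<bar>f x + g x\<bar> powr r \<le> H x" for x
      proof -
        have "\<bar>f x + g x\<bar> powr r \<le> (\<bar>f x\<bar> + \<bar>g x\<bar>) powr r"
          using r by (intro powr_mono2) auto
        also have "\<dots> \<le> H x"
          using powr_convex_ineq[of r a b "\<bar>f x\<bar>" "\<bar>g x\<bar>"] r a b
          by (simp add: H_def powr_divide)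
        finally show ?thesis .
      qed
      have int: "integrable unit_lebesgue (\<lambda>x. \<bar>f x + g x\<bar> powr r)"
        by (rule Bochner_Integration.integrable_bound[OF intH])
          (use le in \<open>auto intro: order_trans[OF le abs_ge_self]\<close>)
      have "(LINT x|unit_lebesgue. \<bar>f x + g x\<bar> powr r) \<le> (LINT x|unit_lebesgue. H x)"
        using le by (intro integral_mono int intH)
      also have "\<dots> = (a + b) powr r * (a / (a + b) * (Lp_norm_fun p f powr r / a powr r)
          + b / (a + b) * (Lp_norm_fun p g powr r / b powr r))"
        unfolding H_def nrm' using intf intg by simp
      also have "\<dots> \<le> (a + b) powr r * (a / (a + b) * 1 + b / (a + b) * 1)"
        using a b r by (intro mult_left_mono add_mono)
          (auto simp: divide_le_eq_1 intro!: powr_mono2 Lp_norm_fun_nonneg)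
      also have "\<dots> = (a + b) powr r"
        using a b by (simp add: add_divide_distrib[symmetric])
      finally have "Lp_norm_fun p (\<lambda>x. f x + g x) \<le> ((a + b) powr r) powr (1 / r)"
        unfolding nrm using r by (intro powr_mono2) auto
      also have "\<dots> = a + b"
        using a b r by (simp add: powr_powr)
      finally show ?thesis
        using int by simp
    qed
    have "Lp_norm_fun p (\<lambda>x. f x + g x) \<le> Lp_norm_fun p f + Lp_norm_fun p g"
    proof (rule field_le_epsilon)
      fix e :: real assume "0 < e"
      then show "Lp_norm_fun p (\<lambda>x. f x + g x) \<le> Lp_norm_fun p f + Lp_norm_fun p g + e"
        using key[of "Lp_norm_fun p f + e / 2" "Lp_norm_fun p g + e / 2"]
          Lp_norm_fun_nonneg[of p f] Lp_norm_fun_nonneg[of p g] by (auto simp: add_pos_nonneg)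
    qed
    moreover have "Lp_fun p (\<lambda>x. f x + g x)"
      using key[of "Lp_norm_fun p f + 1" "Lp_norm_fun p g + 1"] False
        Lp_norm_fun_nonneg[of p f] Lp_norm_fun_nonneg[of p g]
      by (auto simp: Lp_fun_def r_def add_pos_nonneg)
    ultimately show ?thesis
      by simp
  qed
  then show "Lp_fun p (\<lambda>x. f x + g x)"
    "Lp_norm_fun p (\<lambda>x. f x + g x) \<le> Lp_norm_fun p f + Lp_norm_fun p g"
    by auto
qed

lemma Lp_norm_nonneg: "0 \<le> Lp_norm p F"
  by transfer (rule Lp_norm_fun_nonneg)

lemma in_Lp_add: "1 \<le> p \<Longrightarrow> in_Lp p F \<Longrightarrow> in_Lp p G \<Longrightarrow> in_Lp p (F + G)"
  by transfer (rule Lp_triangle_fun(1))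

lemma Lp_norm_triangle:
  "1 \<le> p \<Longrightarrow> in_Lp p F \<Longrightarrow> in_Lp p G \<Longrightarrow> Lp_norm p (F + G) \<le> Lp_norm p F + Lp_norm p G"
  by transfer (rule Lp_triangle_fun(2))

lemma in_Lp_uminus [simp]: "in_Lp p (- F) \<longleftrightarrow> in_Lp p F"
proof transfer
  fix p f assume "ae_eq f f"
  then show "Lp_fun p (\<lambda>x. - f x) \<longleftrightarrow> Lp_fun p f"
    by (simp add: Lp_fun_def ae_eq_def)
qed

lemma Lp_norm_uminus [simp]: "Lp_norm p (- F) = Lp_norm p F"
  by transfer (simp add: Lp_norm_fun_def)

lemma in_Lp_diff: "1 \<le> p \<Longrightarrow> in_Lp p F \<Longrightarrow> in_Lp p G \<Longrightarrow> in_Lp p (F - G)"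
  using in_Lp_add[of p F "- G"] by simp

lemma Lp_norm_zero [simp]: "1 \<le> p \<Longrightarrow> Lp_norm p 0 = 0"
proof transfer
  fix p :: ereal assume "1 \<le> p"
  have "Lp_norm_fun \<infinity> (\<lambda>_. 0) \<le> 0"
    by (rule Linf_I) auto
  then have "Lp_norm_fun \<infinity> (\<lambda>_. 0) = 0"
    using Lp_norm_fun_nonneg[of \<infinity> "\<lambda>_. 0"] by linarith
  then show "Lp_norm_fun p (\<lambda>_. 0) = 0"
    by (cases "p = \<infinity>") (simp_all add: Lp_norm_fun_def)
qed

lemma Lp_norm_eq_0: "1 \<le> p \<Longrightarrow> in_Lp p F \<Longrightarrow> Lp_norm p F = 0 \<longleftrightarrow> F = 0"
proof
  assume "1 \<le> p" "in_Lp p F" "Lp_norm p F = 0"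
  then show "F = 0"
  proof transfer
    fix p f
    assume "1 \<le> p" "ae_eq f f" "Lp_fun p f" "Lp_norm_fun p f = 0"
    then show "ae_eq f (\<lambda>_. 0)"
      using Lp_norm_fun_eq_0[of p f] by (simp add: ae_eq_def)
  qed
qed auto

definition Lp_metric :: "ereal \<Rightarrow> L0 metric" where
  "Lp_metric p = metric ({F. in_Lp p F}, \<lambda>F G. Lp_norm p (F - G))"

lemma Metric_space_Lp:
  assumes "1 \<le> p"
  shows "Metric_space {F. in_Lp p F} (\<lambda>F G. Lp_norm p (F - G))"
proof
  show "0 \<le> Lp_norm p (F - G)" for F G
    by (rule Lp_norm_nonneg)
  show "Lp_norm p (F - G) = Lp_norm p (G - F)" for F G
    using Lp_norm_uminus[of p "F - G"] by simp
  show "Lp_norm p (F - G) = 0 \<longleftrightarrow> F = G" if "F \<in> {F. in_Lp p F}" "G \<in> {F. in_Lp p F}" for F G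
    using that assms Lp_norm_eq_0[of p "F - G"] in_Lp_diff[of p F G] by simp
  show "Lp_norm p (F - H) \<le> Lp_norm p (F - G) + Lp_norm p (G - H)"
    if "F \<in> {F. in_Lp p F}" "G \<in> {F. in_Lp p F}" "H \<in> {F. in_Lp p F}" for F G H
    using that assms Lp_norm_triangle[of p "F - G" "G - H"] in_Lp_diff[of p] by simp
qed

lemma
  assumes "1 \<le> p"
  shows mspace_Lp_metric: "mspace (Lp_metric p) = {F. in_Lp p F}"
    and mdist_Lp_metric: "mdist (Lp_metric p) = (\<lambda>F G. Lp_norm p (F - G))"
  using Metric_space_Lp[OF assms]
  by (simp_all add: Lp_metric_def Metric_space.mspace_metric Metric_space.mdist_metric)

definition Lp_unit_ball :: "ereal \<Rightarrow> L0 set" where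
  "Lp_unit_ball p = {F. in_Lp p F \<and> Lp_norm p F \<le> 1}"

section \<open>The Riemann-Liouville operator\<close>

text \<open>For \<open>\<alpha> < 1\<close> and \<open>f \<in> L\<^sub>p\<close> the integral exists for almost every \<open>t \<in> [0,1]\<close> only; on the
  exceptional null set the library integral has the value 0.\<close>

definition riemann_liouville_fun :: "real \<Rightarrow> (real \<Rightarrow> real) \<Rightarrow> real \<Rightarrow> real" where
  "riemann_liouville_fun \<alpha> f t =
     1 / Gamma \<alpha> * (LINT x:{0..t}|lebesgue. (t - x) powr (\<alpha> - 1) * f x)"

lemma riemann_liouville_fun_cong:
  assumes f: "f \<in> borel_measurable unit_lebesgue" and g: "g \<in> borel_measurable unit_lebesgue"
    and ae: "AE x in unit_lebesgue. f x = g x" and t: "t \<in> {0..1}"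
  shows "riemann_liouville_fun \<alpha> f t = riemann_liouville_fun \<alpha> g t"
proof -
  have kernel: "(\<lambda>x. (t - x) powr (\<alpha> - 1)) \<in> borel_measurable lebesgue"
    by (rule measurable_completion) simp
  have eq: "indicat_real {0..t} x *\<^sub>R ((t - x) powr (\<alpha> - 1) * h x)
      = indicat_real {0..t} x * ((t - x) powr (\<alpha> - 1) * (if x \<in> {0..1} then h x else 0))" for h x
    using t by (auto simp: indicator_def)
  have meas: "(\<lambda>x. indicat_real {0..t} x *\<^sub>R ((t - x) powr (\<alpha> - 1) * h x)) \<in> borel_measurable lebesgue"
    if "h \<in> borel_measurable unit_lebesgue" for h
  proof -
    have "(\<lambda>x. if x \<in> {0..1} then h x else 0) \<in> borel_measurable lebesgue"
      using that by (subst borel_measurable_if) auto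
    then show ?thesis
      unfolding eq using kernel by (intro borel_measurable_times borel_measurable_indicator) auto
  qed
  have "AE x in lebesgue. x \<in> {0..1} \<longrightarrow> f x = g x"
    using ae by (subst (asm) AE_restrict_space_iff) auto
  then have "AE x in lebesgue. indicat_real {0..t} x *\<^sub>R ((t - x) powr (\<alpha> - 1) * f x)
      = indicat_real {0..t} x *\<^sub>R ((t - x) powr (\<alpha> - 1) * g x)"
    by eventually_elim (use t in \<open>auto simp: indicator_def\<close>)
  then show ?thesis
    unfolding riemann_liouville_fun_def set_lebesgue_integral_def
    by (simp only: integral_cong_AE[OF meas[OF f] meas[OF g]])
qed

lemma riemann_liouville_fun_measurable:
  assumes f: "f \<in> borel_measurable unit_lebesgue"
  shows "riemann_liouville_fun \<alpha> f \<in> borel_measurable unit_lebesgue"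
proof -
  have "(\<lambda>x. if x \<in> {0..1} then f x else 0) \<in> borel_measurable lebesgue"
    using f by (subst borel_measurable_if) auto
  then obtain g where g[measurable]: "g \<in> borel_measurable borel"
    and ae: "AE x in lborel. (if x \<in> {0..1} then f x else 0) = g x"
    using completion_ex_borel_measurable_real[of "\<lambda>x. if x \<in> {0..1} then f x else 0" lborel]
    by auto
  have g': "g \<in> borel_measurable unit_lebesgue"
    by (rule measurable_restrict_space1, rule measurable_completion) simp
  have ae': "AE x in unit_lebesgue. f x = g x"
    using AE_completion[OF ae] by (subst AE_restrict_space_iff) (auto elim: eventually_mono)
  have "riemann_liouville_fun \<alpha> g
      = (\<lambda>t. 1 / Gamma \<alpha> * (LINT x|lborel. indicator {0..t} x * ((t - x) powr (\<alpha> - 1) * g x)))"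
    unfolding riemann_liouville_fun_def set_lebesgue_integral_def
    by (subst integral_completion) auto
  also have "\<dots> = (\<lambda>t. 1 / Gamma \<alpha> * (LINT x|lborel.
      (if 0 \<le> x \<and> x \<le> t then 1 else 0) * ((t - x) powr (\<alpha> - 1) * g x)))"
    by (simp add: indicator_def of_bool_def)
  also have "\<dots> \<in> borel_measurable borel"
    by measurable
  finally have "riemann_liouville_fun \<alpha> g \<in> borel_measurable unit_lebesgue"
    by (intro measurable_restrict_space1 measurable_completion) simp
  moreover have "riemann_liouville_fun \<alpha> f t = riemann_liouville_fun \<alpha> g t"
    if "t \<in> space unit_lebesgue" for t
    using that by (intro riemann_liouville_fun_cong f g' ae') (simp add: space_restrict_space)
  ultimately show ?thesis
    by (subst measurable_cong) auto
qed

lift_definition riemann_liouville :: "real \<Rightarrow> L0 \<Rightarrow> L0" is riemann_liouville_fun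
proof -
  fix \<alpha> f g
  assume "ae_eq f g"
  then have fg: "f \<in> borel_measurable unit_lebesgue" "g \<in> borel_measurable unit_lebesgue"
    "AE x in unit_lebesgue. f x = g x"
    by (auto simp: ae_eq_def)
  then show "ae_eq (riemann_liouville_fun \<alpha> f) (riemann_liouville_fun \<alpha> g)"
    unfolding ae_eq_def
    by (intro conjI riemann_liouville_fun_measurable AE_I2)
      (auto intro!: riemann_liouville_fun_cong simp: space_restrict_space)
qed

section \<open>Entropy numbers\<close>

text \<open>The infimum is taken in \<open>[0,\<infinity>]\<close>, so that it is \<open>\<infinity>\<close> if there is no covering at all. In
  particular \<open>entropy_number M A n < \<infinity>\<close> implies that \<open>A\<close> is a bounded subset of \<open>M\<close>.\<close>

definition entropy_number :: "'a metric \<Rightarrow> 'a set \<Rightarrow> nat \<Rightarrow> ennreal" where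
  "entropy_number M A n =
     Inf {ennreal \<epsilon> | \<epsilon>. 0 \<le> \<epsilon> \<and>
       (\<exists>x. (\<forall>i\<in>{1..n}. x i \<in> mspace M) \<and> A \<subseteq> (\<Union>i\<in>{1..n}. mcball_of M (x i) \<epsilon>))}"

definition dyadic_entropy_number :: "'a metric \<Rightarrow> 'a set \<Rightarrow> nat \<Rightarrow> ennreal" where
  "dyadic_entropy_number M A n = entropy_number M A (2 ^ (n - 1))"

text \<open>The entropy numbers of an operator from \<open>L\<^sub>p\<close> to \<open>L\<^sub>q\<close>. They are infinite if the operator does
  not map \<open>L\<^sub>p\<close> boundedly into \<open>L\<^sub>q\<close>.\<close>

definition operator_entropy_number :: "ereal \<Rightarrow> ereal \<Rightarrow> (L0 \<Rightarrow> L0) \<Rightarrow> nat \<Rightarrow> ennreal" where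
  "operator_entropy_number p q T n =
     dyadic_entropy_number (Lp_metric q) (T ` Lp_unit_ball p) n"

text \<open>Two-sided equivalence of sequences indexed by the positive integers.\<close>

definition weakly_equiv :: "(nat \<Rightarrow> ennreal) \<Rightarrow> (nat \<Rightarrow> ennreal) \<Rightarrow> bool"  (infix "\<asymp>" 50) where
  "x \<asymp> y \<longleftrightarrow> (\<exists>c C::real. 0 < c \<and> 0 < C \<and>
     (\<forall>n\<ge>1. ennreal c * y n \<le> x n \<and> x n \<le> ennreal C * y n))"

end

theory Submission
  imports Defs "HOL-Probability.Probability_Measure"
begin

text \<open>
Write \<open>R\<close> for the operator of order \<open>a\<close>. On the line it is convolution with the kernel
\<open>u\<^sup>a\<^sup>-\<^sup>1 / \<Gamma>(a)\<close>, \<open>u > 0\<close>, and by the Beta integral these kernels form a convolution semigroup.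

\<^bold>\<open>Lower bound.\<close> Cut the unit interval into \<open>N\<close> cells and apply \<open>R\<close> to the \<open>2\<^sup>N\<close> functions that are
\<open>\<plusminus>1\<close> on each cell; they lie in every unit ball. \<open>R\<close> is causal: on cell \<open>i\<close> the image depends only on
the first \<open>i + 1\<close> signs, and reversing the last of them changes the integral over that cell by a
fixed amount \<open>2d\<close>, with \<open>d\<close> of order \<open>N\<^sup>-\<^sup>a\<^sup>-\<^sup>1\<close>. So for a given centre and given earlier signs, at most
one choice of the next sign stays closer than \<open>d\<close> to the centre on the cell. A function within
\<open>L\<^sub>1\<close>-distance \<open>\<epsilon>\<close> of the centre can make a far choice at most \<open>\<epsilon>/d\<close> times, so if \<open>\<epsilon>\<close> is a small
multiple of \<open>d N\<close>, of order \<open>N\<^sup>-\<^sup>a\<close>, one ball captures an exponentially small fraction of the images.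
This replaces the usual volume comparison (\<open>near_sign_images_card\<close>, \<open>operator_entropy_number_ge\<close>).

\<^bold>\<open>Upper bound for order below one.\<close> Take \<open>p < \<infinity>\<close>, \<open>p \<le> q\<close>. The mean of \<open>R f\<close> over a dyadic cell is
an integral of \<open>f\<close> against first differences of the kernel of order \<open>a + 1\<close>, and the difference of
means over two sibling cells is an integral against second differences. That kernel is concave on the
half line, so its second differences telescope, and a Schur test bounds the \<open>\<ell>\<^sub>p\<close> norm of the details of
level \<open>k\<close>, normalized by the number \<open>2\<^sup>k\<close> of cells, by a constant times \<open>2\<^sup>-\<^sup>k\<^sup>a\<close> (\<open>sum_detail_le\<close>).
Truncate the details to a multiple of a step size chosen for each level. The resulting integer
vectors lie in an \<open>\<ell>\<^sub>1\<close> ball, because \<open>\<bar>z\<bar> \<le> \<bar>z\<bar>\<^sup>p\<close> for integers, and they are counted by a generating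
function. Fix \<open>J\<close>. Below level \<open>J\<close> the step shrinks and all coefficients are resolved; above it the
step grows relative to the details, slowly enough that the \<open>L\<^sub>q\<close> errors, which interpolate between
the step and the detail norm, still decay (here \<open>a > 1/p - 1/q\<close> enters), and fast enough that few
nonzero coefficients remain. Errors add up to order \<open>2\<^sup>-\<^sup>J\<^sup>a\<close> and the logarithm of the number of choices
to order \<open>2\<^sup>J\<close> (\<open>sum_level_error_le\<close>, \<open>sum_level_log_card_le\<close>). The dyadic means converge to \<open>R f\<close> almost
everywhere, so Fatou's lemma transfers the bound to \<open>R f\<close> itself (\<open>rl_conv_net\<close>).

\<^bold>\<open>All orders and exponents.\<close> Covering numbers multiply and radii multiply under composition. Writing \<open>R\<close> as the square of the
operator of order \<open>a/2\<close>, through the space whose reciprocal exponent is the midpoint of \<open>1/p\<close>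
and \<open>1/q\<close>, halves both the order and the gap \<open>1/p - 1/q\<close>; iterating reaches orders below one
(\<open>riemann_liouville_nets_finite\<close>). If \<open>p > q\<close> or \<open>p = \<infinity>\<close>, the unit ball of \<open>L\<^sub>p\<close> lies in a multiple of
that of a space with smaller finite exponent to which the previous case applies.
\<close>

section \<open>Norm bounds and almost everywhere limits\<close>

lemma prob_space_unit_lebesgue: "prob_space unit_lebesgue"
  by (rule prob_spaceI) (simp add: emeasure_restrict_space space_restrict_space)

interpretation unit_lebesgue: prob_space unit_lebesgue
  by (rule prob_space_unit_lebesgue)

text \<open>Membership is part of the predicate because the norm of a function outside the space is a default
value. In this form norm bounds are stable under sums, almost everywhere limits and change of exponent.\<close>

definition Lp_le :: "ereal \<Rightarrow> real \<Rightarrow> (real \<Rightarrow> real) \<Rightarrow> bool" where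
  "Lp_le q E f \<longleftrightarrow> Lp_fun q f \<and> Lp_norm_fun q f \<le> E"

lemma Lp_le_measurable: "Lp_le q E f \<Longrightarrow> f \<in> borel_measurable unit_lebesgue"
  by (auto simp: Lp_le_def Lp_fun_def)

lemma Lp_le_nonneg: "Lp_le q E f \<Longrightarrow> 0 \<le> E"
  using Lp_norm_fun_nonneg[of q f] by (auto simp: Lp_le_def)

lemma Lp_le_mono: "Lp_le q E f \<Longrightarrow> E \<le> E' \<Longrightarrow> Lp_le q E' f"
  by (auto simp: Lp_le_def)

lemma Lp_le_add:
  assumes "1 \<le> q" "Lp_le q A f" "Lp_le q B g"
  shows "Lp_le q (A + B) (\<lambda>x. f x + g x)"
  using Lp_triangle_fun[of q f g] assms by (auto simp: Lp_le_def)

lemma Lp_le_cong: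
  assumes "Lp_le q E f" "g \<in> borel_measurable unit_lebesgue" "AE x in unit_lebesgue. f x = g x"
  shows "Lp_le q E g"
proof -
  have "ae_eq f g"
    using assms Lp_le_measurable[OF assms(1)] by (auto simp: ae_eq_def)
  then show ?thesis
    using assms Lp_fun_cong Lp_norm_fun_cong by (metis Lp_le_def)
qed

lemma Lp_le_infinity_iff:
  assumes "0 \<le> E"
  shows "Lp_le \<infinity> E f \<longleftrightarrow> f \<in> borel_measurable unit_lebesgue \<and> (AE x in unit_lebesgue. \<bar>f x\<bar> \<le> E)"
proof
  assume "Lp_le \<infinity> E f"
  then show "f \<in> borel_measurable unit_lebesgue \<and> (AE x in unit_lebesgue. \<bar>f x\<bar> \<le> E)"
    using Linf_bound[of f] by (auto simp: Lp_le_def Lp_fun_def elim!: eventually_mono)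
next
  assume "f \<in> borel_measurable unit_lebesgue \<and> (AE x in unit_lebesgue. \<bar>f x\<bar> \<le> E)"
  then show "Lp_le \<infinity> E f"
    using Linf_I[of f E] by (auto simp: Lp_le_def)
qed

lemma Lp_le_finite_iff:
  assumes "1 \<le> r" "0 \<le> E"
  shows "Lp_le (ereal r) E f \<longleftrightarrow> f \<in> borel_measurable unit_lebesgue \<and>
    (\<integral>\<^sup>+x. ennreal (\<bar>f x\<bar> powr r) \<partial>unit_lebesgue) \<le> ennreal (E powr r)"
proof (cases "f \<in> borel_measurable unit_lebesgue")
  case [measurable]: True
  let ?I = "LINT x|unit_lebesgue. \<bar>f x\<bar> powr r"
  have norm: "?I powr (1 / r) \<le> E \<longleftrightarrow> ?I \<le> E powr r"
  proof
    assume "?I powr (1 / r) \<le> E"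
    then have "(?I powr (1 / r)) powr r \<le> E powr r"
      using assms by (intro powr_mono2) auto
    then show "?I \<le> E powr r"
      using assms by (simp add: powr_powr)
  next
    assume "?I \<le> E powr r"
    then have "?I powr (1 / r) \<le> (E powr r) powr (1 / r)"
      using assms by (intro powr_mono2) auto
    then show "?I powr (1 / r) \<le> E"
      using assms by (simp add: powr_powr)
  qed
  show ?thesis
  proof (cases "integrable unit_lebesgue (\<lambda>x. \<bar>f x\<bar> powr r)")
    case True
    then have "(\<integral>\<^sup>+x. ennreal (\<bar>f x\<bar> powr r) \<partial>unit_lebesgue) = ennreal ?I"
      by (intro nn_integral_eq_integral) auto
    then show ?thesis
      using True norm by (simp add: Lp_le_def Lp_fun_def Lp_norm_fun_def)
  next
    case False
    then have "(\<integral>\<^sup>+x. ennreal (\<bar>f x\<bar> powr r) \<partial>unit_lebesgue) = \<infinity>"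
      by (auto simp: integrable_iff_bounded less_top[symmetric])
    then show ?thesis
      using False by (simp add: Lp_le_def Lp_fun_def top_unique)
  qed
qed (auto simp: Lp_le_def Lp_fun_def)

lemma ereal_ge_1_cases:
  fixes q :: ereal
  assumes "1 \<le> q"
  obtains "q = \<infinity>" | r where "q = ereal r" "1 \<le> r"
  using assms by (cases q) auto

lemma Lp_le_bounded:
  assumes q: "1 \<le> q" and [measurable]: "f \<in> borel_measurable unit_lebesgue"
    and bound: "AE x in unit_lebesgue. \<bar>f x\<bar> \<le> E" and E: "0 \<le> E"
  shows "Lp_le q E f"
  using q
proof (cases rule: ereal_ge_1_cases)
  case 1
  then show ?thesis using assms Lp_le_infinity_iff by auto
next
  case (2 r)
  have "(\<integral>\<^sup>+x. ennreal (\<bar>f x\<bar> powr r) \<partial>unit_lebesgue) \<le> (\<integral>\<^sup>+x. ennreal (E powr r) \<partial>unit_lebesgue)"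
    using bound by (intro nn_integral_mono_AE)
      (auto elim!: eventually_mono intro!: ennreal_leI powr_mono2 simp: 2 order_trans[OF _ 2(2)])
  also have "\<dots> = ennreal (E powr r)"
    using unit_lebesgue.emeasure_space_1 by simp
  finally show ?thesis
    using 2 E Lp_le_finite_iff[of r E f] by simp
qed

lemma Lp_le_cmult:
  assumes q: "1 \<le> q" and f: "Lp_le q E f"
  shows "Lp_le q (\<bar>c\<bar> * E) (\<lambda>x. c * f x)"
  using q
proof (cases rule: ereal_ge_1_cases)
  case 1
  then show ?thesis
    using f Lp_le_nonneg[OF f] by (auto simp: Lp_le_infinity_iff abs_mult elim!: eventually_mono intro: mult_left_mono)
next
  case (2 r)
  have [measurable]: "f \<in> borel_measurable unit_lebesgue"
    using f by (rule Lp_le_measurable)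
  have "(\<integral>\<^sup>+x. ennreal (\<bar>c * f x\<bar> powr r) \<partial>unit_lebesgue)
      = ennreal (\<bar>c\<bar> powr r) * (\<integral>\<^sup>+x. ennreal (\<bar>f x\<bar> powr r) \<partial>unit_lebesgue)"
    by (subst nn_integral_cmult[symmetric]) (auto simp: abs_mult powr_mult ennreal_mult)
  also have "\<dots> \<le> ennreal (\<bar>c\<bar> powr r) * ennreal (E powr r)"
    using f 2 Lp_le_nonneg[OF f] by (intro mult_left_mono) (auto simp: Lp_le_finite_iff)
  also have "\<dots> = ennreal ((\<bar>c\<bar> * E) powr r)"
    using Lp_le_nonneg[OF f] by (simp add: ennreal_mult powr_mult)
  finally show ?thesis
    using 2 Lp_le_nonneg[OF f] by (simp add: Lp_le_finite_iff)
qed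

lemma Lp_le_diff:
  assumes "1 \<le> q" "Lp_le q A f" "Lp_le q B g"
  shows "Lp_le q (A + B) (\<lambda>x. f x - g x)"
  using Lp_le_add[OF assms(1,2) Lp_le_cmult[OF assms(1,3), of "-1"]] by simp

text \<open>Fatou's lemma: a closed ball of \<open>L\<^sub>q\<close> is closed under almost everywhere convergence.\<close>

lemma Lp_le_liminf:
  assumes q: "1 \<le> q" and f: "\<And>m. Lp_le q E (f m)"
    and [measurable]: "g \<in> borel_measurable unit_lebesgue"
    and lim: "AE x in unit_lebesgue. (\<lambda>m. f m x) \<longlonglongrightarrow> g x"
  shows "Lp_le q E g"
  using q
proof (cases rule: ereal_ge_1_cases)
  case 1
  have "AE x in unit_lebesgue. \<forall>m. \<bar>f m x\<bar> \<le> E"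
    using f Lp_le_nonneg[OF f] by (auto simp: 1 Lp_le_infinity_iff AE_all_countable)
  with lim have "AE x in unit_lebesgue. \<bar>g x\<bar> \<le> E"
    by eventually_elim (auto intro!: LIMSEQ_le_const2[OF tendsto_rabs])
  then show ?thesis
    using Lp_le_nonneg[OF f] by (simp add: 1 Lp_le_infinity_iff)
next
  case (2 r)
  have [measurable]: "f m \<in> borel_measurable unit_lebesgue" for m
    using f by (rule Lp_le_measurable)
  have "AE x in unit_lebesgue. ennreal (\<bar>g x\<bar> powr r) \<le> liminf (\<lambda>m. ennreal (\<bar>f m x\<bar> powr r))"
    using lim
  proof eventually_elim
    case (elim x)
    have "(\<lambda>m. \<bar>f m x\<bar> powr r) \<longlonglongrightarrow> \<bar>g x\<bar> powr r"
      using 2 by (intro tendsto_powr2 tendsto_rabs elim tendsto_const) auto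
    then have "(\<lambda>m. ennreal (\<bar>f m x\<bar> powr r)) \<longlonglongrightarrow> ennreal (\<bar>g x\<bar> powr r)"
      by (rule tendsto_ennrealI)
    then show ?case
      by (metis lim_imp_Liminf order_refl trivial_limit_sequentially)
  qed
  then have "(\<integral>\<^sup>+x. ennreal (\<bar>g x\<bar> powr r) \<partial>unit_lebesgue)
      \<le> (\<integral>\<^sup>+x. liminf (\<lambda>m. ennreal (\<bar>f m x\<bar> powr r)) \<partial>unit_lebesgue)"
    by (rule nn_integral_mono_AE)
  also have "\<dots> \<le> liminf (\<lambda>m. \<integral>\<^sup>+x. ennreal (\<bar>f m x\<bar> powr r) \<partial>unit_lebesgue)"
    by (rule nn_integral_liminf) simp
  also have "\<dots> \<le> ennreal (E powr r)"
    using f 2 Lp_le_nonneg[OF f] by (intro Liminf_le) (auto simp: Lp_le_finite_iff)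
  finally show ?thesis
    using 2 Lp_le_nonneg[OF f] by (simp add: Lp_le_finite_iff)
qed

text \<open>For finite exponents \<open>r \<le> s\<close>, comparing \<open>\<bar>f\<bar>\<close> with the threshold \<open>E\<close> gives
\<open>\<bar>f\<bar>\<^sup>r \<le> E\<^sup>r + E\<^sup>r\<^sup>-\<^sup>s \<bar>f\<bar>\<^sup>s\<close>, and each summand integrates to at most \<open>E\<^sup>r\<close>. The factor 2 is the price for
avoiding Hoelder's inequality; constants are irrelevant for weak equivalence.\<close>

lemma Lp_le_embed:
  assumes p: "1 \<le> p" and pq: "p \<le> q" and f: "Lp_le q E f" and E: "0 < E"
  shows "Lp_le p (2 * E) f"
proof -
  have [measurable]: "f \<in> borel_measurable unit_lebesgue"
    using f by (rule Lp_le_measurable)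
  have q: "1 \<le> q" using p pq by simp
  show ?thesis
    using q
  proof (cases rule: ereal_ge_1_cases)
    case 1
    then have "AE x in unit_lebesgue. \<bar>f x\<bar> \<le> E"
      using f E by (simp add: Lp_le_infinity_iff)
    then show ?thesis
      using Lp_le_bounded[OF p, of f E] E Lp_le_mono[of p E f "2*E"] by simp
  next
    case (2 s)
    obtain r where r: "p = ereal r" "1 \<le> r" "r \<le> s"
      using p pq 2 by (cases p) auto
    have le: "\<bar>f x\<bar> powr r \<le> E powr r + E powr (r - s) * \<bar>f x\<bar> powr s" for x
    proof (cases "\<bar>f x\<bar> \<le> E")
      case True
      then have "\<bar>f x\<bar> powr r \<le> E powr r"
        using r by (intro powr_mono2) auto
      then show ?thesis by (simp add: add_increasing2)
    next
      case False
      then have "\<bar>f x\<bar> powr (r - s) \<le> E powr (r - s)"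
        using E r by (intro powr_mono2') auto
      then have "\<bar>f x\<bar> powr (r - s) * \<bar>f x\<bar> powr s \<le> E powr (r - s) * \<bar>f x\<bar> powr s"
        by (intro mult_right_mono) auto
      moreover have "\<bar>f x\<bar> powr (r - s) * \<bar>f x\<bar> powr s = \<bar>f x\<bar> powr r"
        using False E by (simp flip: powr_add)
      ultimately show ?thesis by (simp add: add_increasing)
    qed
    have "(\<integral>\<^sup>+x. ennreal (\<bar>f x\<bar> powr r) \<partial>unit_lebesgue)
        \<le> (\<integral>\<^sup>+x. ennreal (E powr r) + ennreal (E powr (r - s)) * ennreal (\<bar>f x\<bar> powr s) \<partial>unit_lebesgue)"
      by (intro nn_integral_mono) (simp add: le flip: ennreal_mult ennreal_plus)
    also have "\<dots> = ennreal (E powr r) + ennreal (E powr (r - s)) * (\<integral>\<^sup>+x. ennreal (\<bar>f x\<bar> powr s) \<partial>unit_lebesgue)"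
      using unit_lebesgue.emeasure_space_1 by (simp add: nn_integral_add nn_integral_cmult)
    also have "\<dots> \<le> ennreal (E powr r) + ennreal (E powr (r - s)) * ennreal (E powr s)"
      using f 2 E by (intro add_left_mono mult_left_mono) (auto simp: Lp_le_finite_iff)
    also have "\<dots> = ennreal (2 * E powr r)"
      by (simp flip: ennreal_mult ennreal_plus powr_add)
    also have "\<dots> \<le> ennreal ((2 * E) powr r)"
      using powr_mono[of 1 r "2::real"] r E by (intro ennreal_leI) (simp add: powr_mult)
    finally show ?thesis
      using r E by (simp add: Lp_le_finite_iff)
  qed
qed

text \<open>Passing to a Borel representative that vanishes outside the unit interval makes the integral
  operators below convolutions on the line, so that Fubini's theorem for \<open>lborel\<close> applies.\<close>

definition unit_supported :: "(real \<Rightarrow> real) \<Rightarrow> bool" where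
  "unit_supported g \<longleftrightarrow> g \<in> borel_measurable borel \<and> (\<forall>x. x \<notin> {0..1} \<longrightarrow> g x = 0)"

lemma unit_supportedD:
  assumes "unit_supported g"
  shows "g \<in> borel_measurable borel" "x \<notin> {0..1} \<Longrightarrow> g x = 0" "x < 0 \<Longrightarrow> g x = 0"
  using assms by (auto simp: unit_supported_def)

lemma unit_supported_representative:
  assumes "f \<in> borel_measurable unit_lebesgue"
  shows "\<exists>g. unit_supported g \<and> ae_eq f g"
proof -
  have "(\<lambda>x. if x \<in> {0..1} then f x else 0) \<in> borel_measurable lebesgue"
    using assms by (subst borel_measurable_if) auto
  then obtain g where g[measurable]: "g \<in> borel_measurable borel"
    and ae: "AE x in lborel. (if x \<in> {0..1} then f x else 0) = g x"
    using completion_ex_borel_measurable_real[of "\<lambda>x. if x \<in> {0..1} then f x else 0" lborel]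
    by auto
  define g' where "g' x = (if x \<in> {0..1} then g x else 0)" for x
  have [measurable]: "g' \<in> borel_measurable borel"
    unfolding g'_def by measurable
  have "g' \<in> borel_measurable unit_lebesgue"
    by (rule measurable_restrict_space1, rule measurable_completion) simp
  moreover have "AE x in unit_lebesgue. f x = g' x"
    using AE_completion[OF ae] by (subst AE_restrict_space_iff) (auto simp: g'_def elim: eventually_mono)
  ultimately show ?thesis
    using assms by (intro exI[of _ g']) (auto simp: g'_def ae_eq_def unit_supported_def)
qed

lemma borel_measurable_unit_lebesgue:
  "f \<in> borel_measurable borel \<Longrightarrow> f \<in> borel_measurable unit_lebesgue"
  by (rule measurable_restrict_space1, rule measurable_completion) simp

lemma nn_integral_unit_lebesgue:
  "(\<integral>\<^sup>+x. f x \<partial>unit_lebesgue) = (\<integral>\<^sup>+x. f x * indicator {0..1} x \<partial>lborel)"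
  by (simp add: nn_integral_restrict_space nn_integral_completion)

lemma AE_unit_lebesgueI:
  assumes "AE x in lborel. x \<in> {0..1} \<longrightarrow> P x"
  shows "AE x in unit_lebesgue. P x"
  using AE_completion[OF assms] by (subst AE_restrict_space_iff) auto

section \<open>Convolution with power kernels\<close>

definition rl_kernel :: "real \<Rightarrow> real \<Rightarrow> real" where
  "rl_kernel a u = (if 0 < u then u powr (a - 1) / Gamma a else 0)"

definition rl_conv :: "real \<Rightarrow> (real \<Rightarrow> real) \<Rightarrow> real \<Rightarrow> real" where
  "rl_conv a g t = (LINT x|lborel. rl_kernel a (t - x) * g x)"

lemma rl_kernel_measurable [measurable]: "rl_kernel a \<in> borel_measurable borel"
  unfolding rl_kernel_def by measurable

lemma rl_conv_measurable [measurable]: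
  assumes [measurable]: "g \<in> borel_measurable borel"
  shows "rl_conv a g \<in> borel_measurable borel"
  unfolding rl_conv_def by measurable

lemma rl_kernel_nonneg: "0 < a \<Longrightarrow> 0 \<le> rl_kernel a u"
  by (simp add: rl_kernel_def)

lemma rl_conv_eq_0: "(\<And>x. x < 0 \<Longrightarrow> g x = 0) \<Longrightarrow> t < 0 \<Longrightarrow> rl_conv a g t = 0"
proof -
  assume g: "\<And>x. x < 0 \<Longrightarrow> g x = 0" and t: "t < 0"
  have "(\<lambda>x. rl_kernel a (t - x) * g x) = (\<lambda>x. 0)"
    using g t by (auto simp: rl_kernel_def fun_eq_iff)
  then show ?thesis by (simp only: rl_conv_def integral_zero)
qed

lemma riemann_liouville_fun_eq_conv:
  assumes [measurable]: "g \<in> borel_measurable borel" and g: "\<And>x. x < 0 \<Longrightarrow> g x = 0"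
  shows "riemann_liouville_fun a g t = rl_conv a g t"
proof -
  have "riemann_liouville_fun a g t
      = 1 / Gamma a * (LINT x|lborel. indicator {0..t} x *\<^sub>R ((t - x) powr (a - 1) * g x))"
    unfolding riemann_liouville_fun_def set_lebesgue_integral_def
    by (subst integral_completion) auto
  also have "\<dots> = (LINT x|lborel. 1 / Gamma a * (indicator {0..t} x *\<^sub>R ((t - x) powr (a - 1) * g x)))"
    by (rule integral_mult_right_zero[symmetric])
  also have "\<dots> = (LINT x|lborel. rl_kernel a (t - x) * g x)"
    by (intro Bochner_Integration.integral_cong refl)
      (auto simp: rl_kernel_def indicator_def intro!: g)
  finally show ?thesis by (simp add: rl_conv_def)
qed

lemma nn_integral_abs_powr:
  assumes "0 < a"
  shows "(\<integral>\<^sup>+u. indicator {-1..1} u * ennreal (\<bar>u\<bar> powr (a - 1)) \<partial>lborel) \<le> ennreal (2 / a)"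
proof -
  have 1: "(\<integral>\<^sup>+u. indicator {0..1} u * ennreal (\<bar>u\<bar> powr (a - 1)) \<partial>lborel) = ennreal (1 / a)"
  proof -
    have "((\<lambda>u. u powr (a - 1)) has_integral (1 / a)) {0..1}"
      using has_integral_powr_from_0[of "a - 1" 1] assms by simp
    then have "((\<lambda>u. \<bar>u\<bar> powr (a - 1)) has_integral (1 / a)) {0..1}"
      by (rule has_integral_eq[rotated]) auto
    then show ?thesis
      using nn_integral_has_integral_lebesgue'[of "{0..1}" "\<lambda>u. \<bar>u\<bar> powr (a - 1)"] by (simp add: mult.commute)
  qed
  have 2: "(\<integral>\<^sup>+u. indicator {-1..0} u * ennreal (\<bar>u\<bar> powr (a - 1)) \<partial>lborel) = ennreal (1 / a)"
    by (subst nn_integral_real_affine[where c="-1" and t=0])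
      (auto simp: 1[symmetric] indicator_def intro!: nn_integral_cong)
  have "(\<integral>\<^sup>+u. indicator {-1..1} u * ennreal (\<bar>u\<bar> powr (a - 1)) \<partial>lborel)
      \<le> (\<integral>\<^sup>+u. indicator {0..1} u * ennreal (\<bar>u\<bar> powr (a - 1)) + indicator {-1..0} u * ennreal (\<bar>u\<bar> powr (a - 1)) \<partial>lborel)"
    by (intro nn_integral_mono) (auto simp: indicator_def)
  also have "\<dots> = ennreal (2 / a)"
    using assms by (subst nn_integral_add) (auto simp: 1 2 simp flip: ennreal_plus)
  finally show ?thesis .
qed

text \<open>The kernel is integrable in \<open>t\<close> uniformly in \<open>x\<close>, so Tonelli's theorem applies. The two-sided kernel
is needed because the dyadic means considered later also see points slightly to the right of \<open>t\<close>.\<close>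

lemma AE_integrable_abs_powr:
  assumes a: "0 < a" and g: "unit_supported g" "integrable lborel g"
  shows "AE t in lborel. t \<in> {0..1} \<longrightarrow> integrable lborel (\<lambda>x. \<bar>t - x\<bar> powr (a - 1) * g x)"
proof -
  have [measurable]: "g \<in> borel_measurable borel"
    using g by (simp add: unit_supportedD)
  let ?H = "\<lambda>(t::real) (x::real). indicator {0..1} t * (ennreal (\<bar>t - x\<bar> powr (a - 1)) * ennreal \<bar>g x\<bar>) :: ennreal"
  have inner: "(\<integral>\<^sup>+t. ?H t x \<partial>lborel) \<le> ennreal (2 / a) * ennreal \<bar>g x\<bar>" for x
  proof (cases "x \<in> {0..1}")
    case True
    have "(\<integral>\<^sup>+t. ?H t x \<partial>lborel) = (\<integral>\<^sup>+u. ?H (x + 1 * u) x \<partial>lborel)"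
      by (subst nn_integral_real_affine[where c=1 and t=x]) auto
    also have "\<dots> \<le> (\<integral>\<^sup>+u. (indicator {-1..1} u * ennreal (\<bar>u\<bar> powr (a - 1))) * ennreal \<bar>g x\<bar> \<partial>lborel)"
      using True by (intro nn_integral_mono) (auto simp: indicator_def)
    also have "\<dots> = (\<integral>\<^sup>+u. indicator {-1..1} u * ennreal (\<bar>u\<bar> powr (a - 1)) \<partial>lborel) * ennreal \<bar>g x\<bar>"
      by (rule nn_integral_multc) measurable
    also have "\<dots> \<le> ennreal (2 / a) * ennreal \<bar>g x\<bar>"
      by (intro mult_right_mono nn_integral_abs_powr a) auto
    finally show ?thesis .
  qed (simp add: unit_supportedD[OF g(1)])
  have "(\<integral>\<^sup>+t. (\<integral>\<^sup>+x. ?H t x \<partial>lborel) \<partial>lborel) = (\<integral>\<^sup>+x. (\<integral>\<^sup>+t. ?H t x \<partial>lborel) \<partial>lborel)"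
    by (rule lborel_pair.Fubini') measurable
  also have "\<dots> \<le> (\<integral>\<^sup>+x. ennreal (2 / a) * ennreal \<bar>g x\<bar> \<partial>lborel)"
    by (intro nn_integral_mono inner)
  also have "\<dots> < \<infinity>"
    using g(2) by (simp add: nn_integral_cmult integrable_iff_bounded ennreal_mult_less_top)
  finally have "AE t in lborel. (\<integral>\<^sup>+x. ?H t x \<partial>lborel) \<noteq> \<infinity>"
    by (intro nn_integral_noteq_infinite) auto
  then show ?thesis
  proof eventually_elim
    case (elim t)
    then show ?case
      by (auto simp: integrable_iff_bounded abs_mult ennreal_mult less_top)
  qed
qed

lemma AE_integrable_rl_kernel:
  assumes a: "0 < a" and g: "unit_supported g" "integrable lborel g"
  shows "AE t in lborel. t \<in> {0..1} \<longrightarrow> integrable lborel (\<lambda>x. rl_kernel a (t - x) * g x)"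
  using AE_integrable_abs_powr[OF a g]
proof eventually_elim
  case (elim t)
  have [measurable]: "g \<in> borel_measurable borel"
    using g by (simp add: unit_supportedD)
  show ?case
  proof
    assume "t \<in> {0..1}"
    then have "integrable lborel (\<lambda>x. 1 / Gamma a * (\<bar>t - x\<bar> powr (a - 1) * g x))"
      using elim by (intro integrable_mult_right) auto
    then show "integrable lborel (\<lambda>x. rl_kernel a (t - x) * g x)"
      by (rule Bochner_Integration.integrable_bound) (auto simp: rl_kernel_def abs_mult)
  qed
qed

text \<open>The Beta integral, scaled to the interval from \<open>x\<close> to \<open>t\<close>.\<close>

lemma nn_integral_rl_kernel_mult:
  assumes a: "0 < a" and b: "0 < b"
  shows "(\<integral>\<^sup>+s. ennreal (rl_kernel a (t - s) * rl_kernel b (s - x)) \<partial>lborel) = ennreal (rl_kernel (a + b) (t - x))"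
proof (cases "x < t")
  case False
  then have "(\<lambda>s. ennreal (rl_kernel a (t - s) * rl_kernel b (s - x))) = (\<lambda>s. 0)"
    by (auto simp: rl_kernel_def fun_eq_iff)
  then show ?thesis using False by (simp only: nn_integral_const) (simp add: rl_kernel_def)
next
  case True
  define c where "c = t - x"
  have c: "0 < c" using True by (simp add: c_def)
  have Beta: "((\<lambda>v. v powr (b - 1) * (1 - v) powr (a - 1)) has_integral Beta b a) {0..1}"
    by (rule has_integral_Beta_real) (use a b in auto)
  have BetaG: "Beta b a = Gamma a * Gamma b / Gamma (a + b)"
    by (simp add: Beta_def add.commute)
  have eq: "rl_kernel a (t - (x + c * v)) * rl_kernel b (x + c * v - x)
      = c powr (a + b - 2) / (Gamma a * Gamma b) * (indicator {0..1} v * (v powr (b - 1) * (1 - v) powr (a - 1)))"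
    (is "?L v = ?R v") for v
  proof (cases "0 < v \<and> v < 1")
    case True
    have "t - (x + c * v) = c * (1 - v)" by (simp add: c_def algebra_simps)
    then have "?L v = (c * (1 - v)) powr (a - 1) / Gamma a * ((c * v) powr (b - 1) / Gamma b)"
      using True c by (simp add: rl_kernel_def)
    also have "\<dots> = (c powr (a - 1) * c powr (b - 1)) / (Gamma a * Gamma b) * (v powr (b - 1) * (1 - v) powr (a - 1))"
      using True c by (simp add: powr_mult)
    also have "c powr (a - 1) * c powr (b - 1) = c powr (a + b - 2)"
      by (simp flip: powr_add add: algebra_simps)
    finally show ?thesis using True by simp
  next
    case False
    have *: "t - (x + c * v) = c * (1 - v)" by (simp add: c_def algebra_simps)
    have "?L v = 0"
      unfolding * using False c by (auto simp: rl_kernel_def zero_less_mult_iff)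
    moreover have "?R v = 0"
      using False by (cases "v = 0 \<or> v = 1") (auto simp: indicator_def)
    ultimately show ?thesis by (simp only:)
  qed
  have "(\<integral>\<^sup>+s. ennreal (rl_kernel a (t - s) * rl_kernel b (s - x)) \<partial>lborel)
      = ennreal c * (\<integral>\<^sup>+v. ennreal (rl_kernel a (t - (x + c * v)) * rl_kernel b (x + c * v - x)) \<partial>lborel)"
    using c by (subst nn_integral_real_affine[where c=c and t=x]) auto
  also have "\<dots> = ennreal c * (\<integral>\<^sup>+v. ennreal (c powr (a + b - 2) / (Gamma a * Gamma b)) *
      (indicator {0..1} v * ennreal (v powr (b - 1) * (1 - v) powr (a - 1))) \<partial>lborel)"
    unfolding eq using a b
    by (intro arg_cong2[where f="(*)"] refl nn_integral_cong) (auto simp: indicator_def simp flip: ennreal_mult)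
  also have "\<dots> = ennreal c * (ennreal (c powr (a + b - 2) / (Gamma a * Gamma b)) *
      (\<integral>\<^sup>+v. indicator {0..1} v * ennreal (v powr (b - 1) * (1 - v) powr (a - 1)) \<partial>lborel))"
    by (subst nn_integral_cmult) auto
  also have "(\<integral>\<^sup>+v. indicator {0..1} v * ennreal (v powr (b - 1) * (1 - v) powr (a - 1)) \<partial>lborel) = ennreal (Beta b a)"
    using nn_integral_has_integral_lebesgue'[OF _ Beta] by (simp add: mult.commute)
  also have "ennreal c * (ennreal (c powr (a + b - 2) / (Gamma a * Gamma b)) * ennreal (Beta b a))
      = ennreal (c * (c powr (a + b - 2) / (Gamma a * Gamma b) * Beta b a))"
    using a b c by (simp add: BetaG flip: ennreal_mult)
  also have "c * (c powr (a + b - 2) / (Gamma a * Gamma b) * Beta b a) = (c * c powr (a + b - 2)) / Gamma (a + b)"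
    using Gamma_real_pos[OF a] Gamma_real_pos[OF b] by (simp add: BetaG)
  also have "c * c powr (a + b - 2) = c powr (a + b - 1)"
    using c by (simp add: powr_mult_base)
  finally show ?thesis
    using c by (simp add: rl_kernel_def c_def)
qed

text \<open>Applied to absolute values, the Beta integral also supplies the integrability that Fubini's theorem
requires.\<close>

lemma rl_conv_rl_conv:
  assumes a: "0 < a" and b: "0 < b" and [measurable]: "g \<in> borel_measurable borel"
    and int: "integrable lborel (\<lambda>x. rl_kernel (a + b) (t - x) * g x)"
  shows "rl_conv a (rl_conv b g) t = rl_conv (a + b) g t"
proof -
  let ?k = "\<lambda>x s. rl_kernel a (t - s) * rl_kernel b (s - x)"
  have nn: "(\<integral>\<^sup>+s. ennreal (norm (?k x s * g x)) \<partial>lborel) = ennreal (norm (rl_kernel (a + b) (t - x) * g x))" for x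
  proof -
    have "(\<integral>\<^sup>+s. ennreal (norm (?k x s * g x)) \<partial>lborel) = (\<integral>\<^sup>+s. ennreal (?k x s) * ennreal \<bar>g x\<bar> \<partial>lborel)"
      using a b by (intro nn_integral_cong) (simp add: abs_mult rl_kernel_nonneg ennreal_mult')
    also have "\<dots> = (\<integral>\<^sup>+s. ennreal (?k x s) \<partial>lborel) * ennreal \<bar>g x\<bar>"
      by (rule nn_integral_multc) measurable
    also have "\<dots> = ennreal (norm (rl_kernel (a + b) (t - x) * g x))"
      unfolding nn_integral_rl_kernel_mult[OF a b]
      using a b by (simp add: abs_mult rl_kernel_nonneg ennreal_mult')
    finally show ?thesis .
  qed
  have "(\<integral>\<^sup>+z. ennreal (norm ((\<lambda>(x, s). ?k x s * g x) z)) \<partial>(lborel \<Otimes>\<^sub>M lborel))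
      = (\<integral>\<^sup>+x. (\<integral>\<^sup>+s. ennreal (norm (?k x s * g x)) \<partial>lborel) \<partial>lborel)"
    by (subst lborel.nn_integral_fst[symmetric]) (auto simp: split_beta)
  also have "\<dots> < \<infinity>"
    unfolding nn using int by (simp add: integrable_iff_bounded)
  finally have "integrable (lborel \<Otimes>\<^sub>M lborel) (\<lambda>(x, s). ?k x s * g x)"
    by (intro integrableI_bounded) auto
  then have Fubini: "(LINT s|lborel. LINT x|lborel. ?k x s * g x) = (LINT x|lborel. LINT s|lborel. ?k x s * g x)"
    by (rule lborel_pair.Fubini_integral)
  have "rl_conv a (rl_conv b g) t = (LINT s|lborel. LINT x|lborel. ?k x s * g x)"
    unfolding rl_conv_def by (simp only: mult.assoc integral_mult_right_zero)
  also have "\<dots> = (LINT x|lborel. (LINT s|lborel. ?k x s) * g x)"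
    unfolding Fubini by simp
  also have "\<dots> = rl_conv (a + b) g t"
    unfolding rl_conv_def
  proof (intro Bochner_Integration.integral_cong refl arg_cong2[where f="(*)"])
    fix x
    show "(LINT s|lborel. ?k x s) = rl_kernel (a + b) (t - x)"
      using a b by (subst integral_eq_nn_integral) (auto simp: nn_integral_rl_kernel_mult rl_kernel_nonneg)
  qed
  finally show ?thesis .
qed

section \<open>The Riemann-Liouville operators as a semigroup of linear operators\<close>

lemma L0_borel_representative:
  "\<exists>g. unit_supported g \<and> ae_eq g g \<and> F = abs_L0 g"
proof -
  have rep: "ae_eq (rep_L0 F) (rep_L0 F)"
    using Quotient_rep_reflp[OF Quotient_L0] .
  obtain g where g: "unit_supported g" "ae_eq (rep_L0 F) g"
    using unit_supported_representative[of "rep_L0 F"] rep by (auto simp: ae_eq_def)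
  have "F = abs_L0 (rep_L0 F)"
    using Quotient_abs_rep[OF Quotient_L0] by metis
  also have "\<dots> = abs_L0 g"
    using Quotient_rel_abs[OF Quotient_L0, OF g(2)] .
  finally show ?thesis
    using g by (intro exI[of _ g]) (auto simp: ae_eq_def)
qed

lemma in_Lp_abs_L0: "ae_eq g g \<Longrightarrow> in_Lp p (abs_L0 g) \<longleftrightarrow> Lp_fun p g"
  by (rule in_Lp.abs_eq)

lemma abs_L0_eqI: "ae_eq f g \<Longrightarrow> abs_L0 f = abs_L0 g"
  using Quotient_rel_abs[OF Quotient_L0] .

lemma nn_integral_unit_supported:
  assumes "unit_supported f" "\<phi> 0 = 0"
  shows "(\<integral>\<^sup>+x. \<phi> (f x) \<partial>unit_lebesgue) = (\<integral>\<^sup>+x. \<phi> (f x) \<partial>lborel)"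
  unfolding nn_integral_unit_lebesgue using unit_supportedD(2)[OF assms(1)] assms(2)
  by (intro nn_integral_cong) (auto simp: indicator_def)

lemma Lp_fun_1_integrable:
  assumes g: "unit_supported g" and "Lp_fun 1 g"
  shows "integrable lborel g"
proof -
  have [measurable]: "g \<in> borel_measurable borel"
    using g by (simp add: unit_supportedD)
  have "integrable unit_lebesgue (\<lambda>x. \<bar>g x\<bar>)"
    using assms(2) by (simp add: Lp_fun_def)
  then have "(\<integral>\<^sup>+x. ennreal \<bar>g x\<bar> \<partial>unit_lebesgue) < \<infinity>"
    by (simp add: integrable_iff_bounded)
  also have "(\<integral>\<^sup>+x. ennreal \<bar>g x\<bar> \<partial>unit_lebesgue) = (\<integral>\<^sup>+x. ennreal \<bar>g x\<bar> \<partial>lborel)"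
    by (rule nn_integral_unit_supported[OF g, where \<phi>="\<lambda>y. ennreal \<bar>y\<bar>"]) simp
  finally show ?thesis
    by (simp add: integrable_iff_bounded)
qed

lemma riemann_liouville_abs_L0:
  assumes "g \<in> borel_measurable borel" "\<And>x. x < 0 \<Longrightarrow> g x = 0"
  shows "riemann_liouville a (abs_L0 g) = abs_L0 (rl_conv a g)"
proof -
  have "ae_eq g g"
    using assms by (auto simp: ae_eq_def borel_measurable_unit_lebesgue)
  moreover have "riemann_liouville_fun a g = rl_conv a g"
    using assms by (intro ext riemann_liouville_fun_eq_conv) auto
  ultimately show ?thesis
    by (simp add: riemann_liouville.abs_eq)
qed

lemma riemann_liouville_semigroup:
  assumes a: "0 < a" and b: "0 < b" and F: "in_Lp 1 F"
  shows "riemann_liouville a (riemann_liouville b F) = riemann_liouville (a + b) F"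
proof -
  obtain g where g: "unit_supported g" and gg: "ae_eq g g" "F = abs_L0 g"
    using L0_borel_representative[of F] by blast
  note [measurable] = unit_supportedD(1)[OF g]
  have int: "integrable lborel g"
    using F gg by (intro Lp_fun_1_integrable g) (auto simp: in_Lp_abs_L0)
  have "AE t in unit_lebesgue. rl_conv a (rl_conv b g) t = rl_conv (a + b) g t"
    using AE_integrable_rl_kernel[of "a + b" g] a b int g
    by (intro AE_unit_lebesgueI) (auto elim!: eventually_mono intro!: rl_conv_rl_conv)
  then have "abs_L0 (rl_conv a (rl_conv b g)) = abs_L0 (rl_conv (a + b) g)"
    by (intro abs_L0_eqI) (auto simp: ae_eq_def intro!: borel_measurable_unit_lebesgue)
  then show ?thesis
    using unit_supportedD[OF g] by (simp add: gg riemann_liouville_abs_L0 rl_conv_eq_0)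
qed

lemma riemann_liouville_add:
  assumes a: "0 < a" and F: "in_Lp 1 F" and G: "in_Lp 1 G"
  shows "riemann_liouville a (F + G) = riemann_liouville a F + riemann_liouville a G"
proof -
  obtain f where f: "unit_supported f" and ff: "ae_eq f f" "F = abs_L0 f"
    using L0_borel_representative[of F] by blast
  note [measurable] = unit_supportedD(1)[OF f]
  obtain g where g: "unit_supported g" and gg: "ae_eq g g" "G = abs_L0 g"
    using L0_borel_representative[of G] by blast
  note [measurable] = unit_supportedD(1)[OF g]
  have int: "integrable lborel f" "integrable lborel g"
    using F f ff G g gg by (auto intro!: Lp_fun_1_integrable simp: in_Lp_abs_L0)
  have "AE t in lborel. t \<in> {0..1} \<longrightarrow> rl_conv a (\<lambda>x. f x + g x) t = rl_conv a f t + rl_conv a g t"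
    using AE_integrable_rl_kernel[OF a f int(1)] AE_integrable_rl_kernel[OF a g int(2)]
  proof eventually_elim
    case (elim t)
    then show ?case
      by (simp add: rl_conv_def distrib_left)
  qed
  then have ae: "ae_eq (rl_conv a (\<lambda>x. f x + g x)) (\<lambda>t. rl_conv a f t + rl_conv a g t)"
    by (auto simp: ae_eq_def intro!: AE_unit_lebesgueI borel_measurable_unit_lebesgue)
  have "riemann_liouville a (F + G) = abs_L0 (rl_conv a (\<lambda>x. f x + g x))"
    using unit_supportedD[OF f] unit_supportedD[OF g] by (subst ff(2), subst gg(2), subst plus_L0.abs_eq[OF ff(1) gg(1)], intro riemann_liouville_abs_L0) auto
  also have "\<dots> = abs_L0 (\<lambda>t. rl_conv a f t + rl_conv a g t)"
    using ae by (rule abs_L0_eqI)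
  also have "\<dots> = riemann_liouville a F + riemann_liouville a G"
    using unit_supportedD[OF f] unit_supportedD[OF g] by (simp add: ff gg riemann_liouville_abs_L0 plus_L0.abs_eq ae_eq_def borel_measurable_unit_lebesgue)
  finally show ?thesis .
qed

lemma riemann_liouville_scaleR: "riemann_liouville a (c *\<^sub>R F) = c *\<^sub>R riemann_liouville a F"
proof -
  obtain f where f: "unit_supported f" and ff: "ae_eq f f" "F = abs_L0 f"
    using L0_borel_representative[of F] by blast
  note [measurable] = unit_supportedD(1)[OF f]
  have eq: "rl_conv a (\<lambda>x. c * f x) = (\<lambda>t. c * rl_conv a f t)"
    by (simp add: rl_conv_def fun_eq_iff mult.left_commute)
  have "riemann_liouville a (c *\<^sub>R F) = abs_L0 (rl_conv a (\<lambda>x. c * f x))"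
    using unit_supportedD[OF f] by (subst ff(2), subst scaleR_L0.abs_eq[OF ff(1)], intro riemann_liouville_abs_L0) auto
  also have "\<dots> = c *\<^sub>R riemann_liouville a F"
    unfolding eq using unit_supportedD[OF f] by (simp add: ff riemann_liouville_abs_L0 scaleR_L0.abs_eq ae_eq_def borel_measurable_unit_lebesgue)
  finally show ?thesis .
qed

section \<open>Lower bound by sign patterns and causality\<close>

lemma finite_bool_lists: "finite {xs :: bool list. length xs = N}"
  using finite_lists_length_eq[of "UNIV :: bool set" N] by simp

lemma sum_lists_snoc:
  fixes f :: "bool list \<Rightarrow> real"
  shows "(\<Sum>xs | length xs = Suc N. f xs) = (\<Sum>xs | length xs = N. f (xs @ [True]) + f (xs @ [False]))"
proof -
  have eq: "{xs :: bool list. length xs = Suc N} = (\<lambda>(xs, b). xs @ [b]) ` ({xs. length xs = N} \<times> UNIV)"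
    by (auto simp: image_iff length_Suc_conv_rev)
  have "(\<Sum>xs | length xs = Suc N. f xs) = (\<Sum>(xs, b) \<in> {xs. length xs = N} \<times> UNIV. f (xs @ [b]))"
    unfolding eq by (subst sum.reindex) (auto simp: inj_on_def split_beta)
  also have "\<dots> = (\<Sum>xs | length xs = N. \<Sum>b\<in>UNIV. f (xs @ [b]))"
    by (rule sum.cartesian_product[symmetric])
  finally show ?thesis
    by (simp add: UNIV_bool add.commute)
qed

text \<open>Read \<open>\<delta>\<close> as the local distance that a sign pattern reaches with its last sign. If of the two ways to
prolong any prefix at least one is far, then appending one sign multiplies the weighted count of
patterns by at most \<open>1 + w\<close> instead of 2.\<close>

lemma far_prefix_weight:
  fixes \<delta> :: "bool list \<Rightarrow> real" and w d :: real
  assumes far: "\<And>xs. length xs < N \<Longrightarrow> d \<le> \<delta> (xs @ [True]) \<or> d \<le> \<delta> (xs @ [False])" and w: "0 \<le> w" "w \<le> 1"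
  shows "(\<Sum>xs | length xs = N. w ^ card {i. i < N \<and> d \<le> \<delta> (take (Suc i) xs)}) \<le> (1 + w) ^ N"
  using far
proof (induction N)
  case 0
  then show ?case by simp
next
  case (Suc N)
  let ?F = "\<lambda>n xs. {i. i < n \<and> d \<le> \<delta> (take (Suc i) xs)}"
  have snoc: "card (?F (Suc N) (xs @ [b])) = card (?F N xs) + (if d \<le> \<delta> (xs @ [b]) then 1 else 0)"
    if "length xs = N" for xs b
  proof -
    have "?F (Suc N) (xs @ [b]) = ?F N xs \<union> (if d \<le> \<delta> (xs @ [b]) then {N} else {})"
      using that by (auto simp: less_Suc_eq)
    then show ?thesis by simp
  qed
  have "(\<Sum>xs | length xs = Suc N. w ^ card (?F (Suc N) xs))
      = (\<Sum>xs | length xs = N. w ^ card (?F (Suc N) (xs @ [True])) + w ^ card (?F (Suc N) (xs @ [False])))"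
    by (rule sum_lists_snoc)
  also have "\<dots> \<le> (\<Sum>xs | length xs = N. w ^ card (?F N xs) * (1 + w))"
  proof (rule sum_mono)
    fix xs :: "bool list" assume "xs \<in> {xs. length xs = N}"
    then have len: "length xs = N" by simp
    have "w * w ^ k \<le> w ^ k" for k
      using w by (simp add: mult_left_le_one_le)
    then show "w ^ card (?F (Suc N) (xs @ [True])) + w ^ card (?F (Suc N) (xs @ [False]))
        \<le> w ^ card (?F N xs) * (1 + w)"
      unfolding snoc[OF len] using Suc.prems[of xs] len by (auto simp: algebra_simps)
  qed
  also have "\<dots> = (\<Sum>xs | length xs = N. w ^ card (?F N xs)) * (1 + w)"
    by (simp add: sum_distrib_right)
  also have "\<dots> \<le> (1 + w) ^ N * (1 + w)"
    using w Suc.IH[OF Suc.prems] by (intro mult_right_mono) auto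
  finally show ?case by (simp add: mult.commute)
qed

text \<open>A pattern with total distance at most \<open>\<epsilon>\<close> has at most \<open>m\<close> far prefixes, hence weight at least
\<open>w\<^sup>m\<close>.\<close>

lemma near_sign_patterns_card:
  fixes \<delta> :: "bool list \<Rightarrow> real" and w d \<epsilon> :: real
  assumes far: "\<And>xs. length xs < N \<Longrightarrow> d \<le> \<delta> (xs @ [True]) \<or> d \<le> \<delta> (xs @ [False])"
    and w: "0 < w" "w \<le> 1" and nonneg: "\<And>xs. 0 \<le> \<delta> xs" and d: "0 < d"
    and eps: "\<epsilon> < d * (real m + 1)"
  shows "real (card {xs. length xs = N \<and> (\<Sum>i<N. \<delta> (take (Suc i) xs)) \<le> \<epsilon>}) * w ^ m \<le> (1 + w) ^ N"
proof -
  let ?S = "{xs. length xs = N \<and> (\<Sum>i<N. \<delta> (take (Suc i) xs)) \<le> \<epsilon>}"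
  let ?F = "\<lambda>xs. {i. i < N \<and> d \<le> \<delta> (take (Suc i) xs)}"
  have le: "card (?F xs) \<le> m" if "xs \<in> ?S" for xs
  proof -
    have "real (card (?F xs)) * d = (\<Sum>i\<in>?F xs. d)"
      by simp
    also have "\<dots> \<le> (\<Sum>i\<in>?F xs. \<delta> (take (Suc i) xs))"
      by (intro sum_mono) auto
    also have "\<dots> \<le> (\<Sum>i<N. \<delta> (take (Suc i) xs))"
      using nonneg by (intro sum_mono2) auto
    also have "\<dots> < d * (real m + 1)"
      using that eps by auto
    finally have "real (card (?F xs)) < real m + 1"
      using d by (simp add: mult.commute)
    then show ?thesis by linarith
  qed
  have "real (card ?S) * w ^ m = (\<Sum>xs\<in>?S. w ^ m)"
    by simp
  also have "\<dots> \<le> (\<Sum>xs\<in>?S. w ^ card (?F xs))"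
    using w le by (intro sum_mono power_decreasing) auto
  also have "\<dots> \<le> (\<Sum>xs | length xs = N. w ^ card (?F xs))"
    using w by (intro sum_mono2 finite_bool_lists) auto
  also have "\<dots> \<le> (1 + w) ^ N"
    using w by (intro far_prefix_weight far) auto
  finally show ?thesis .
qed

text \<open>The cells are open so that their indicators are products of shifted kernels of order one, which are
indicators of open half lines.\<close>

abbreviation cell :: "nat \<Rightarrow> nat \<Rightarrow> real set" where
  "cell N i \<equiv> {real i / real N <..< (real i + 1) / real N}"

lemma cell_disjoint: "0 < N \<Longrightarrow> t \<in> cell N i \<Longrightarrow> t \<in> cell N j \<Longrightarrow> i = j"
proof -
  assume "0 < N" "t \<in> cell N i" "t \<in> cell N j"
  then have "real i < real j + 1" "real j < real i + 1"
    by (auto simp: field_simps)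
  then show ?thesis by linarith
qed

lemma sum_indicator_cell:
  assumes "0 < N"
  shows "(\<Sum>i<n. indicator (cell N i) t) = (indicator (\<Union>i<n. cell N i) t :: real)"
proof -
  have "disjoint_family_on (cell N) {..<n}"
    unfolding disjoint_family_on_def using cell_disjoint[OF assms] by blast
  then show ?thesis by (rule indicator_UN_disjoint[OF finite_lessThan, symmetric])
qed

lemma cell_subset: "i < N \<Longrightarrow> cell N i \<subseteq> {0..1}"
proof
  fix t assume i: "i < N" and t: "t \<in> cell N i"
  have "(real i + 1) / real N \<le> 1" using i by (simp add: divide_le_eq)
  moreover have "0 \<le> real i / real N" by simp
  moreover have "real i / real N < t" "t < (real i + 1) / real N" using t by auto
  ultimately show "t \<in> {0..1}" unfolding atLeastAtMost_iff by linarith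
qed

definition sign_fun :: "nat \<Rightarrow> bool list \<Rightarrow> real \<Rightarrow> real" where
  "sign_fun N xs t = (\<Sum>j<length xs. (if xs ! j then 1 else - 1) * indicator (cell N j) t)"

lemma sign_fun_measurable [measurable]: "sign_fun N xs \<in> borel_measurable borel"
  unfolding sign_fun_def by measurable

lemma abs_sign_fun_le:
  assumes "0 < N"
  shows "\<bar>sign_fun N xs t\<bar> \<le> indicator {0<..} t"
proof -
  have "\<bar>sign_fun N xs t\<bar> \<le> (\<Sum>j<length xs. indicator (cell N j) t)"
    unfolding sign_fun_def by (rule sum_abs[THEN order_trans]) (intro sum_mono, simp add: abs_mult)
  also have "\<dots> \<le> indicator {0<..} t"
  proof -
    have "0 < t" if "t \<in> cell N j" for j
      using that by (auto intro: le_less_trans[rotated])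
    then show ?thesis
      unfolding sum_indicator_cell[OF assms] by (auto simp: indicator_def)
  qed
  finally show ?thesis .
qed

lemma unit_supported_sign_fun:
  assumes "length xs \<le> N"
  shows "unit_supported (sign_fun N xs)"
proof -
  have "x \<notin> cell N j" if "x \<notin> {0..1}" "j < length xs" for x j
    using cell_subset[of j N] that assms by (meson less_le_trans subsetD)
  then show ?thesis
    by (auto simp: unit_supported_def sign_fun_def intro!: sum.neutral simp del: greaterThanLessThan_iff)
qed

lemma sign_fun_prefix:
  assumes i: "i < length xs" and x: "x < (real i + 1) / real N" and N: "0 < N"
  shows "sign_fun N xs x = sign_fun N (take (Suc i) xs) x"
proof -
  have "x \<notin> cell N j" if "Suc i \<le> j" for j
  proof -
    have "(real i + 1) / real N \<le> real j / real N"
      using that N by (intro divide_right_mono) auto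
    then show ?thesis using x by auto
  qed
  then show ?thesis
    unfolding sign_fun_def using i
    by (intro sum.mono_neutral_cong_right) (auto simp: indicator_def not_less)
qed

lemma integrable_rl_kernel_bounded:
  assumes a: "0 < a" and [measurable]: "f \<in> borel_measurable borel" and f: "\<And>x. \<bar>f x\<bar> \<le> indicator {0<..} x"
  shows "integrable lborel (\<lambda>x. rl_kernel a (t - x) * f x)" (is ?int)
    and "\<bar>rl_conv a f t\<bar> \<le> rl_kernel (a + 1) t" (is ?bound)
proof -
  have "norm (rl_kernel a (t - x) * f x) \<le> rl_kernel a (t - x) * rl_kernel 1 (x - 0)" for x
  proof -
    have "\<bar>f x\<bar> \<le> rl_kernel 1 (x - 0)"
      using f[of x] by (auto simp: rl_kernel_def indicator_def)
    then show ?thesis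
      using a by (simp add: abs_mult rl_kernel_nonneg mult_left_mono)
  qed
  then have "(\<integral>\<^sup>+x. ennreal (norm (rl_kernel a (t - x) * f x)) \<partial>lborel)
      \<le> (\<integral>\<^sup>+x. ennreal (rl_kernel a (t - x) * rl_kernel 1 (x - 0)) \<partial>lborel)"
    by (intro nn_integral_mono ennreal_leI)
  also have "\<dots> = ennreal (rl_kernel (a + 1) t)"
    using nn_integral_rl_kernel_mult[OF a zero_less_one, of t 0] by simp
  finally have le: "(\<integral>\<^sup>+x. ennreal (norm (rl_kernel a (t - x) * f x)) \<partial>lborel) \<le> ennreal (rl_kernel (a + 1) t)" .
  then show ?int
    by (intro integrableI_bounded) (auto intro: le_less_trans)
  then have "ennreal (norm (rl_conv a f t)) \<le> ennreal (rl_kernel (a + 1) t)"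
    unfolding rl_conv_def by (rule order_trans[OF integral_norm_bound_ennreal le])
  then show ?bound
    using a by (simp add: rl_kernel_nonneg)
qed

lemma integrable_indicator_rl_conv:
  assumes a: "0 < a" and [measurable]: "f \<in> borel_measurable borel" and f: "\<And>x. \<bar>f x\<bar> \<le> indicator {0<..} x"
    and S: "S \<in> sets borel" "S \<subseteq> {0..1}"
  shows "integrable lborel (\<lambda>t. indicator S t * rl_conv a f t)"
proof (rule Bochner_Integration.integrable_bound)
  show "integrable lborel (\<lambda>t::real. indicator {0..1} t * (1 / Gamma (a + 1)) :: real)"
    by (intro integrable_mult_left integrable_real_indicator) auto
  show "AE t in lborel. norm (indicator S t * rl_conv a f t) \<le> norm (indicator {0..1} t * (1 / Gamma (a + 1)) :: real)"
  proof (rule AE_I2)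
    fix t
    show "norm (indicator S t * rl_conv a f t) \<le> norm (indicator {0..1} t * (1 / Gamma (a + 1)) :: real)"
    proof (cases "t \<in> S")
      case True
      then have t: "t \<in> {0..1}" using S by auto
      have "rl_kernel (a + 1) t \<le> 1 / Gamma (a + 1)"
        using t a powr_mono2[of a t 1] by (auto simp: rl_kernel_def intro!: divide_right_mono)
      then show ?thesis
        using True t a integrable_rl_kernel_bounded(2)[OF a assms(2) f, of t] by simp
    qed simp
  qed
qed (use S in measurable)

text \<open>Both integrations are convolutions of power kernels, so the value follows from the semigroup law.\<close>

lemma integral_cell_rl_conv_indicator:
  assumes a: "0 < a" and N: "0 < N"
  shows "(LINT t|lborel. indicator (cell N i) t * rl_conv a (indicator (cell N i)) t) = rl_kernel (a + 2) (1 / N)"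
proof -
  let ?l = "real i / N" and ?r = "(real i + 1) / N"
  have lt: "rl_conv a (indicator (cell N i)) t = rl_kernel (a + 1) (t - ?l)" if "t \<in> cell N i" for t
  proof -
    have "rl_conv a (indicator (cell N i)) t = (LINT x|lborel. rl_kernel a (t - x) * rl_kernel 1 (x - ?l))"
      unfolding rl_conv_def using that
      by (intro Bochner_Integration.integral_cong refl) (auto simp: rl_kernel_def indicator_def)
    also have "\<dots> = rl_kernel (a + 1) (t - ?l)"
      using a by (subst integral_eq_nn_integral) (auto simp: nn_integral_rl_kernel_mult rl_kernel_nonneg)
    finally show ?thesis .
  qed
  have "(LINT t|lborel. indicator (cell N i) t * rl_conv a (indicator (cell N i)) t)
      = (LINT t|lborel. rl_kernel 1 (?r - t) * rl_kernel (a + 1) (t - ?l))"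
    by (intro Bochner_Integration.integral_cong refl)
      (auto simp: lt indicator_def rl_kernel_def)
  also have "\<dots> = rl_kernel (1 + (a + 1)) (?r - ?l)"
    using a nn_integral_rl_kernel_mult[of 1 "a + 1" ?r ?l]
    by (subst integral_eq_nn_integral) (auto simp: rl_kernel_nonneg)
  also have "1 + (a + 1) = a + 2" by simp
  also have "?r - ?l = 1 / N" using N by (simp add: diff_divide_distrib[symmetric])
  finally show ?thesis .
qed

text \<open>Here \<open>\<delta>\<close> is the distance between the integrals of the image and of the centre over the last cell
decided so far. By causality it is determined by the prefix, its sum over all prefixes is at most the
\<open>L\<^sub>1\<close> distance, and reversing the last sign moves the integral of
the image by \<open>2d\<close>.\<close>

lemma near_sign_images_card:
  assumes a: "0 < a" and N: "0 < N" and y: "integrable lborel y"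
    and w: "0 < w" "w \<le> 1" and eps: "\<epsilon> < rl_kernel (a + 2) (1 / N) * (real m + 1)"
  shows "real (card {xs. length xs = N \<and>
      (LINT t|lborel. indicator {0..1} t * \<bar>rl_conv a (sign_fun N xs) t - y t\<bar>) \<le> \<epsilon>}) * w ^ m \<le> (1 + w) ^ N"
proof -
  define d where "d = rl_kernel (a + 2) (1 / N)"
  have d: "0 < d" using a N by (simp add: d_def rl_kernel_def)
  let ?u = "\<lambda>xs. rl_conv a (sign_fun N xs)"
  let ?D = "\<lambda>xs. LINT t|lborel. indicator {0..1} t * \<bar>?u xs t - y t\<bar>"
  let ?A = "\<lambda>xs i. LINT t|lborel. indicator (cell N i) t * ?u xs t"
  let ?c = "\<lambda>i. LINT t|lborel. indicator (cell N i) t * y t"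
  define \<delta> where "\<delta> xs = \<bar>?A xs (length xs - 1) - ?c (length xs - 1)\<bar>" for xs
  have [measurable]: "y \<in> borel_measurable borel"
    using borel_measurable_integrable[OF y] by simp
  have intu: "integrable lborel (\<lambda>t. indicator S t * ?u xs t)" if "S \<in> sets borel" "S \<subseteq> {0..1}" for S xs
    using that abs_sign_fun_le[OF N] by (intro integrable_indicator_rl_conv a) auto
  have inty: "integrable lborel (\<lambda>t. indicator S t * y t)" if "S \<in> sets borel" for S
    using integrable_mult_indicator[OF _ y, of S] that by simp
  have far: "d \<le> \<delta> (xs @ [True]) \<or> d \<le> \<delta> (xs @ [False])" if "length xs < N" for xs
  proof -
    let ?i = "length xs"
    have "?u (xs @ [True]) t - ?u (xs @ [False]) t = 2 * rl_conv a (indicator (cell N ?i)) t" for t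
    proof -
      have "?u (xs @ [True]) t - ?u (xs @ [False]) t
          = (LINT x|lborel. rl_kernel a (t - x) * sign_fun N (xs @ [True]) x - rl_kernel a (t - x) * sign_fun N (xs @ [False]) x)"
        unfolding rl_conv_def using abs_sign_fun_le[OF N]
        by (intro Bochner_Integration.integral_diff[symmetric] integrable_rl_kernel_bounded a) auto
      also have "\<dots> = (LINT x|lborel. 2 * (rl_kernel a (t - x) * indicator (cell N ?i) x))"
        by (intro Bochner_Integration.integral_cong refl)
          (simp add: sign_fun_def nth_append algebra_simps)
      finally show ?thesis by (simp only: integral_mult_right_zero rl_conv_def)
    qed
    note eq = this
    have "?A (xs @ [True]) ?i - ?A (xs @ [False]) ?i
        = (LINT t|lborel. indicator (cell N ?i) t * (?u (xs @ [True]) t - ?u (xs @ [False]) t))"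
      unfolding right_diff_distrib using cell_subset[OF that]
      by (intro Bochner_Integration.integral_diff[symmetric] intu) auto
    also have "\<dots> = (LINT t|lborel. 2 * (indicator (cell N ?i) t * rl_conv a (indicator (cell N ?i)) t))"
      unfolding eq by (simp only: mult.left_commute)
    also have "\<dots> = 2 * d"
      unfolding integral_mult_right_zero integral_cell_rl_conv_indicator[OF a N] d_def ..
    finally show ?thesis
      by (auto simp: \<delta>_def abs_if split: if_splits)
  qed
  have sum_le: "(\<Sum>i<N. \<delta> (take (Suc i) xs)) \<le> ?D xs"
    if len: "length xs = N" for xs
  proof -
    have intd: "integrable lborel (\<lambda>t. indicator S t * (?u xs t - y t))" if "S \<in> sets borel" "S \<subseteq> {0..1}" for S
      using Bochner_Integration.integrable_diff[OF intu[OF that] inty[OF that(1)]] by (simp add: right_diff_distrib)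
    have intd': "integrable lborel (\<lambda>t. indicator S t * \<bar>?u xs t - y t\<bar>)" if "S \<in> sets borel" "S \<subseteq> {0..1}" for S
      using integrable_abs[OF intd[OF that]] by (simp add: abs_mult)
    have "\<delta> (take (Suc i) xs) \<le> (LINT t|lborel. indicator (cell N i) t * \<bar>?u xs t - y t\<bar>)" if i: "i < N" for i
    proof -
      have causal: "indicator (cell N i) t * ?u (take (Suc i) xs) t = indicator (cell N i) t * ?u xs t" for t
      proof (cases "t \<in> cell N i")
        case True
        have "(\<lambda>x. rl_kernel a (t - x) * sign_fun N (take (Suc i) xs) x) = (\<lambda>x. rl_kernel a (t - x) * sign_fun N xs x)"
        proof
          fix x
          show "rl_kernel a (t - x) * sign_fun N (take (Suc i) xs) x = rl_kernel a (t - x) * sign_fun N xs x"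
            using sign_fun_prefix[of i xs x N] i len True N
            by (cases "x < (real i + 1) / N") (auto simp: rl_kernel_def)
        qed
        then show ?thesis by (simp only: rl_conv_def)
      qed simp
      have "\<delta> (take (Suc i) xs) = \<bar>?A xs i - ?c i\<bar>"
        using i len by (simp add: \<delta>_def causal)
      also have "?A xs i - ?c i = (LINT t|lborel. indicator (cell N i) t * (?u xs t - y t))"
        using cell_subset[OF i] by (subst Bochner_Integration.integral_diff[symmetric])
          (auto intro!: intu inty simp: right_diff_distrib)
      also have "\<bar>\<dots>\<bar> \<le> (LINT t|lborel. \<bar>indicator (cell N i) t * (?u xs t - y t)\<bar>)"
        by (rule integral_abs_bound)
      finally show ?thesis by (simp add: abs_mult)
    qed
    then have "(\<Sum>i<N. \<delta> (take (Suc i) xs)) \<le> (\<Sum>i<N. LINT t|lborel. indicator (cell N i) t * \<bar>?u xs t - y t\<bar>)"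
      by (intro sum_mono) auto
    also have "\<dots> = (LINT t|lborel. (\<Sum>i<N. indicator (cell N i) t * \<bar>?u xs t - y t\<bar>))"
      using cell_subset by (intro Bochner_Integration.integral_sum[symmetric] intd') auto
    also have "\<dots> \<le> ?D xs"
    proof (rule integral_mono)
      show "integrable lborel (\<lambda>t. \<Sum>i<N. indicator (cell N i) t * \<bar>?u xs t - y t\<bar>)"
        using cell_subset by (intro Bochner_Integration.integrable_sum intd') auto
      show "integrable lborel (\<lambda>t. indicator {0..1} t * \<bar>?u xs t - y t\<bar>)"
        by (intro intd') auto
      fix t
      show "(\<Sum>i<N. indicator (cell N i) t * \<bar>?u xs t - y t\<bar>) \<le> indicator {0..1} t * \<bar>?u xs t - y t\<bar>"
        unfolding sum_distrib_right[symmetric] sum_indicator_cell[OF N]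
      proof (rule mult_right_mono)
        show "indicator (\<Union>i<N. cell N i) t \<le> (indicator {0..1} t :: real)"
          using cell_subset[of _ N] by (intro indicator_leI) blast
      qed simp
    qed
    finally show ?thesis .
  qed
  have "{xs. length xs = N \<and> ?D xs \<le> \<epsilon>}
      \<subseteq> {xs. length xs = N \<and> (\<Sum>i<N. \<delta> (take (Suc i) xs)) \<le> \<epsilon>}"
    using sum_le by force
  then have "card {xs. length xs = N \<and> ?D xs \<le> \<epsilon>}
      \<le> card {xs. length xs = N \<and> (\<Sum>i<N. \<delta> (take (Suc i) xs)) \<le> \<epsilon>}"
    by (rule card_mono[rotated]) (rule finite_subset[OF _ finite_bool_lists[of N]], auto)
  then have "real (card {xs. length xs = N \<and> ?D xs \<le> \<epsilon>}) * w ^ m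
      \<le> real (card {xs. length xs = N \<and> (\<Sum>i<N. \<delta> (take (Suc i) xs)) \<le> \<epsilon>}) * w ^ m"
    using w by (intro mult_right_mono) auto
  also have "\<dots> \<le> (1 + w) ^ N"
    using far w d eps by (intro near_sign_patterns_card[where d=d]) (auto simp: \<delta>_def d_def)
  finally show ?thesis .
qed

text \<open>With weight \<open>1/2\<close> this says that \<open>2\<^sup>n\<^sup>-\<^sup>1\<close> balls cannot capture all \<open>2\<^sup>4\<^sup>n\<close> patterns if each of them
allows at most \<open>n/2\<close> far choices: after squaring, \<open>4 \<sqdot> 2 \<sqdot> (81/16)\<^sup>2 < 256\<close>.\<close>

lemma sign_pattern_numerics:
  assumes "1 \<le> n" "2 * m \<le> n"
  shows "2 ^ (n - 1) * (2 ^ m * (3 / 2) ^ (4 * n)) < (2 :: real) ^ (4 * n)"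
proof (rule power2_less_imp_less)
  have 1: "((3 / 2 :: real) ^ (4 * n))\<^sup>2 = (6561 / 256) ^ n"
    unfolding power_mult power_even_eq[symmetric] power2_eq_square power_mult_distrib[symmetric]
    by (simp add: power_divide)
  have 2: "(2 ^ (n - 1) :: real)\<^sup>2 = 4 ^ n / 4"
    using assms by (cases n) (simp_all add: power2_eq_square flip: power_mult_distrib)
  have 3: "(2 ^ m :: real)\<^sup>2 \<le> 2 ^ n"
    unfolding power_even_eq[symmetric] using assms by (intro power_increasing) auto
  have 4: "((2 :: real) ^ (4 * n))\<^sup>2 = 256 ^ n"
    unfolding power_mult by (simp add: power2_eq_square flip: power_mult_distrib)
  have "(2 ^ (n - 1) * (2 ^ m * (3 / 2) ^ (4 * n)) :: real)\<^sup>2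
      = 4 ^ n / 4 * ((2 ^ m)\<^sup>2 * (6561 / 256) ^ n)"
    by (simp only: power_mult_distrib[of _ _ 2] 1 2)
  also have "\<dots> \<le> 4 ^ n / 4 * (2 ^ n * (6561 / 256) ^ n)"
    by (intro mult_left_mono mult_right_mono 3) auto
  also have "\<dots> = (6561 / 32) ^ n / 4"
    by (simp flip: power_mult_distrib)
  also have "\<dots> < (256 :: real) ^ n"
    using power_mono[of "6561 / 32 :: real" 256 n] by (intro divide_less_eq[THEN iffD2]) (auto intro: le_less_trans)
  finally show "(2 ^ (n - 1) * (2 ^ m * (3 / 2) ^ (4 * n)) :: real)\<^sup>2 < ((2 :: real) ^ (4 * n))\<^sup>2"
    unfolding 4 .
qed simp

theorem operator_entropy_number_ge:
  assumes p: "1 \<le> p" and q: "1 \<le> q" and a: "0 < a" and n: "1 \<le> n"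
  shows "ennreal (4 powr (- a - 1) / (4 * Gamma (a + 2)) * real n powr - a)
    \<le> operator_entropy_number p q (riemann_liouville a) n"
proof -
  \<comment> \<open>Four signs per unit of \<open>n\<close> leave room for the \<open>2\<^sup>n\<^sup>-\<^sup>1\<close> centres and the far choices.\<close>
  define N where "N = 4 * n"
  define c where "c = 4 powr (- a - 1) / (4 * Gamma (a + 2))"
  \<comment> \<open>The factor 2 lost in passing from \<open>L\<^sub>q\<close> to \<open>L\<^sub>1\<close> turns a radius below \<open>E\<close> into \<open>2 * E\<close>.\<close>
  define E where "E = c * real n powr - a"
  have N: "0 < N" using n by (simp add: N_def)
  have E: "0 < E" using a n by (simp add: E_def c_def)
  have key: "ennreal E \<le> ennreal \<epsilon>" if "0 \<le> \<epsilon>"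
    and z: "\<forall>i\<in>{1..2 ^ (n - 1)}. z i \<in> mspace (Lp_metric q)"
    and cover: "riemann_liouville a ` Lp_unit_ball p \<subseteq> (\<Union>i\<in>{1..2 ^ (n - 1)}. mcball_of (Lp_metric q) (z i) \<epsilon>)"
    for \<epsilon> and z :: "nat \<Rightarrow> L0"
  proof (rule ccontr)
    assume "\<not> ennreal E \<le> ennreal \<epsilon>"
    then have eps: "\<epsilon> < E" using \<open>0 \<le> \<epsilon>\<close> by (simp add: not_le ennreal_less_iff)
    have "\<exists>y. \<forall>i. unit_supported (y i) \<and> ae_eq (y i) (y i) \<and> z i = abs_L0 (y i)"
      by (intro choice allI L0_borel_representative)
    then obtain y where y: "\<And>i. unit_supported (y i)" "\<And>i. ae_eq (y i) (y i)" "\<And>i. z i = abs_L0 (y i)"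
      by blast
    have Lp1: "Lp_fun 1 f" if "Lp_fun q f" for f
      using that Lp_le_embed[of 1 q "Lp_norm_fun q f + 1" f] q Lp_norm_fun_nonneg[of q f]
      by (auto simp: Lp_le_def)
    have yint: "integrable lborel (y i)" if "i \<in> {1..2 ^ (n - 1)}" for i
      using that z y q by (intro Lp_fun_1_integrable Lp1 y) (auto simp: mspace_Lp_metric in_Lp_abs_L0[symmetric])
    let ?near = "\<lambda>i. {xs. length xs = N \<and>
      (LINT t|lborel. indicator {0..1} t * \<bar>rl_conv a (sign_fun N xs) t - y i t\<bar>) \<le> 2 * E}"
    have sub: "{xs. length xs = N} \<subseteq> (\<Union>i\<in>{1..2 ^ (n - 1)}. ?near i)"
    proof
      fix xs :: "bool list" assume "xs \<in> {xs. length xs = N}"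
      then have len: "length xs = N" by simp
      let ?f = "sign_fun N xs"
      have fs: "unit_supported ?f"
        using len by (simp add: unit_supported_sign_fun)
      have ff: "ae_eq ?f ?f" by (simp add: ae_eq_def borel_measurable_unit_lebesgue)
      have "Lp_le p 1 ?f"
        using order_trans[OF abs_sign_fun_le[OF N] indicator_le_1]
        by (intro Lp_le_bounded p borel_measurable_unit_lebesgue) auto
      then have "abs_L0 ?f \<in> Lp_unit_ball p"
        using ff by (simp add: Lp_unit_ball_def Lp_le_def in_Lp_abs_L0 Lp_norm.abs_eq)
      then obtain i where i: "i \<in> {1..2 ^ (n - 1)}"
        and "riemann_liouville a (abs_L0 ?f) \<in> mcball_of (Lp_metric q) (z i) \<epsilon>"
        using cover by blast
      moreover have R: "riemann_liouville a (abs_L0 ?f) = abs_L0 (rl_conv a ?f)"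
        using unit_supportedD[OF fs] by (intro riemann_liouville_abs_L0) auto
      moreover have uu: "ae_eq (rl_conv a ?f) (rl_conv a ?f)"
        by (simp add: ae_eq_def borel_measurable_unit_lebesgue)
      moreover have "ae_eq (\<lambda>x. y i x - rl_conv a ?f x) (\<lambda>x. y i x - rl_conv a ?f x)"
        using unit_supportedD(1)[OF y(1)] by (simp add: ae_eq_def borel_measurable_unit_lebesgue)
      ultimately have mem: "Lp_fun q (rl_conv a ?f)" "Lp_fun q (y i)"
        and norm: "Lp_norm_fun q (\<lambda>x. y i x - rl_conv a ?f x) \<le> \<epsilon>"
        using y q by (auto simp: mspace_Lp_metric mdist_Lp_metric in_Lp_abs_L0 minus_L0.abs_eq Lp_norm.abs_eq)
      have "Lp_fun q (\<lambda>x. y i x - rl_conv a ?f x)"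
        using Lp_le_diff[OF q, of "Lp_norm_fun q (y i)" "y i" "Lp_norm_fun q (rl_conv a ?f)" "rl_conv a ?f"] mem
        by (simp add: Lp_le_def)
      then have "Lp_le q E (\<lambda>x. y i x - rl_conv a ?f x)"
        using norm eps by (simp add: Lp_le_def)
      then have "Lp_le 1 (2 * E) (\<lambda>x. y i x - rl_conv a ?f x)"
        using q E by (intro Lp_le_embed) auto
      then have "(\<integral>\<^sup>+x. ennreal \<bar>y i x - rl_conv a ?f x\<bar> \<partial>unit_lebesgue) \<le> ennreal (2 * E)"
        using E Lp_le_finite_iff[of 1 "2 * E"] by (simp add: one_ereal_def)
      also have "(\<integral>\<^sup>+x. ennreal \<bar>y i x - rl_conv a ?f x\<bar> \<partial>unit_lebesgue)
          = (\<integral>\<^sup>+x. ennreal (indicator {0..1} x * \<bar>rl_conv a ?f x - y i x\<bar>) \<partial>lborel)"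
        unfolding nn_integral_unit_lebesgue
        by (intro nn_integral_cong) (auto simp: indicator_def abs_minus_commute)
      finally have "(LINT x|lborel. indicator {0..1} x * \<bar>rl_conv a ?f x - y i x\<bar>) \<le> 2 * E"
        using E unit_supportedD(1)[OF y(1)] by (subst integral_eq_nn_integral)
          (auto intro!: enn2real_leI)
      then show "xs \<in> (\<Union>i\<in>{1..2 ^ (n - 1)}. ?near i)"
        using i len by blast
    qed
    define m where "m = n div 2"
    have m: "real n < 2 * (real m + 1)" using div_less_iff_less_mult[of 2 n "m + 1"] by (simp add: m_def)
    have small: "2 * E < rl_kernel (a + 2) (1 / N) * (real m + 1)"
    proof -
      have "rl_kernel (a + 2) (1 / N) = (1 / (4 * real n)) powr (a + 1) / Gamma (a + 2)"
        using n by (simp add: rl_kernel_def N_def add.commute)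
      also have "(1 / (4 * real n)) powr (a + 1) = 4 powr (- a - 1) * real n powr (- a - 1)"
        using n powr_minus_divide[of "4 * real n" "a + 1"]
        by (simp add: powr_divide flip: powr_mult)
      finally have eq: "rl_kernel (a + 2) (1 / N) = 4 * c * real n powr (- a - 1)"
        by (simp add: c_def)
      have c: "0 < c" using a by (simp add: c_def)
      have "2 * E = 2 * c * real n powr (- a - 1) * real n"
        using n by (simp add: E_def powr_mult_base mult.commute[of _ "real n"])
      also have "\<dots> < 2 * c * real n powr (- a - 1) * (2 * (real m + 1))"
        using m c n by (intro mult_strict_left_mono) auto
      finally show ?thesis by (simp add: eq algebra_simps)
    qed
    have near: "real (card (?near i)) \<le> 2 ^ m * (3 / 2) ^ N" if "i \<in> {1..2 ^ (n - 1)}" for i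
      using near_sign_images_card[OF a N yint[OF that], of "1 / 2" "2 * E" m] small
      by (simp add: power_divide field_simps)
    have fin: "finite (?near i)" for i
      by (rule finite_subset[OF _ finite_bool_lists[of N]]) auto
    have "(2::real) ^ N = real (card {xs :: bool list. length xs = N})"
      using card_lists_length_eq[of "UNIV :: bool set" N] by simp
    also have "\<dots> \<le> real (card (\<Union>i\<in>{1..2 ^ (n - 1)}. ?near i))"
      using sub fin by (intro of_nat_mono card_mono) auto
    also have "\<dots> \<le> real (\<Sum>i\<in>{1..2 ^ (n - 1)}. card (?near i))"
      by (intro of_nat_mono card_UN_le) auto
    also have "\<dots> \<le> (\<Sum>i\<in>{1..2 ^ (n - 1) :: nat}. 2 ^ m * (3 / 2) ^ N)"
      unfolding of_nat_sum by (intro sum_mono near) auto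
    also have "\<dots> = 2 ^ (n - 1) * (2 ^ m * (3 / 2) ^ N)"
      by simp
    finally show False
      using sign_pattern_numerics[of n m] n by (simp add: N_def m_def)
  qed
  show ?thesis
    unfolding operator_entropy_number_def dyadic_entropy_number_def entropy_number_def
      c_def[symmetric] E_def[symmetric]
  proof (rule Inf_greatest, elim CollectE exE conjE)
    fix v \<epsilon> and z :: "nat \<Rightarrow> L0"
    assume "v = ennreal \<epsilon>" "0 \<le> \<epsilon>" "\<forall>i\<in>{1..2 ^ (n - 1)}. z i \<in> mspace (Lp_metric q)"
      "riemann_liouville a ` Lp_unit_ball p \<subseteq> (\<Union>i\<in>{1..2 ^ (n - 1)}. mcball_of (Lp_metric q) (z i) \<epsilon>)"
    then show "ennreal E \<le> v"
      using key by simp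
  qed
qed

section \<open>Counting and quantizing coefficient vectors\<close>

lemma sum_power_abs_le:
  fixes x :: real
  assumes "0 < x" "x < 1"
  shows "(\<Sum>v\<in>{- int m..int m}. x ^ nat \<bar>v\<bar>) \<le> (1 + x) / (1 - x)"
proof -
  have "(\<Sum>v\<in>{- int m..int m}. x ^ nat \<bar>v\<bar>) = (1 + x - 2 * x ^ Suc m) / (1 - x)"
  proof (induction m)
    case 0
    then show ?case using assms by simp
  next
    case (Suc m)
    have eq: "{- int (Suc m)..int (Suc m)} = insert (- int (Suc m)) (insert (int (Suc m)) {- int m..int m})"
      by auto
    have "(\<Sum>v\<in>{- int (Suc m)..int (Suc m)}. x ^ nat \<bar>v\<bar>)
        = 2 * x ^ Suc m + (\<Sum>v\<in>{- int m..int m}. x ^ nat \<bar>v\<bar>)"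
      unfolding eq by (subst sum.insert; simp)+ (simp add: nat_add_distrib)
    also have "\<dots> = (1 + x - 2 * x ^ Suc (Suc m)) / (1 - x)"
      using assms unfolding Suc.IH by (simp add: field_simps)
    finally show ?case .
  qed
  also have "\<dots> \<le> (1 + x) / (1 - x)"
    using assms by (intro divide_right_mono) auto
  finally show ?thesis .
qed

text \<open>Vectors are extensional functions, undefined from \<open>N\<close> on, so that the product formula for sums over
function spaces applies and the set is finite.\<close>

definition lattice_ball :: "nat \<Rightarrow> real \<Rightarrow> (nat \<Rightarrow> int) set" where
  "lattice_ball N K = {z \<in> {..<N} \<rightarrow>\<^sub>E UNIV. (\<Sum>i<N. real_of_int \<bar>z i\<bar>) \<le> K}"

lemma lattice_ball_subset: "lattice_ball N K \<subseteq> {..<N} \<rightarrow>\<^sub>E {- int (nat \<lfloor>K\<rfloor>)..int (nat \<lfloor>K\<rfloor>)}"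
proof (intro subsetI PiE_I)
  fix z i assume z: "z \<in> lattice_ball N K" and i: "i \<in> {..<N}"
  have "real_of_int \<bar>z i\<bar> \<le> (\<Sum>i<N. real_of_int \<bar>z i\<bar>)"
    using i by (intro member_le_sum) auto
  also have "\<dots> \<le> K" using z by (simp add: lattice_ball_def)
  finally have "\<bar>z i\<bar> \<le> \<lfloor>K\<rfloor>" by (simp add: le_floor_iff)
  moreover from this have "0 \<le> \<lfloor>K\<rfloor>" by linarith
  ultimately show "z i \<in> {- int (nat \<lfloor>K\<rfloor>)..int (nat \<lfloor>K\<rfloor>)}" by auto
qed (auto simp: lattice_ball_def)

lemma finite_lattice_ball: "finite (lattice_ball N K)"
  by (rule finite_subset[OF lattice_ball_subset]) (auto intro: finite_PiE)

text \<open>Each vector in the ball contributes at least \<open>x\<^sup>K\<close> to the product of the \<open>N\<close> generating functions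
\<open>\<Sum>\<^sub>v x\<^sup>\<bar>\<^sup>v\<^sup>\<bar>\<close>.\<close>

lemma card_lattice_ball_le:
  fixes x :: real
  assumes x: "0 < x" "x < 1"
  shows "real (card (lattice_ball N K)) \<le> (1 / x) powr K * ((1 + x) / (1 - x)) ^ N"
proof -
  let ?P = "{..<N} \<rightarrow>\<^sub>E {- int (nat \<lfloor>K\<rfloor>)..int (nat \<lfloor>K\<rfloor>)}"
  have "real (card (lattice_ball N K)) * x powr K = (\<Sum>z\<in>lattice_ball N K. x powr K)"
    by simp
  also have "\<dots> \<le> (\<Sum>z\<in>lattice_ball N K. (\<Prod>i<N. x ^ nat \<bar>z i\<bar>))"
  proof (rule sum_mono)
    fix z assume z: "z \<in> lattice_ball N K"
    have "x powr K \<le> x powr (\<Sum>i<N. real_of_int \<bar>z i\<bar>)"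
      using x z by (intro powr_mono') (auto simp: lattice_ball_def)
    also have "\<dots> = (\<Prod>i<N. x powr real_of_int \<bar>z i\<bar>)"
      using x by (subst powr_sum) auto
    also have "\<dots> = (\<Prod>i<N. x ^ nat \<bar>z i\<bar>)"
      using x by (intro prod.cong refl) (simp add: powr_realpow[symmetric])
    finally show "x powr K \<le> (\<Prod>i<N. x ^ nat \<bar>z i\<bar>)" .
  qed
  also have "\<dots> \<le> (\<Sum>z\<in>?P. (\<Prod>i<N. x ^ nat \<bar>z i\<bar>))"
    using x lattice_ball_subset by (intro sum_mono2 finite_PiE prod_nonneg) auto
  also have "\<dots> = (\<Prod>i<N. \<Sum>v\<in>{- int (nat \<lfloor>K\<rfloor>)..int (nat \<lfloor>K\<rfloor>)}. x ^ nat \<bar>v\<bar>)"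
    by (rule prod_sum_PiE[symmetric]) auto
  also have "\<dots> \<le> (\<Prod>i<N. (1 + x) / (1 - x))"
    using x by (intro prod_mono conjI sum_power_abs_le sum_nonneg) auto
  finally have "real (card (lattice_ball N K)) * x powr K \<le> ((1 + x) / (1 - x)) ^ N"
    by simp
  then show ?thesis
    using x by (simp add: powr_divide field_simps)
qed

text \<open>The choice \<open>x = r / (1 + r)\<close> balances the two factors for radius \<open>r N\<close>; it serves both the dense
case \<open>r \<ge> 1\<close> and the sparse case \<open>r \<le> 1\<close>.\<close>

lemma card_lattice_ball_ratio:
  assumes r: "0 < r" and N: "0 < N"
  shows "real (card (lattice_ball N (r * real N))) \<le> (((1 + r) / r) powr r * (1 + 2 * r)) ^ N"
proof -
  define x where "x = r / (1 + r)"
  have x: "0 < x" "x < 1" using r by (auto simp: x_def field_simps)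
  have "(1 + x) / (1 - x) = 1 + 2 * r" "1 / x = (1 + r) / r"
    using r by (auto simp: x_def field_simps)
  then have "real (card (lattice_ball N (r * real N))) \<le> ((1 + r) / r) powr (r * real N) * (1 + 2 * r) ^ N"
    using card_lattice_ball_le[OF x, of N "r * real N"] by simp
  also have "((1 + r) / r) powr (r * real N) = (((1 + r) / r) powr r) ^ N"
    using r by (simp add: powr_powr[symmetric] powr_realpow)
  finally show ?thesis by (simp add: power_mult_distrib)
qed

lemma card_lattice_ball_dense:
  assumes nu: "0 \<le> \<nu>" and N: "0 < N"
  shows "real (card (lattice_ball N (2 powr \<nu> * real N))) \<le> 2 powr (real N * (5 + \<nu>))"
proof -
  define r where "r = (2::real) powr \<nu>"
  have r: "1 \<le> r" using nu by (simp add: r_def ge_one_powr_ge_zero)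
  have "((1 + r) / r) powr r \<le> exp (1 / r) powr r"
    using r exp_ge_add_one_self[of "1 / r"] by (intro powr_mono2) (auto simp: field_simps)
  also have "\<dots> = exp 1"
    using r by (simp add: powr_def)
  also have "\<dots> \<le> 3" by (rule exp_le)
  finally have "((1 + r) / r) powr r * (1 + 2 * r) \<le> 3 * (3 * r)"
    using r by (intro mult_mono) auto
  also have "\<dots> \<le> 32 * r" using r by simp
  also have "\<dots> = 2 powr (5 + \<nu>)" by (simp add: powr_add r_def)
  finally have "(((1 + r) / r) powr r * (1 + 2 * r)) ^ N \<le> (2 powr (5 + \<nu>)) ^ N"
    using r by (intro power_mono) auto
  then show ?thesis
    using card_lattice_ball_ratio[of r N] r N
    by (simp add: r_def[symmetric] powr_power mult.commute)
qed

lemma card_lattice_ball_sparse: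
  assumes nu: "0 \<le> \<nu>" and N: "0 < N"
  shows "real (card (lattice_ball N (2 powr (- \<nu>) * real N))) \<le> 2 powr (2 powr (- \<nu>) * real N * (5 + \<nu>))"
proof -
  define r where "r = (2::real) powr (- \<nu>)"
  have r: "0 < r" "r \<le> 1" using nu powr_mono[of "- \<nu>" 0 "2::real"] by (auto simp: r_def)
  have "(1 + r) / r \<le> 2 powr (1 + \<nu>)"
    using r by (simp add: r_def powr_minus powr_add field_simps)
  then have 1: "((1 + r) / r) powr r \<le> 2 powr (r * (1 + \<nu>))"
    using r powr_mono2[of r "(1 + r) / r" "2 powr (1 + \<nu>)"] by (simp add: powr_powr mult.commute)
  have "1 + 2 * r \<le> exp 2 powr r"
    using exp_ge_add_one_self[of "2 * r"] by (simp add: powr_def mult.commute)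
  also have "\<dots> \<le> 16 powr r"
  proof (rule powr_mono2)
    have "exp (2::real) = exp 1 * exp 1" by (simp flip: exp_add)
    also have "\<dots> \<le> 3 * 3" by (intro mult_mono exp_le) auto
    finally show "exp (2::real) \<le> 16" by simp
  qed (use r in auto)
  also have "(16::real) powr r = 2 powr (r * 4)"
    using powr_powr[of "2::real" 4 r] by (simp add: mult.commute)
  finally have "((1 + r) / r) powr r * (1 + 2 * r) \<le> 2 powr (r * (1 + \<nu>)) * 2 powr (r * 4)"
    using 1 r by (intro mult_mono) auto
  also have "\<dots> = 2 powr (r * (5 + \<nu>))" by (simp flip: powr_add add: algebra_simps)
  finally have "(((1 + r) / r) powr r * (1 + 2 * r)) ^ N \<le> (2 powr (r * (5 + \<nu>))) ^ N"
    using r by (intro power_mono) auto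
  also have "\<dots> = 2 powr (r * real N * (5 + \<nu>))"
    by (simp add: powr_power algebra_simps)
  finally show ?thesis
    using card_lattice_ball_ratio[of r N] r N by (simp add: r_def[symmetric])
qed

text \<open>Rounding toward zero keeps the error below both the step and the coefficient.\<close>

lemma ex_truncation:
  fixes c \<tau> :: real
  assumes "0 < \<tau>"
  shows "\<exists>z::int. real_of_int \<bar>z\<bar> \<le> \<bar>c\<bar> / \<tau> \<and> \<bar>c - \<tau> * real_of_int z\<bar> \<le> \<tau> \<and> \<bar>c - \<tau> * real_of_int z\<bar> \<le> \<bar>c\<bar>"
proof -
  have nonneg: "\<exists>z::int. 0 \<le> z \<and> real_of_int z \<le> b / \<tau> \<and> \<bar>b - \<tau> * real_of_int z\<bar> \<le> \<tau> \<and> \<bar>b - \<tau> * real_of_int z\<bar> \<le> b"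
    if "0 \<le> b" for b
  proof (intro exI[of _ "\<lfloor>b / \<tau>\<rfloor>"] conjI)
    have b: "real_of_int \<lfloor>b / \<tau>\<rfloor> * \<tau> \<le> b"
      using assms by (subst pos_le_divide_eq[symmetric]) simp_all
    have b': "b \<le> (real_of_int \<lfloor>b / \<tau>\<rfloor> + 1) * \<tau>"
      using assms real_of_int_floor_add_one_ge[of "b / \<tau>"] by (subst pos_divide_le_eq[symmetric])
    show 0: "0 \<le> \<lfloor>b / \<tau>\<rfloor>" using that assms by simp
    then have "0 \<le> real_of_int \<lfloor>b / \<tau>\<rfloor> * \<tau>" using assms by simp
    then show "\<bar>b - \<tau> * real_of_int \<lfloor>b / \<tau>\<rfloor>\<bar> \<le> b" "\<bar>b - \<tau> * real_of_int \<lfloor>b / \<tau>\<rfloor>\<bar> \<le> \<tau>"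
      using b b' by (simp_all add: algebra_simps)
  qed (rule of_int_floor_le)
  show ?thesis
  proof (cases "0 \<le> c")
    case True
    then obtain z :: int where "0 \<le> z" "real_of_int z \<le> c / \<tau>" "\<bar>c - \<tau> * real_of_int z\<bar> \<le> \<tau>" "\<bar>c - \<tau> * real_of_int z\<bar> \<le> c"
      using nonneg[of c] by auto
    then show ?thesis using True by (intro exI[of _ z]) auto
  next
    case False
    then obtain z :: int where z: "0 \<le> z" "real_of_int z \<le> - c / \<tau>" "\<bar>- c - \<tau> * real_of_int z\<bar> \<le> \<tau>" "\<bar>- c - \<tau> * real_of_int z\<bar> \<le> - c"
      using nonneg[of "- c"] by auto
    then show ?thesis using False by (intro exI[of _ "- z"]) auto
  qed
qed

text \<open>An \<open>\<ell>\<^sub>p\<close> bound for the coefficients becomes an \<open>\<ell>\<^sub>1\<close> bound for the truncated multiples, since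
\<open>\<bar>z\<bar> \<le> \<bar>z\<bar>\<^sup>p\<close> for integers.\<close>

lemma quantize_vector:
  fixes c :: "nat \<Rightarrow> real"
  assumes p: "1 \<le> p" and tau: "0 < \<tau>" and c: "(\<Sum>i<N. \<bar>c i\<bar> powr p) \<le> R"
  shows "\<exists>z \<in> lattice_ball N (R / \<tau> powr p). \<forall>i<N. \<bar>c i - \<tau> * real_of_int (z i)\<bar> \<le> \<tau> \<and> \<bar>c i - \<tau> * real_of_int (z i)\<bar> \<le> \<bar>c i\<bar>"
proof -
  have "\<exists>z. \<forall>i. real_of_int \<bar>z i\<bar> \<le> \<bar>c i\<bar> / \<tau> \<and> \<bar>c i - \<tau> * real_of_int (z i)\<bar> \<le> \<tau> \<and> \<bar>c i - \<tau> * real_of_int (z i)\<bar> \<le> \<bar>c i\<bar>"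
    by (intro choice allI ex_truncation tau)
  then obtain z :: "nat \<Rightarrow> int" where z: "\<And>i. real_of_int \<bar>z i\<bar> \<le> \<bar>c i\<bar> / \<tau>"
    "\<And>i. \<bar>c i - \<tau> * real_of_int (z i)\<bar> \<le> \<tau>" "\<And>i. \<bar>c i - \<tau> * real_of_int (z i)\<bar> \<le> \<bar>c i\<bar>"
    by blast
  define z' where "z' = restrict z {..<N}"
  have "real_of_int \<bar>z i\<bar> \<le> \<bar>c i\<bar> powr p / \<tau> powr p" for i
  proof -
    have "real_of_int \<bar>z i\<bar> \<le> real_of_int \<bar>z i\<bar> powr p"
    proof (cases "z i = 0")
      case False
      then have "1 \<le> real_of_int \<bar>z i\<bar>" by linarith
      then show ?thesis using powr_mono[OF p, of "real_of_int \<bar>z i\<bar>"] by simp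
    qed simp
    also have "\<dots> \<le> (\<bar>c i\<bar> / \<tau>) powr p"
      using z(1) p by (intro powr_mono2) auto
    finally show ?thesis using tau by (simp add: powr_divide)
  qed
  then have "(\<Sum>i<N. real_of_int \<bar>z i\<bar>) \<le> (\<Sum>i<N. \<bar>c i\<bar> powr p / \<tau> powr p)"
    by (intro sum_mono)
  also have "\<dots> \<le> R / \<tau> powr p"
    using c tau by (simp add: sum_divide_distrib[symmetric] divide_right_mono)
  finally have "z' \<in> lattice_ball N (R / \<tau> powr p)"
    by (simp add: lattice_ball_def z'_def)
  then show ?thesis
    using z by (intro bexI[of _ z']) (auto simp: z'_def)
qed

section \<open>A Schur test\<close>

text \<open>Hoelder's inequality up to the factor 2: below the threshold \<open>\<lambda>\<close> bound \<open>\<bar>f\<bar>\<close> by \<open>\<lambda>\<close>, above it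
  by \<open>\<lambda>\<^sup>1\<^sup>-\<^sup>p \<bar>f\<bar>\<^sup>p\<close>, and optimize \<open>\<lambda>\<close>.\<close>

lemma weighted_integral_powr_le:
  fixes f K :: "real \<Rightarrow> real"
  assumes p: "1 \<le> p" and f: "unit_supported f" and [measurable]: "K \<in> borel_measurable borel"
    and intf: "integrable lborel (\<lambda>x. \<bar>f x\<bar> powr p)" and K: "\<And>x. \<bar>K x\<bar> \<le> M"
    and B: "(LINT x|lborel. indicator {0..1} x * \<bar>K x\<bar>) \<le> B" "0 < B"
  shows "\<bar>LINT x|lborel. K x * f x\<bar> powr p \<le> 2 powr p * B powr (p - 1) * (LINT x|lborel. \<bar>K x\<bar> * \<bar>f x\<bar> powr p)"
proof -
  note [measurable] = unit_supportedD(1)[OF f]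
  let ?X = "LINT x|lborel. \<bar>K x\<bar> * \<bar>f x\<bar> powr p"
  let ?c = "LINT x|lborel. K x * f x"
  have int1: "integrable lborel (\<lambda>x. indicator {0..1} x * \<bar>K x\<bar>)"
  proof (rule Bochner_Integration.integrable_bound)
    show "integrable lborel (\<lambda>x::real. indicator {0..1} x * M)"
      by (intro integrable_mult_left integrable_real_indicator) auto
  qed (use K in \<open>auto simp: indicator_def intro: order_trans[OF _ abs_ge_self]\<close>)
  have int2: "integrable lborel (\<lambda>x. \<bar>K x\<bar> * \<bar>f x\<bar> powr p)"
    by (rule Bochner_Integration.integrable_bound[OF integrable_mult_right[OF intf, of M]])
      (auto simp: abs_mult intro!: AE_I2 mult_right_mono order_trans[OF K abs_ge_self])
  have X0: "0 \<le> ?X" by simp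
  have le: "\<bar>?c\<bar> \<le> l * B + l powr (1 - p) * ?X" if l: "0 < l" for l
  proof -
    have pt: "\<bar>K x * f x\<bar> \<le> l * (indicator {0..1} x * \<bar>K x\<bar>) + l powr (1 - p) * (\<bar>K x\<bar> * \<bar>f x\<bar> powr p)" for x
    proof (cases "x \<in> {0..1}")
      case True
      have "\<bar>f x\<bar> \<le> l + l powr (1 - p) * \<bar>f x\<bar> powr p"
      proof (cases "\<bar>f x\<bar> \<le> l")
        case True
        then show ?thesis by (simp add: add_increasing2)
      next
        case False
        then have "\<bar>f x\<bar> = \<bar>f x\<bar> powr (1 - p) * \<bar>f x\<bar> powr p"
          using l by (simp flip: powr_add)
        also have "\<dots> \<le> l powr (1 - p) * \<bar>f x\<bar> powr p"
          using False l p by (intro mult_right_mono powr_mono2') auto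
        finally show ?thesis using l by simp
      qed
      then have "\<bar>K x\<bar> * \<bar>f x\<bar> \<le> \<bar>K x\<bar> * (l + l powr (1 - p) * \<bar>f x\<bar> powr p)"
        by (intro mult_left_mono) auto
      then show ?thesis using True by (simp add: abs_mult algebra_simps)
    qed (simp add: unit_supportedD(2)[OF f])
    have "\<bar>?c\<bar> \<le> (LINT x|lborel. \<bar>K x * f x\<bar>)"
      by (rule integral_abs_bound)
    also have "\<dots> \<le> (LINT x|lborel. l * (indicator {0..1} x * \<bar>K x\<bar>) + l powr (1 - p) * (\<bar>K x\<bar> * \<bar>f x\<bar> powr p))"
    proof (rule integral_mono')
      show "integrable lborel (\<lambda>x. l * (indicator {0..1} x * \<bar>K x\<bar>) + l powr (1 - p) * (\<bar>K x\<bar> * \<bar>f x\<bar> powr p))"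
        by (intro Bochner_Integration.integrable_add integrable_mult_right int1 int2)
      show "\<bar>K x * f x\<bar> \<le> l * (indicator {0..1} x * \<bar>K x\<bar>) + l powr (1 - p) * (\<bar>K x\<bar> * \<bar>f x\<bar> powr p)" for x
        by (rule pt)
      show "0 \<le> l * (indicator {0..1} x * \<bar>K x\<bar>) + l powr (1 - p) * (\<bar>K x\<bar> * \<bar>f x\<bar> powr p)" for x
        using l by simp
    qed
    also have "\<dots> = l * (LINT x|lborel. indicator {0..1} x * \<bar>K x\<bar>) + l powr (1 - p) * ?X"
      using integrable_mult_right[OF int1, of l] integrable_mult_right[OF int2, of "l powr (1 - p)"]
      by (simp only: Bochner_Integration.integral_add integral_mult_right_zero)
    also have "\<dots> \<le> l * B + l powr (1 - p) * ?X"
      using B l by simp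
    finally show ?thesis .
  qed
  show ?thesis
  proof (cases "?X = 0")
    case True
    have "\<bar>?c\<bar> \<le> 0 + e" if "0 < e" for e
      using le[of "e / B"] that B by (simp add: True)
    then have "\<bar>?c\<bar> \<le> 0" by (rule field_le_epsilon)
    then show ?thesis using p by (simp add: True)
  next
    case False
    then have X: "0 < ?X" using X0 by linarith
    define l where "l = (?X / B) powr (1 / p)"
    have l: "0 < l" "l powr p = ?X / B"
      using X B p by (auto simp: l_def powr_powr)
    have "l powr (1 - p) * ?X = l * B"
      using X B l by (simp add: powr_diff)
    then have "\<bar>?c\<bar> \<le> 2 * (l * B)"
      using le[OF l(1)] by linarith
    then have "\<bar>?c\<bar> powr p \<le> (2 * (l * B)) powr p"
      using p by (intro powr_mono2) auto
    also have "\<dots> = 2 powr p * (?X / B * B powr p)"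
      using l B by (simp add: powr_mult)
    also have "\<dots> = 2 powr p * B powr (p - 1) * ?X"
      using B by (simp add: powr_diff)
    finally show ?thesis .
  qed
qed

text \<open>Rows enter through the weighted inequality above with exponent \<open>p - 1\<close>, columns by summing
\<open>\<bar>K i x\<bar> \<bar>f x\<bar>\<^sup>p\<close> over \<open>i\<close>. Both are normalized to the same \<open>B\<close>, so the bound is the \<open>p\<close>-th power
of \<open>2 * B\<close>.\<close>

lemma Schur_test:
  fixes f :: "real \<Rightarrow> real" and K :: "nat \<Rightarrow> real \<Rightarrow> real"
  assumes p: "1 \<le> p" and f: "unit_supported f" and K: "\<And>i. K i \<in> borel_measurable borel"
    and intf: "integrable lborel (\<lambda>x. \<bar>f x\<bar> powr p)" and f1: "(LINT x|lborel. \<bar>f x\<bar> powr p) \<le> 1"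
    and rows: "\<And>i. i < N \<Longrightarrow> (LINT x|lborel. indicator {0..1} x * \<bar>K i x\<bar>) \<le> B"
    and columns: "\<And>x. (\<Sum>i<N. \<bar>K i x\<bar>) \<le> real N * B" and B: "0 < B"
  shows "(\<Sum>i<N. \<bar>LINT x|lborel. K i x * f x\<bar> powr p) \<le> real N * (2 * B) powr p"
proof -
  note [measurable] = unit_supportedD(1)[OF f] K
  have bound: "\<bar>K i x\<bar> \<le> real N * B" if "i < N" for i x
  proof -
    have "\<bar>K i x\<bar> \<le> (\<Sum>i<N. \<bar>K i x\<bar>)"
      using that by (intro member_le_sum) auto
    also have "\<dots> \<le> real N * B" by (rule columns)
    finally show ?thesis .
  qed
  have int: "integrable lborel (\<lambda>x. \<bar>K i x\<bar> * \<bar>f x\<bar> powr p)" if "i < N" for i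
    by (rule Bochner_Integration.integrable_bound[OF integrable_mult_right[OF intf, of "real N * B"]])
      (use bound[OF that] B in \<open>auto simp: abs_mult intro!: mult_right_mono\<close>)
  have "(\<Sum>i<N. \<bar>LINT x|lborel. K i x * f x\<bar> powr p)
      \<le> (\<Sum>i<N. 2 powr p * B powr (p - 1) * (LINT x|lborel. \<bar>K i x\<bar> * \<bar>f x\<bar> powr p))"
    by (intro sum_mono weighted_integral_powr_le[where M="real N * B"] p f K intf bound rows B) auto
  also have "\<dots> = 2 powr p * B powr (p - 1) * (LINT x|lborel. (\<Sum>i<N. \<bar>K i x\<bar> * \<bar>f x\<bar> powr p))"
    by (subst Bochner_Integration.integral_sum) (auto simp: sum_distrib_left intro!: int)
  also have "\<dots> \<le> 2 powr p * B powr (p - 1) * (LINT x|lborel. real N * B * \<bar>f x\<bar> powr p)"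
  proof (intro mult_left_mono integral_mono' integrable_mult_right intf)
    show "(\<Sum>i<N. \<bar>K i x\<bar> * \<bar>f x\<bar> powr p) \<le> real N * B * \<bar>f x\<bar> powr p" for x
      unfolding sum_distrib_right[symmetric] by (intro mult_right_mono columns) auto
  qed (use B in auto)
  also have "\<dots> = 2 powr p * B powr (p - 1) * (real N * B * (LINT x|lborel. \<bar>f x\<bar> powr p))"
    by (simp only: integral_mult_right_zero)
  also have "\<dots> \<le> 2 powr p * B powr (p - 1) * (real N * B * 1)"
    using B f1 by (intro mult_left_mono) auto
  also have "\<dots> = real N * (2 * B) powr p"
    using B by (simp add: powr_mult powr_diff)
  finally show ?thesis .
qed

section \<open>Differences of the integrated kernel\<close>

lemma rl_kernel_Suc: "0 < a \<Longrightarrow> 0 \<le> u \<Longrightarrow> rl_kernel (a + 1) u = u powr a / Gamma (a + 1)"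
  by (auto simp: rl_kernel_def)

lemma rl_kernel_antitone: "0 < a \<Longrightarrow> a \<le> 1 \<Longrightarrow> 0 < u \<Longrightarrow> u \<le> v \<Longrightarrow> rl_kernel a v \<le> rl_kernel a u"
  by (auto simp: rl_kernel_def intro!: divide_right_mono powr_mono2')

lemma rl_kernel_Suc_mono: "0 < a \<Longrightarrow> u \<le> v \<Longrightarrow> rl_kernel (a + 1) u \<le> rl_kernel (a + 1) v"
  by (auto simp: rl_kernel_def intro!: divide_right_mono powr_mono2)

lemma rl_kernel_mean_value:
  assumes a: "0 < a" and uv: "0 \<le> u" "u < v"
  shows "\<exists>\<xi>. u < \<xi> \<and> \<xi> < v \<and> rl_kernel (a + 1) v - rl_kernel (a + 1) u = (v - u) * rl_kernel a \<xi>"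
proof -
  let ?G = "\<lambda>u. u powr a / Gamma (a + 1)"
  have G: "Gamma (a + 1) \<noteq> 0"
    using Gamma_real_pos[of "a + 1"] a by linarith
  have "continuous_on {u..v} (\<lambda>x. x powr a)"
    using a uv by (intro continuous_on_powr' continuous_on_id continuous_on_const) auto
  then have cont: "continuous_on {u..v} ?G"
    using G by (intro continuous_on_divide continuous_on_const) auto
  have deriv: "(?G has_real_derivative rl_kernel a x) (at x)" if "u < x" for x
  proof -
    have "(?G has_real_derivative a * x powr (a - 1) / Gamma (a + 1)) (at x)"
      using that uv G by (auto intro!: derivative_eq_intros)
    also have "a * x powr (a - 1) / Gamma (a + 1) = rl_kernel a x"
    proof -
      have "a \<notin> \<int>\<^sub>\<le>\<^sub>0" using a by (auto elim!: nonpos_Ints_cases)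
      then show ?thesis
        using a that uv Gamma_plus1[of a] by (simp add: rl_kernel_def add.commute)
    qed
    finally show ?thesis .
  qed
  obtain l z where z: "u < z" "z < v" "(?G has_real_derivative l) (at z)" "?G v - ?G u = (v - u) * l"
    using MVT[OF uv(2) cont] deriv by (auto simp: real_differentiable_def)
  have "l = rl_kernel a z"
    using DERIV_unique[OF z(3) deriv[OF z(1)]] .
  then show ?thesis
    using z a uv by (intro exI[of _ z]) (simp add: rl_kernel_Suc)
qed

text \<open>Concavity of the kernel of order \<open>a + 1\<close>, from the mean value theorem and the monotonicity of its
derivative. If the two increments overlap, exchanging the roles of step and shift makes them disjoint.\<close>

lemma rl_kernel_increment_antitone:
  assumes a: "0 < a" "a \<le> 1" and u: "0 \<le> u" "u \<le> v" and h: "0 \<le> h"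
  shows "rl_kernel (a + 1) (v + h) - rl_kernel (a + 1) v \<le> rl_kernel (a + 1) (u + h) - rl_kernel (a + 1) u"
proof -
  have disjoint: "rl_kernel (a + 1) (y + l) - rl_kernel (a + 1) y \<le> rl_kernel (a + 1) (x + l) - rl_kernel (a + 1) x"
    if x: "0 \<le> x" "x + l \<le> y" and l: "0 < l" for x y l
  proof -
    obtain s where s: "x < s" "s < x + l" "rl_kernel (a + 1) (x + l) - rl_kernel (a + 1) x = l * rl_kernel a s"
      using rl_kernel_mean_value[of a x "x + l"] a x l by auto
    obtain t where t: "y < t" "t < y + l" "rl_kernel (a + 1) (y + l) - rl_kernel (a + 1) y = l * rl_kernel a t"
      using rl_kernel_mean_value[of a y "y + l"] a x l by auto
    have "rl_kernel a t \<le> rl_kernel a s"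
      using s t x a by (intro rl_kernel_antitone) auto
    then show ?thesis using s t l by simp
  qed
  consider "h = 0" | "u = v" | "0 < h" "u + h \<le> v" | "u < v" "v < u + h"
    using u h by linarith
  then show ?thesis
  proof cases
    case 3
    then show ?thesis using disjoint u by simp
  next
    case 4
    then show ?thesis using disjoint[of u "v - u" "u + h"] u by (simp add: add.commute)
  qed auto
qed

definition second_difference :: "real \<Rightarrow> real \<Rightarrow> real \<Rightarrow> real" where
  "second_difference a h u = 2 * rl_kernel (a + 1) u - rl_kernel (a + 1) (u - h) - rl_kernel (a + 1) (u + h)"

lemma second_difference_measurable [measurable]: "second_difference a h \<in> borel_measurable borel"
  unfolding second_difference_def by measurable

text \<open>On the concave part a second difference is the drop between consecutive increments, so the sum
telescopes and is bounded by its first increment.\<close>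

lemma sum_second_difference_concave:
  assumes a: "0 < a" "a \<le> 1" and h: "0 \<le> h" and u: "h \<le> u"
  shows "(\<Sum>i<n. \<bar>second_difference a h (u + 2 * h * real i)\<bar>) \<le> rl_kernel (a + 1) h"
proof -
  define D where "D v = rl_kernel (a + 1) v - rl_kernel (a + 1) (v - h)" for v
  have anti: "D w \<le> D v" if "h \<le> v" "v \<le> w" for v w
    using rl_kernel_increment_antitone[OF a, of "v - h" "w - h" h] that h by (simp add: D_def)
  have "(\<Sum>i<n. \<bar>second_difference a h (u + 2 * h * real i)\<bar>) \<le> D u - D (u + 2 * h * real n)"
  proof (induction n)
    case (Suc n)
    let ?v = "u + 2 * h * real n"
    have v: "h \<le> ?v" using u h by (simp add: add_increasing2)
    have "second_difference a h ?v = D ?v - D (?v + h)"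
      by (simp add: second_difference_def D_def)
    moreover have "D (?v + h) \<le> D ?v" "D (?v + 2 * h) \<le> D (?v + h)"
      using anti v h by auto
    ultimately show ?case
      using Suc.IH by (simp add: algebra_simps)
  qed simp
  also have "\<dots> \<le> D h - 0"
  proof (rule diff_mono)
    show "D u \<le> D h" using anti u by simp
    show "0 \<le> D (u + 2 * h * real n)"
      using rl_kernel_Suc_mono[OF a(1), of "u + 2 * h * real n - h" "u + 2 * h * real n"] h by (simp add: D_def)
  qed
  also have "\<dots> = rl_kernel (a + 1) h"
    by (simp add: D_def) (simp add: rl_kernel_def)
  finally show ?thesis .
qed

text \<open>Second differences vanish left of the origin, and at most one term of the progression has its
stencil across the origin, because the points are two steps apart.\<close>

lemma sum_second_difference_le:
  assumes a: "0 < a" "a \<le> 1" and h: "0 < h"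
  shows "(\<Sum>i<n. \<bar>second_difference a h (u + 2 * h * real i)\<bar>) \<le> 2 * rl_kernel (a + 1) h"
proof (induction n arbitrary: u)
  case 0
  then show ?case using a by (simp add: rl_kernel_nonneg)
next
  case (Suc n)
  have split: "(\<Sum>i<Suc n. \<bar>second_difference a h (u + 2 * h * real i)\<bar>)
      = \<bar>second_difference a h u\<bar> + (\<Sum>i<n. \<bar>second_difference a h ((u + 2 * h) + 2 * h * real i)\<bar>)"
    unfolding sum.lessThan_Suc_shift by (simp add: algebra_simps)
  have G0: "0 \<le> rl_kernel (a + 1) h" using a by (simp add: rl_kernel_nonneg)
  consider "u \<le> - h" | "- h < u" "u \<le> 0" | "0 < u" "u < h" | "h \<le> u" by linarith
  then show ?case
  proof cases
    case 1
    then have "second_difference a h u = 0"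
      using h by (simp add: second_difference_def rl_kernel_def)
    then show ?thesis using Suc.IH unfolding split by simp
  next
    case 2
    then have "second_difference a h u = - rl_kernel (a + 1) (u + h)"
      using h by (simp add: second_difference_def rl_kernel_def)
    then have "\<bar>second_difference a h u\<bar> \<le> rl_kernel (a + 1) h"
      using rl_kernel_Suc_mono[OF a(1), of "u + h" h] 2 a by (simp add: rl_kernel_nonneg)
    then show ?thesis
      using sum_second_difference_concave[OF a, of h "u + 2 * h" n] h 2 unfolding split by simp
  next
    case 3
    have "second_difference a h u = 2 * rl_kernel (a + 1) u - rl_kernel (a + 1) (u + h)"
      using h 3 by (simp add: second_difference_def rl_kernel_def)
    moreover have "rl_kernel (a + 1) (u + h) - rl_kernel (a + 1) u \<le> rl_kernel (a + 1) h"
      using rl_kernel_increment_antitone[OF a, of 0 u h] 3 h by (simp add: rl_kernel_def)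
    moreover have "rl_kernel (a + 1) u \<le> rl_kernel (a + 1) (u + h)" "rl_kernel (a + 1) u \<le> rl_kernel (a + 1) h"
      using rl_kernel_Suc_mono[OF a(1)] 3 h by auto
    moreover have "0 \<le> rl_kernel (a + 1) u" using a by (simp add: rl_kernel_nonneg)
    ultimately have "\<bar>second_difference a h u\<bar> \<le> rl_kernel (a + 1) h" by linarith
    then show ?thesis
      using sum_second_difference_concave[OF a, of h "u + 2 * h" n] h 3 unfolding split by simp
  next
    case 4
    then show ?thesis
      using sum_second_difference_concave[OF a, of h u "Suc n"] h G0 by simp
  qed
qed

section \<open>Integrals over a uniform grid\<close>

lemma nn_integral_fold:
  assumes N: "0 < N" and [measurable]: "\<phi> \<in> borel_measurable borel"
  shows "(\<integral>\<^sup>+t. indicator {0..<1} t * \<phi> t \<partial>lborel)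
    = (\<Sum>j<N. \<integral>\<^sup>+y. indicator {0..<1 / real N} y * \<phi> (real j / real N + y) \<partial>lborel)"
proof -
  let ?I = "\<lambda>j. {real j / real N..<real j / real N + 1 / real N}"
  have floor: "t \<in> ?I j \<longleftrightarrow> real j \<le> real N * t \<and> real N * t < real j + 1" for t j
    using N by (auto simp: field_simps)
  have ind: "indicator {0..<1} t = (\<Sum>j<N. indicator (?I j) t :: ennreal)" for t
  proof -
    have "disjoint_family_on ?I {..<N}"
      unfolding disjoint_family_on_def
    proof (intro ballI impI equals0I)
      fix j k t assume "j \<noteq> k" "t \<in> ?I j \<inter> ?I k"
      then show False unfolding Int_iff floor by linarith
    qed
    then have "(\<Sum>j<N. indicator (?I j) t :: ennreal) = indicator (\<Union>j<N. ?I j) t"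
      by (rule indicator_UN_disjoint[OF finite_lessThan, symmetric])
    also have "(\<Union>j<N. ?I j) = {0..<1}"
    proof (intro equalityI subsetI)
      fix t assume "t \<in> (\<Union>j<N. ?I j)"
      then obtain j where "j < N" "t \<in> ?I j" by blast
      then have "real j + 1 \<le> real N" "real j \<le> real N * t" "real N * t < real j + 1"
        unfolding floor by auto
      then have "0 \<le> real N * t" "real N * t < real N * 1" by linarith+
      then show "t \<in> {0..<1}" using N by (simp add: zero_le_mult_iff)
    next
      fix t :: real assume t: "t \<in> {0..<1}"
      define j where "j = nat \<lfloor>real N * t\<rfloor>"
      have j: "real j \<le> real N * t" "real N * t < real j + 1"
        using t by (auto simp: j_def)
      have "real N * t < real N * 1" using t N by (intro mult_strict_left_mono) auto
      then have "j < N" using j by linarith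
      moreover have "t \<in> ?I j" unfolding floor using j by simp
      ultimately show "t \<in> (\<Union>j<N. ?I j)" by blast
    qed
    finally show ?thesis ..
  qed
  have "(\<integral>\<^sup>+t. indicator {0..<1} t * \<phi> t \<partial>lborel) = (\<integral>\<^sup>+t. (\<Sum>j<N. indicator (?I j) t * \<phi> t) \<partial>lborel)"
    unfolding ind by (simp add: sum_distrib_right)
  also have "\<dots> = (\<Sum>j<N. \<integral>\<^sup>+t. indicator (?I j) t * \<phi> t \<partial>lborel)"
    by (rule nn_integral_sum) simp
  also have "\<dots> = (\<Sum>j<N. \<integral>\<^sup>+y. indicator {0..<1 / real N} y * \<phi> (real j / real N + y) \<partial>lborel)"
  proof (rule sum.cong[OF refl])
    fix j
    show "(\<integral>\<^sup>+t. indicator (?I j) t * \<phi> t \<partial>lborel)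
        = (\<integral>\<^sup>+y. indicator {0..<1 / real N} y * \<phi> (real j / real N + y) \<partial>lborel)"
      by (subst nn_integral_real_affine[where c=1 and t="real j / real N"])
        (auto simp: indicator_def intro!: nn_integral_cong)
  qed
  finally show ?thesis .
qed

lemma AE_unit_lebesgue_half_openI:
  assumes "\<And>t. 0 \<le> t \<Longrightarrow> t < 1 \<Longrightarrow> P t"
  shows "AE t in unit_lebesgue. P t"
proof (rule AE_unit_lebesgueI)
  show "AE t in lborel. t \<in> {0..1} \<longrightarrow> P t"
    using AE_lborel_singleton[of 1] by eventually_elim (auto intro: assms)
qed

lemma dyadic_cell_less:
  fixes t :: real
  assumes "t < 1"
  shows "nat \<lfloor>2 ^ k * t\<rfloor> < 2 ^ k"
proof -
  have "2 ^ k * t < 2 ^ k * 1" using assms by (intro mult_strict_left_mono) auto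
  then have "2 ^ k * t < real (2 ^ k)" by simp
  then show ?thesis by (simp add: nat_less_iff floor_less_iff)
qed

lemma nn_integral_unit_half_open:
  "(\<integral>\<^sup>+t. \<phi> t \<partial>unit_lebesgue) = (\<integral>\<^sup>+t. indicator {0..<1} t * \<phi> t \<partial>lborel)"
  unfolding nn_integral_unit_lebesgue
  by (intro nn_integral_cong_AE) (use AE_lborel_singleton[of 1] in eventually_elim, auto simp: indicator_def)

text \<open>The integrand depends only on the grid cell containing its argument.\<close>

lemma nn_integral_step:
  assumes N: "0 < N" and c: "\<And>i. 0 \<le> c i"
  shows "(\<integral>\<^sup>+t. ennreal (c (nat \<lfloor>real N * t\<rfloor>)) \<partial>unit_lebesgue) = ennreal ((\<Sum>i<N. c i) / real N)"
proof -
  have [measurable]: "(\<lambda>t. ennreal (c (nat \<lfloor>real N * t\<rfloor>))) \<in> borel_measurable borel"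
    by measurable
  have floor: "nat \<lfloor>real N * (real j / real N + y)\<rfloor> = j" if "0 \<le> y" "y < 1 / real N" for j y
  proof -
    have "real N * (real j / real N + y) = real j + real N * y" "0 \<le> real N * y" "real N * y < 1"
      using that N by (auto simp: field_simps)
    then show ?thesis by linarith
  qed
  have "(\<integral>\<^sup>+t. ennreal (c (nat \<lfloor>real N * t\<rfloor>)) \<partial>unit_lebesgue)
      = (\<Sum>j<N. \<integral>\<^sup>+y. indicator {0..<1 / real N} y * ennreal (c (nat \<lfloor>real N * (real j / real N + y)\<rfloor>)) \<partial>lborel)"
    unfolding nn_integral_unit_half_open by (rule nn_integral_fold[OF N]) measurable
  also have "\<dots> = (\<Sum>j<N. \<integral>\<^sup>+y. ennreal (c j) * indicator {0..<1 / real N} y \<partial>lborel)"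
    by (intro sum.cong nn_integral_cong refl) (auto simp: floor indicator_def)
  also have "\<dots> = (\<Sum>j<N. ennreal (c j / real N))"
    using c by (simp add: nn_integral_cmult_indicator flip: ennreal_mult)
  also have "\<dots> = ennreal ((\<Sum>j<N. c j) / real N)"
    using c by (simp add: sum_ennreal sum_divide_distrib)
  finally show ?thesis .
qed

section \<open>Means of the kernel over dyadic cells\<close>

text \<open>The mean over the cell \<open>[i/2\<^sup>m, (i+1)/2\<^sup>m]\<close> of the kernel of order \<open>a\<close> translated by \<open>x\<close>, written with
its primitive, the kernel of order \<open>a + 1\<close>.\<close>

definition mean_kernel :: "real \<Rightarrow> nat \<Rightarrow> nat \<Rightarrow> real \<Rightarrow> real" where
  "mean_kernel a m i x = 2 ^ m * (rl_kernel (a + 1) ((real i + 1) / 2 ^ m - x) - rl_kernel (a + 1) (real i / 2 ^ m - x))"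

text \<open>The kernel of the unnormalized Haar coefficient: half the difference of the means over the two
children of a cell.\<close>

definition detail_kernel :: "real \<Rightarrow> nat \<Rightarrow> nat \<Rightarrow> real \<Rightarrow> real" where
  "detail_kernel a k i x = (mean_kernel a (Suc k) (2 * i) x - mean_kernel a (Suc k) (2 * i + 1) x) / 2"

lemma mean_kernel_measurable [measurable]: "mean_kernel a m i \<in> borel_measurable borel"
  unfolding mean_kernel_def by measurable

lemma detail_kernel_measurable [measurable]: "detail_kernel a k i \<in> borel_measurable borel"
  unfolding detail_kernel_def by measurable

lemma mean_kernel_parent:
  "mean_kernel a k i x = (mean_kernel a (Suc k) (2 * i) x + mean_kernel a (Suc k) (2 * i + 1) x) / 2"
proof -
  have "(real (2 * i + 1) + 1) / 2 ^ Suc k = (real i + 1) / 2 ^ k" "real (2 * i) / 2 ^ Suc k = real i / 2 ^ k"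
    "(real (2 * i) + 1) / 2 ^ Suc k = real (2 * i + 1) / 2 ^ Suc k"
    by (simp_all add: field_simps)
  then show ?thesis
    unfolding mean_kernel_def by (simp only:) (simp add: algebra_simps)
qed

lemma detail_kernel_eq:
  "detail_kernel a k i x = 2 ^ k * second_difference a (1 / 2 ^ Suc k) ((2 * real i + 1) / 2 ^ Suc k - x)"
proof -
  let ?m = "(2 * real i + 1) / 2 ^ Suc k"
  have "real (2 * i) / 2 ^ Suc k - x = ?m - x - 1 / 2 ^ Suc k"
    "(real (2 * i) + 1) / 2 ^ Suc k = ?m" "real (2 * i + 1) / 2 ^ Suc k = ?m"
    "(real (2 * i + 1) + 1) / 2 ^ Suc k - x = ?m - x + 1 / 2 ^ Suc k"
    by (simp_all add: add_divide_distrib)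
  moreover have "(2 ^ Suc k * (B - A) - 2 ^ Suc k * (C - B)) / 2 = 2 ^ k * (2 * B - A - C)" for A B C :: real
    by (simp add: field_simps)
  ultimately show ?thesis
    unfolding detail_kernel_def mean_kernel_def second_difference_def by (simp only:)
qed

text \<open>For fixed \<open>x\<close> the midpoints of the cells form an arithmetic progression with twice the step of the
second difference.\<close>

lemma detail_kernel_columns:
  assumes a: "0 < a" "a \<le> 1"
  shows "(\<Sum>i<n. \<bar>detail_kernel a k i x\<bar>) \<le> 2 ^ k * (2 * rl_kernel (a + 1) (1 / 2 ^ Suc k))"
proof -
  let ?h = "1 / 2 ^ Suc k :: real"
  have "(\<Sum>i<n. \<bar>detail_kernel a k i x\<bar>) = 2 ^ k * (\<Sum>i<n. \<bar>second_difference a ?h ((?h - x) + 2 * ?h * real i)\<bar>)"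
    unfolding detail_kernel_eq sum_distrib_left
    by (intro sum.cong refl) (simp add: abs_mult add_divide_distrib algebra_simps)
  also have "\<dots> \<le> 2 ^ k * (2 * rl_kernel (a + 1) ?h)"
    by (intro mult_left_mono sum_second_difference_le a) auto
  finally show ?thesis .
qed

text \<open>Folding the integral over the unit interval onto one dyadic cell turns the row integral into a
  mean of column sums.\<close>

lemma detail_kernel_rows:
  assumes a: "0 < a" "a \<le> 1"
  shows "(LINT x|lborel. indicator {0..1} x * \<bar>detail_kernel a k i x\<bar>) \<le> 2 * rl_kernel (a + 1) (1 / 2 ^ Suc k)"
proof -
  let ?h = "1 / 2 ^ Suc k :: real"
  let ?N = "2 ^ k :: nat"
  let ?B = "2 * rl_kernel (a + 1) ?h"
  have B: "0 \<le> ?B" using a by (simp add: rl_kernel_nonneg)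
  have sum: "(\<Sum>j<?N. \<bar>detail_kernel a k i (real j / real ?N + y)\<bar>) \<le> 2 ^ k * ?B" for y
  proof -
    have "(\<Sum>j<?N. \<bar>detail_kernel a k i (real j / real ?N + y)\<bar>)
        = (\<Sum>j<?N. \<bar>detail_kernel a k i (real (?N - Suc j) / real ?N + y)\<bar>)"
      by (rule sum.nat_diff_reindex[symmetric])
    also have "\<dots> = (\<Sum>j<?N. \<bar>2 ^ k * second_difference a ?h
        (((2 * real i + 1) / 2 ^ Suc k - y - (real ?N - 1) / real ?N) + 2 * ?h * real j)\<bar>)"
    proof (rule sum.cong[OF refl])
      fix j assume "j \<in> {..<?N}"
      then have r: "real (?N - Suc j) = real ?N - 1 - real j"
        by (simp add: of_nat_diff Suc_leI)
      have "(2 * real i + 1) / 2 ^ Suc k - (real (?N - Suc j) / real ?N + y)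
          = ((2 * real i + 1) / 2 ^ Suc k - y - (real ?N - 1) / real ?N) + 2 * ?h * real j"
        unfolding r by (simp add: diff_divide_distrib)
      then show "\<bar>detail_kernel a k i (real (?N - Suc j) / real ?N + y)\<bar> = \<bar>2 ^ k * second_difference a ?h
        (((2 * real i + 1) / 2 ^ Suc k - y - (real ?N - 1) / real ?N) + 2 * ?h * real j)\<bar>"
        unfolding detail_kernel_eq by (simp only:)
    qed
    also have "\<dots> = 2 ^ k * (\<Sum>j<?N. \<bar>second_difference a ?h
        (((2 * real i + 1) / 2 ^ Suc k - y - (real ?N - 1) / real ?N) + 2 * ?h * real j)\<bar>)"
      by (simp add: abs_mult sum_distrib_left)
    also have "\<dots> \<le> 2 ^ k * ?B"
      by (intro mult_left_mono sum_second_difference_le a) auto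
    finally show ?thesis .
  qed
  have "(\<integral>\<^sup>+x. ennreal (indicator {0..1} x * \<bar>detail_kernel a k i x\<bar>) \<partial>lborel)
      = (\<integral>\<^sup>+t. indicator {0..<1} t * ennreal \<bar>detail_kernel a k i t\<bar> \<partial>lborel)"
    unfolding nn_integral_unit_half_open[symmetric] nn_integral_unit_lebesgue
    by (intro nn_integral_cong) (auto simp: indicator_def)
  also have "\<dots> = (\<Sum>j<?N. \<integral>\<^sup>+y. indicator {0..<1 / real ?N} y * ennreal \<bar>detail_kernel a k i (real j / real ?N + y)\<bar> \<partial>lborel)"
    by (rule nn_integral_fold) auto
  also have "\<dots> = (\<integral>\<^sup>+y. (\<Sum>j<?N. indicator {0..<1 / real ?N} y * ennreal \<bar>detail_kernel a k i (real j / real ?N + y)\<bar>) \<partial>lborel)"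
    by (rule nn_integral_sum[symmetric]) auto
  also have "\<dots> \<le> (\<integral>\<^sup>+y. ennreal (2 ^ k * ?B) * indicator {0..<1 / real ?N} y \<partial>lborel)"
    unfolding sum_distrib_left[symmetric]
  proof (rule nn_integral_mono)
    fix y
    have "(\<Sum>j<?N. ennreal \<bar>detail_kernel a k i (real j / real ?N + y)\<bar>) \<le> ennreal (2 ^ k * ?B)"
      using sum[of y] by (subst sum_ennreal) (auto intro: ennreal_leI)
    then show "indicator {0..<1 / real ?N} y * (\<Sum>j<?N. ennreal \<bar>detail_kernel a k i (real j / real ?N + y)\<bar>)
        \<le> ennreal (2 ^ k * ?B) * indicator {0..<1 / real ?N} y"
      by (auto simp: indicator_def)
  qed
  also have "\<dots> = ennreal ?B"
    using B by (simp add: nn_integral_cmult_indicator flip: ennreal_mult)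
  finally show ?thesis
    using B by (subst integral_eq_nn_integral) (auto intro!: enn2real_leI)
qed

lemma mean_kernel_nonneg: "0 < a \<Longrightarrow> 0 \<le> mean_kernel a m i x"
  by (auto simp: mean_kernel_def divide_right_mono intro!: mult_nonneg_nonneg rl_kernel_Suc_mono)

text \<open>If \<open>x\<close> is at least two cell lengths away, the kernel is evaluated at points that are
negative or at least \<open>\<bar>t - x\<bar> / 2\<close>; otherwise concavity bounds the mean by that over the first cell, and the cell length
exceeds \<open>\<bar>t - x\<bar> / 2\<close>. The bound is independent of \<open>m\<close> and serves as a dominating function.\<close>

lemma mean_kernel_le_abs_powr:
  assumes a: "0 < a" "a < 1" and t: "real i / 2 ^ m \<le> t" "t < (real i + 1) / 2 ^ m" and x: "x \<noteq> t"
  shows "mean_kernel a m i x \<le> (1 / Gamma a + 1 / Gamma (a + 1)) * (\<bar>t - x\<bar> / 2) powr (a - 1)"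
proof -
  define l r h d where "l = real i / 2 ^ m" and "r = (real i + 1) / 2 ^ m" and "h = 1 / (2::real) ^ m" and "d = \<bar>t - x\<bar>"
  have h: "0 < h" "r = l + h" by (auto simp: h_def l_def r_def add_divide_distrib)
  have d: "0 < d" using x by (simp add: d_def)
  have lt: "l \<le> t" "t < r" using t by (auto simp: l_def r_def)
  have mean: "mean_kernel a m i x = (rl_kernel (a + 1) (r - x) - rl_kernel (a + 1) (l - x)) / h"
    by (simp add: mean_kernel_def l_def r_def h_def)
  have Gam: "0 < Gamma a" "0 < Gamma (a + 1)" using a by auto
  have "mean_kernel a m i x \<le> (d / 2) powr (a - 1) / Gamma a \<or> mean_kernel a m i x \<le> (d / 2) powr (a - 1) / Gamma (a + 1)"
  proof (cases "2 * h \<le> d")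
    case True
    show ?thesis
    proof (cases "x < t")
      case True
      then have lx: "d / 2 \<le> l - x" using \<open>2 * h \<le> d\<close> lt h by (auto simp: d_def)
      obtain s where s: "l - x < s" "rl_kernel (a + 1) (r - x) - rl_kernel (a + 1) (l - x) = h * rl_kernel a s"
        using rl_kernel_mean_value[of a "l - x" "r - x"] a lx d h by auto
      have "mean_kernel a m i x = rl_kernel a s"
        unfolding mean s(2) using h by simp
      also have "\<dots> \<le> rl_kernel a (d / 2)"
        using a d s lx by (intro rl_kernel_antitone) auto
      finally show ?thesis using d by (simp add: rl_kernel_def)
    next
      case False
      then have "r - x \<le> 0" "l - x \<le> 0" using \<open>2 * h \<le> d\<close> lt h by (auto simp: d_def)
      then have "mean_kernel a m i x = 0" by (simp add: mean rl_kernel_def)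
      then show ?thesis using Gam by simp
    qed
  next
    case False
    have "rl_kernel (a + 1) (r - x) - rl_kernel (a + 1) (l - x) \<le> rl_kernel (a + 1) h"
    proof (cases "0 \<le> l - x")
      case True
      then show ?thesis
        using rl_kernel_increment_antitone[of a 0 "l - x" h] a h by (simp add: rl_kernel_def[of _ 0] algebra_simps)
    next
      case False
      then have "rl_kernel (a + 1) (r - x) \<le> rl_kernel (a + 1) h" "rl_kernel (a + 1) (l - x) = 0"
        using a h by (auto intro!: rl_kernel_Suc_mono simp: rl_kernel_def[of _ "l - x"])
      then show ?thesis by simp
    qed
    then have "mean_kernel a m i x \<le> rl_kernel (a + 1) h / h"
      unfolding mean using h by (intro divide_right_mono) auto
    also have "\<dots> = h powr (a - 1) / Gamma (a + 1)"
      using a h by (simp add: rl_kernel_def powr_diff)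
    also have "\<dots> \<le> (d / 2) powr (a - 1) / Gamma (a + 1)"
      using False a d h by (intro divide_right_mono powr_mono2') auto
    finally show ?thesis by simp
  qed
  moreover have "(1 / Gamma a + 1 / Gamma (a + 1)) * (d / 2) powr (a - 1)
      = (d / 2) powr (a - 1) / Gamma a + (d / 2) powr (a - 1) / Gamma (a + 1)"
    by (simp add: algebra_simps)
  moreover have "0 \<le> (d / 2) powr (a - 1) / Gamma a" "0 \<le> (d / 2) powr (a - 1) / Gamma (a + 1)"
    using Gam by auto
  ultimately show ?thesis unfolding d_def by linarith
qed

lemma mean_kernel_tendsto:
  assumes a: "0 < a" and t: "0 \<le> t" and x: "x \<noteq> t"
  shows "(\<lambda>m. mean_kernel a m (nat \<lfloor>2 ^ m * t\<rfloor>) x) \<longlonglongrightarrow> rl_kernel a (t - x)"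
proof -
  define l where "l m = real (nat \<lfloor>2 ^ m * t\<rfloor>) / 2 ^ m" for m
  define h where "h m = 1 / (2::real) ^ m" for m
  have h: "h \<longlonglongrightarrow> 0"
    unfolding h_def by (intro LIMSEQ_divide_realpow_zero) auto
  have lt: "l m \<le> t" "t < l m + h m" "0 < h m" for m
  proof -
    have "real (nat \<lfloor>2 ^ m * t\<rfloor>) \<le> 2 ^ m * t" "2 ^ m * t < real (nat \<lfloor>2 ^ m * t\<rfloor>) + 1"
      using t by auto
    then show "l m \<le> t" "t < l m + h m" "0 < h m"
      by (auto simp: l_def h_def field_simps)
  qed
  have mean: "mean_kernel a m (nat \<lfloor>2 ^ m * t\<rfloor>) x
      = (rl_kernel (a + 1) (l m + h m - x) - rl_kernel (a + 1) (l m - x)) / h m" for m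
    by (simp add: mean_kernel_def l_def h_def add_divide_distrib)
  show ?thesis
  proof (cases "x < t")
    case True
    have ev: "eventually (\<lambda>m. h m < t - x) sequentially"
      using h True by (intro order_tendstoD) auto
    have "\<forall>m. \<exists>s. h m < t - x \<longrightarrow> t - x - h m < s \<and> s < t - x + h m \<and>
        mean_kernel a m (nat \<lfloor>2 ^ m * t\<rfloor>) x = rl_kernel a s"
    proof
      fix m
      show "\<exists>s. h m < t - x \<longrightarrow> t - x - h m < s \<and> s < t - x + h m \<and>
        mean_kernel a m (nat \<lfloor>2 ^ m * t\<rfloor>) x = rl_kernel a s"
      proof (cases "h m < t - x")
        case True
        then obtain s where s: "l m - x < s" "s < l m + h m - x"
          "rl_kernel (a + 1) (l m + h m - x) - rl_kernel (a + 1) (l m - x) = (l m + h m - x - (l m - x)) * rl_kernel a s"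
          using rl_kernel_mean_value[of a "l m - x" "l m + h m - x"] a lt[of m] by auto
        then show ?thesis
          using lt[of m] by (intro exI[of _ s]) (auto simp: mean)
      qed auto
    qed
    then obtain s where s: "\<And>m. h m < t - x \<Longrightarrow> t - x - h m < s m \<and> s m < t - x + h m \<and>
        mean_kernel a m (nat \<lfloor>2 ^ m * t\<rfloor>) x = rl_kernel a (s m)"
      by metis
    have "s \<longlonglongrightarrow> t - x"
    proof (rule tendsto_sandwich)
      show "(\<lambda>m. t - x - h m) \<longlonglongrightarrow> t - x" "(\<lambda>m. t - x + h m) \<longlonglongrightarrow> t - x"
        using tendsto_diff[OF tendsto_const h, of "t - x"] tendsto_add[OF tendsto_const h, of "t - x"] by simp_all
    qed (use ev s in \<open>auto elim!: eventually_mono intro: less_imp_le\<close>)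
    then have "(\<lambda>m. s m powr (a - 1) / Gamma a) \<longlonglongrightarrow> (t - x) powr (a - 1) / Gamma a"
      using True Gamma_real_pos[OF a] by (intro tendsto_intros) auto
    moreover have "eventually (\<lambda>m. mean_kernel a m (nat \<lfloor>2 ^ m * t\<rfloor>) x = s m powr (a - 1) / Gamma a) sequentially"
      using ev
    proof eventually_elim
      case (elim m)
      then have "0 < s m" using s[of m] by auto
      then show ?case using s[of m] elim by (simp add: rl_kernel_def)
    qed
    ultimately show ?thesis
      using True by (simp add: rl_kernel_def tendsto_cong)
  next
    case False
    then have ev: "eventually (\<lambda>m. h m < x - t) sequentially"
      using h x by (intro order_tendstoD) auto
    have "eventually (\<lambda>m. mean_kernel a m (nat \<lfloor>2 ^ m * t\<rfloor>) x = 0) sequentially"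
      using ev
    proof eventually_elim
      case (elim m)
      then have "l m + h m - x \<le> 0" "l m - x \<le> 0" using lt[of m] by auto
      then show ?case by (simp add: mean rl_kernel_def)
    qed
    then show ?thesis
      using False by (simp add: rl_kernel_def tendsto_cong)
  qed
qed

section \<open>Quantizing the details of one dyadic level\<close>

definition detail :: "real \<Rightarrow> (real \<Rightarrow> real) \<Rightarrow> nat \<Rightarrow> nat \<Rightarrow> real" where
  "detail a f k i = (LINT x|lborel. detail_kernel a k i x * f x)"

definition mean :: "real \<Rightarrow> (real \<Rightarrow> real) \<Rightarrow> nat \<Rightarrow> nat \<Rightarrow> real" where
  "mean a f m i = (LINT x|lborel. mean_kernel a m i x * f x)"

text \<open>The step function of means over the dyadic cells of level \<open>m\<close>. It is defined through the kernels and
not as a mean of the image function, which makes each level an integral operator from the outset.\<close>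

definition step_mean :: "real \<Rightarrow> (real \<Rightarrow> real) \<Rightarrow> nat \<Rightarrow> real \<Rightarrow> real" where
  "step_mean a f m t = mean a f m (nat \<lfloor>2 ^ m * t\<rfloor>)"

definition haar_sign :: "nat \<Rightarrow> real \<Rightarrow> real" where
  "haar_sign k t = (if even (nat \<lfloor>2 ^ Suc k * t\<rfloor>) then 1 else - 1)"

lemma abs_haar_sign [simp]: "\<bar>haar_sign k t\<bar> = 1"
  by (simp add: haar_sign_def)

lemma haar_sign_measurable [measurable]: "haar_sign k \<in> borel_measurable borel"
  unfolding haar_sign_def by measurable

lemma step_mean_measurable [measurable]: "step_mean a f m \<in> borel_measurable borel"
  unfolding step_mean_def by measurable

lemma integrable_mean_kernel:
  assumes a: "0 < a" and f: "unit_supported f" "integrable lborel f"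
  shows "integrable lborel (\<lambda>x. mean_kernel a m i x * f x)"
proof (rule Bochner_Integration.integrable_bound[OF integrable_mult_right[OF f(2), of "2 ^ m * rl_kernel (a + 1) ((real i + 1) / 2 ^ m)"]])
  note [measurable] = unit_supportedD(1)[OF f(1)]
  show "(\<lambda>x. mean_kernel a m i x * f x) \<in> borel_measurable lborel" by simp
  show "AE x in lborel. norm (mean_kernel a m i x * f x) \<le> norm (2 ^ m * rl_kernel (a + 1) ((real i + 1) / 2 ^ m) * f x)"
  proof (rule AE_I2)
    fix x
    show "norm (mean_kernel a m i x * f x) \<le> norm (2 ^ m * rl_kernel (a + 1) ((real i + 1) / 2 ^ m) * f x)"
    proof (cases "x \<in> {0..1}")
      case True
      have "rl_kernel (a + 1) ((real i + 1) / 2 ^ m - x) \<le> rl_kernel (a + 1) ((real i + 1) / 2 ^ m)"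
        using True a by (intro rl_kernel_Suc_mono) auto
      moreover have "0 \<le> rl_kernel (a + 1) (real i / 2 ^ m - x)" using a by (simp add: rl_kernel_nonneg)
      ultimately have "mean_kernel a m i x \<le> 2 ^ m * rl_kernel (a + 1) ((real i + 1) / 2 ^ m)"
        unfolding mean_kernel_def by (intro mult_left_mono) auto
      then show ?thesis
        using a mean_kernel_nonneg[of a m i x] by (simp add: abs_mult rl_kernel_nonneg mult_right_mono)
    qed (simp add: unit_supportedD(2)[OF f(1)])
  qed
qed

text \<open>The parent of a dyadic cell.\<close>

lemma floor_double: "0 \<le> s \<Longrightarrow> nat \<lfloor>s\<rfloor> = nat \<lfloor>2 * s\<rfloor> div 2" for s :: real
  by linarith

lemma step_mean_Suc:
  assumes a: "0 < a" and f: "unit_supported f" "integrable lborel f" and t: "0 \<le> t"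
  shows "step_mean a f (Suc k) t = step_mean a f k t + haar_sign k t * detail a f k (nat \<lfloor>2 ^ k * t\<rfloor>)"
proof -
  define j where "j = nat \<lfloor>2 ^ Suc k * t\<rfloor>"
  define i where "i = nat \<lfloor>2 ^ k * t\<rfloor>"
  have i: "i = j div 2"
    using floor_double[of "2 ^ k * t"] t by (simp add: i_def j_def mult.assoc)
  note int = integrable_mean_kernel[OF a f]
  have parent: "mean a f k i = (mean a f (Suc k) (2 * i) + mean a f (Suc k) (2 * i + 1)) / 2"
    unfolding mean_def mean_kernel_parent[of a k i] using int[of "Suc k"]
    by (simp add: algebra_simps)
  have det: "detail a f k i = (mean a f (Suc k) (2 * i) - mean a f (Suc k) (2 * i + 1)) / 2"
    unfolding mean_def detail_def detail_kernel_def using int[of "Suc k"]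
    by (simp add: algebra_simps)
  have "j = 2 * i \<or> j = 2 * i + 1" using i by presburger
  then show ?thesis
  proof
    assume j: "j = 2 * i"
    then have "haar_sign k t = 1" unfolding haar_sign_def j_def[symmetric] by simp
    then show ?thesis
      unfolding step_mean_def i_def[symmetric] j_def[symmetric] using parent det j by (simp add: field_simps)
  next
    assume j: "j = 2 * i + 1"
    then have "haar_sign k t = - 1" unfolding haar_sign_def j_def[symmetric] by simp
    then show ?thesis
      unfolding step_mean_def i_def[symmetric] j_def[symmetric] using parent det j by (simp add: field_simps)
  qed
qed

text \<open>Twice the bound \<open>2 * rl_kernel (a + 1) h\<close>, \<open>h = 2\<^sup>-\<^sup>k\<^sup>-\<^sup>1\<close>, that rows and normalized columns of the
detail kernels share; the Schur test doubles it.\<close>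

definition level_bound :: "real \<Rightarrow> nat \<Rightarrow> real" where
  "level_bound a k = 4 * rl_kernel (a + 1) (1 / 2 ^ Suc k)"

lemma level_bound_eq: "level_bound a k = level_bound a 0 * 2 powr (- (real k * a))"
proof -
  have "(1 / 2 ^ Suc k :: real) = (1 / 2) * 2 powr (- real k)"
    by (simp add: powr_minus powr_realpow field_simps)
  then have "(1 / 2 ^ Suc k :: real) powr a = (1 / 2) powr a * 2 powr (- (real k * a))"
    by (simp only: powr_mult powr_powr) simp
  then show ?thesis by (simp add: level_bound_def rl_kernel_def)
qed

lemma level_bound_pos: "0 < a \<Longrightarrow> 0 < level_bound a k"
  by (simp add: level_bound_def rl_kernel_def)

lemma Lp_le_finite_integral:
  assumes p: "1 \<le> p" and f: "unit_supported f" and le: "Lp_le (ereal p) 1 f"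
  shows "integrable lborel (\<lambda>x. \<bar>f x\<bar> powr p)" "(LINT x|lborel. \<bar>f x\<bar> powr p) \<le> 1"
proof -
  note [measurable] = unit_supportedD(1)[OF f]
  have "(\<integral>\<^sup>+x. ennreal (\<bar>f x\<bar> powr p) \<partial>lborel) = (\<integral>\<^sup>+x. ennreal (\<bar>f x\<bar> powr p) \<partial>unit_lebesgue)"
    by (rule nn_integral_unit_supported[OF f, where \<phi>="\<lambda>y. ennreal (\<bar>y\<bar> powr p)", symmetric]) simp
  also have "\<dots> \<le> ennreal 1"
    using le p Lp_le_finite_iff[of p 1 f] by simp
  finally have nn: "(\<integral>\<^sup>+x. ennreal (\<bar>f x\<bar> powr p) \<partial>lborel) \<le> ennreal 1" .
  then show "integrable lborel (\<lambda>x. \<bar>f x\<bar> powr p)"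
    by (intro integrableI_bounded) (auto intro: le_less_trans)
  show "(LINT x|lborel. \<bar>f x\<bar> powr p) \<le> 1"
    using nn by (subst integral_eq_nn_integral) (auto intro!: enn2real_leI)
qed

lemma Lp_le_integrable:
  assumes p: "1 \<le> p" and f: "unit_supported f" and le: "Lp_le p E f"
  shows "integrable lborel f"
proof -
  have "Lp_le p (E + 1) f" using le by (rule Lp_le_mono) simp
  then have "Lp_le 1 (2 * (E + 1)) f"
    using p Lp_le_nonneg[OF le] by (intro Lp_le_embed) auto
  then show ?thesis
    using f by (intro Lp_fun_1_integrable) (auto simp: Lp_le_def)
qed

lemma sum_detail_le:
  assumes a: "0 < a" "a \<le> 1" and p: "1 \<le> p" and f: "unit_supported f" "Lp_le (ereal p) 1 f"
  shows "(\<Sum>i<2 ^ k. \<bar>detail a f k i\<bar> powr p) \<le> 2 ^ k * level_bound a k powr p"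
proof -
  let ?B = "2 * rl_kernel (a + 1) (1 / 2 ^ Suc k)"
  have "(\<Sum>i<2 ^ k. \<bar>detail a f k i\<bar> powr p) \<le> real (2 ^ k) * (2 * ?B) powr p"
    unfolding detail_def
  proof (rule Schur_test[OF p f(1) _ Lp_le_finite_integral[OF p f]])
    show "(\<Sum>i<2 ^ k. \<bar>detail_kernel a k i x\<bar>) \<le> real (2 ^ k) * ?B" for x
      using detail_kernel_columns[OF a, of k x "2 ^ k"] by simp
    show "0 < ?B" using a by (simp add: rl_kernel_def)
  qed (use detail_kernel_rows[OF a] in auto)
  then show ?thesis by (simp add: level_bound_def)
qed

text \<open>The ratio \<open>p/q\<close>, which vanishes at \<open>q = \<infinity>\<close>.\<close>

definition exponent_ratio :: "real \<Rightarrow> ereal \<Rightarrow> real" where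
  "exponent_ratio p q = p * real_of_ereal (1 / q)"

text \<open>For finite \<open>q\<close> the second bound integrates \<open>\<bar>e\<bar>\<^sup>q \<le> \<tau>\<^sup>q\<^sup>-\<^sup>p \<bar>c\<bar>\<^sup>p\<close>; at \<open>q = \<infinity>\<close> the exponent ratio is 0 and
it coincides with the first.\<close>

lemma step_error:
  assumes p: "1 \<le> p" "ereal p \<le> q" and tau: "0 < \<tau>" and rho: "0 < \<rho>"
    and sum: "(\<Sum>i<2 ^ k. \<bar>c i\<bar> powr p) \<le> 2 ^ k * \<rho> powr p"
    and e: "\<And>i. i < 2 ^ k \<Longrightarrow> \<bar>e i\<bar> \<le> \<tau> \<and> \<bar>e i\<bar> \<le> \<bar>c i\<bar>"
  shows "Lp_le q \<tau> (\<lambda>t. haar_sign k t * e (nat \<lfloor>2 ^ k * t\<rfloor>))" (is "Lp_le q _ ?g")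
    and "Lp_le q (\<rho> powr exponent_ratio p q * \<tau> powr (1 - exponent_ratio p q)) (\<lambda>t. haar_sign k t * e (nat \<lfloor>2 ^ k * t\<rfloor>))"
proof -
  have q: "1 \<le> q" using p by (metis ereal_less_eq(3) one_ereal_def order_trans)
  have [measurable]: "?g \<in> borel_measurable borel" by measurable
  show 1: "Lp_le q \<tau> ?g"
  proof (rule Lp_le_bounded[OF q])
    show "?g \<in> borel_measurable unit_lebesgue" by (rule borel_measurable_unit_lebesgue) simp
    show "AE t in unit_lebesgue. \<bar>?g t\<bar> \<le> \<tau>"
      by (rule AE_unit_lebesgue_half_openI) (use e dyadic_cell_less in \<open>simp add: abs_mult\<close>)
  qed (use tau in simp)
  show "Lp_le q (\<rho> powr exponent_ratio p q * \<tau> powr (1 - exponent_ratio p q)) ?g"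
    using q
  proof (cases rule: ereal_ge_1_cases)
    case 1
    then show ?thesis
      using \<open>Lp_le q \<tau> ?g\<close> tau rho by (simp add: exponent_ratio_def)
  next
    case (2 s)
    have ps: "p \<le> s" using p 2 by simp
    have th: "exponent_ratio p q = p / s" using 2 by (simp add: exponent_ratio_def one_ereal_def)
    let ?E = "\<rho> powr (p / s) * \<tau> powr (1 - p / s)"
    have Es: "?E powr s = \<rho> powr p * \<tau> powr (s - p)"
      using 2 by (simp add: powr_mult powr_powr left_diff_distrib)
    define e' where "e' i = (if i < 2 ^ k then \<bar>e i\<bar> powr s else 0)" for i
    have e': "e' i \<le> \<tau> powr (s - p) * \<bar>c i\<bar> powr p" if "i < 2 ^ k" for i
    proof -
      have "\<bar>e i\<bar> powr s = \<bar>e i\<bar> powr (s - p) * \<bar>e i\<bar> powr p"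
        by (simp flip: powr_add)
      also have "\<dots> \<le> \<tau> powr (s - p) * \<bar>c i\<bar> powr p"
        using e[OF that] ps p by (intro mult_mono powr_mono2) auto
      finally show ?thesis using that by (simp add: e'_def)
    qed
    have "(\<integral>\<^sup>+t. ennreal (\<bar>?g t\<bar> powr s) \<partial>unit_lebesgue)
        = (\<integral>\<^sup>+t. ennreal (e' (nat \<lfloor>real (2 ^ k) * t\<rfloor>)) \<partial>unit_lebesgue)"
      by (intro nn_integral_cong_AE AE_unit_lebesgue_half_openI)
        (use dyadic_cell_less in \<open>auto simp: e'_def abs_mult\<close>)
    also have "\<dots> = ennreal ((\<Sum>i<2 ^ k. e' i) / real (2 ^ k))"
      by (rule nn_integral_step) (auto simp: e'_def)
    also have "\<dots> \<le> ennreal (?E powr s)"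
    proof (rule ennreal_leI)
      have "(\<Sum>i<2 ^ k. e' i) \<le> (\<Sum>i<2 ^ k. \<tau> powr (s - p) * \<bar>c i\<bar> powr p)"
        using e' by (intro sum_mono) auto
      also have "\<dots> \<le> \<tau> powr (s - p) * (2 ^ k * \<rho> powr p)"
        unfolding sum_distrib_left[symmetric] by (intro mult_left_mono sum) auto
      finally show "(\<Sum>i<2 ^ k. e' i) / real (2 ^ k) \<le> ?E powr s"
        unfolding Es by (simp add: field_simps)
    qed
    finally have "Lp_le (ereal s) ?E ?g"
      using 2 by (subst Lp_le_finite_iff) (auto intro: borel_measurable_unit_lebesgue)
    then show ?thesis using th 2 by simp
  qed
qed

definition level_step :: "nat \<Rightarrow> real \<Rightarrow> (nat \<Rightarrow> int) \<Rightarrow> real \<Rightarrow> real" where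
  "level_step k \<tau> z t = haar_sign k t * (\<tau> * real_of_int (z (nat \<lfloor>2 ^ k * t\<rfloor>)))"

lemma level_step_measurable [measurable]: "level_step k \<tau> z \<in> borel_measurable borel"
  unfolding level_step_def by measurable

text \<open>The parameter \<open>\<nu>\<close> is the binary logarithm of the step relative to the size of the details: negative
\<open>\<nu>\<close> gives many vectors and small errors, positive \<open>\<nu>\<close> few nonzero coefficients.\<close>

lemma level_quantization:
  assumes a: "0 < a" "a \<le> 1" and p: "1 \<le> p" "ereal p \<le> q" and f: "unit_supported f" "Lp_le (ereal p) 1 f"
  shows "\<exists>z \<in> lattice_ball (2 ^ k) (2 powr (- (p * \<nu>)) * 2 ^ k).
    Lp_le q (level_bound a k * 2 powr \<nu>) (\<lambda>t. step_mean a f (Suc k) t - step_mean a f k t - level_step k (level_bound a k * 2 powr \<nu>) z t) \<and>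
    Lp_le q (level_bound a k * 2 powr ((1 - exponent_ratio p q) * \<nu>))
      (\<lambda>t. step_mean a f (Suc k) t - step_mean a f k t - level_step k (level_bound a k * 2 powr \<nu>) z t)"
proof -
  define \<rho> where "\<rho> = level_bound a k"
  define \<tau> where "\<tau> = \<rho> * 2 powr \<nu>"
  have rho: "0 < \<rho>" using a by (simp add: \<rho>_def level_bound_pos)
  then have tau: "0 < \<tau>" by (simp add: \<tau>_def)
  have int: "integrable lborel f"
    using p f by (intro Lp_le_integrable[of "ereal p"]) auto
  have sum: "(\<Sum>i<2 ^ k. \<bar>detail a f k i\<bar> powr p) \<le> 2 ^ k * \<rho> powr p"
    unfolding \<rho>_def by (rule sum_detail_le[OF a p(1) f])
  have K: "2 ^ k * \<rho> powr p / \<tau> powr p = 2 powr (- (p * \<nu>)) * 2 ^ k"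
    using rho by (simp add: \<tau>_def powr_mult powr_powr powr_minus field_simps)
  obtain z where z: "z \<in> lattice_ball (2 ^ k) (2 powr (- (p * \<nu>)) * 2 ^ k)"
    and e: "\<forall>i<2 ^ k. \<bar>detail a f k i - \<tau> * real_of_int (z i)\<bar> \<le> \<tau> \<and> \<bar>detail a f k i - \<tau> * real_of_int (z i)\<bar> \<le> \<bar>detail a f k i\<bar>"
    using quantize_vector[OF p(1) tau sum] unfolding K by blast
  have ratio: "\<rho> powr exponent_ratio p q * \<tau> powr (1 - exponent_ratio p q) = \<rho> * 2 powr ((1 - exponent_ratio p q) * \<nu>)"
    using rho by (simp add: \<tau>_def powr_mult powr_powr mult.commute powr_diff right_diff_distrib)
  let ?h = "\<lambda>t. step_mean a f (Suc k) t - step_mean a f k t - level_step k \<tau> z t"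
  have cong: "Lp_le q E ?h" if "Lp_le q E (\<lambda>t. haar_sign k t * (detail a f k (nat \<lfloor>2 ^ k * t\<rfloor>) - \<tau> * real_of_int (z (nat \<lfloor>2 ^ k * t\<rfloor>))))" for E
  proof (rule Lp_le_cong[OF that])
    show "?h \<in> borel_measurable unit_lebesgue" by (rule borel_measurable_unit_lebesgue) simp
    show "AE t in unit_lebesgue. haar_sign k t * (detail a f k (nat \<lfloor>2 ^ k * t\<rfloor>) - \<tau> * real_of_int (z (nat \<lfloor>2 ^ k * t\<rfloor>))) = ?h t"
      by (rule AE_unit_lebesgueI) (auto simp: step_mean_Suc[OF a(1) f(1) int] level_step_def algebra_simps)
  qed
  have e': "\<bar>detail a f k i - \<tau> * real_of_int (z i)\<bar> \<le> \<tau> \<and> \<bar>detail a f k i - \<tau> * real_of_int (z i)\<bar> \<le> \<bar>detail a f k i\<bar>"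
    if "i < 2 ^ k" for i
    using e that by blast
  have "Lp_le q \<tau> ?h"
    by (rule cong, rule step_error(1)[OF p tau rho sum e'])
  moreover have "Lp_le q (\<rho> * 2 powr ((1 - exponent_ratio p q) * \<nu>)) ?h"
    unfolding ratio[symmetric] by (rule cong, rule step_error(2)[OF p tau rho sum e'])
  ultimately show ?thesis
    using z unfolding \<tau>_def \<rho>_def by blast
qed

lemma lattice_ball_eq_0: "z \<in> lattice_ball N K \<Longrightarrow> K < 1 \<Longrightarrow> i < N \<Longrightarrow> z i = 0"
proof -
  assume z: "z \<in> lattice_ball N K" and K: "K < 1" and i: "i < N"
  have "real_of_int \<bar>z i\<bar> \<le> (\<Sum>i<N. real_of_int \<bar>z i\<bar>)"
    using i by (intro member_le_sum) auto
  also have "\<dots> < 1" using z K by (simp add: lattice_ball_def)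
  finally show "z i = 0" by simp
qed

text \<open>On levels where the radius of the lattice ball is below 1, only the zero vector remains, so nothing has
to be stored and the quantization error bounds the whole detail.\<close>

lemma level_tail:
  assumes a: "0 < a" "a \<le> 1" and p: "1 \<le> p" "ereal p \<le> q" and f: "unit_supported f" "Lp_le (ereal p) 1 f"
    and K: "2 powr (- (p * \<nu>)) * 2 ^ k < 1"
  shows "Lp_le q (level_bound a k * 2 powr ((1 - exponent_ratio p q) * \<nu>)) (\<lambda>t. step_mean a f (Suc k) t - step_mean a f k t)"
proof -
  obtain z where z: "z \<in> lattice_ball (2 ^ k) (2 powr (- (p * \<nu>)) * 2 ^ k)"
    and le: "Lp_le q (level_bound a k * 2 powr ((1 - exponent_ratio p q) * \<nu>))
      (\<lambda>t. step_mean a f (Suc k) t - step_mean a f k t - level_step k (level_bound a k * 2 powr \<nu>) z t)"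
    using level_quantization[OF a p f, of k \<nu>] by blast
  have "level_step k \<tau> z t = 0" if "t < 1" for t \<tau>
    using lattice_ball_eq_0[OF z K dyadic_cell_less[OF that]] by (simp add: level_step_def)
  then show ?thesis
    by (intro Lp_le_cong[OF le] AE_unit_lebesgue_half_openI borel_measurable_unit_lebesgue) auto
qed

section \<open>Almost everywhere convergence of the dyadic means\<close>

text \<open>Dominated convergence in the variable \<open>x\<close>, at every \<open>t\<close> for which the two-sided potential of \<open>f\<close> is
finite.\<close>

lemma AE_step_mean_tendsto:
  assumes a: "0 < a" "a < 1" and f: "unit_supported f" "integrable lborel f"
  shows "AE t in unit_lebesgue. (\<lambda>m. step_mean a f m t) \<longlonglongrightarrow> rl_conv a f t"
proof (rule AE_unit_lebesgueI)
  note [measurable] = unit_supportedD(1)[OF f(1)]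
  define C where "C = (1 / Gamma a + 1 / Gamma (a + 1)) * (1 / 2) powr (a - 1)"
  show "AE t in lborel. t \<in> {0..1} \<longrightarrow> (\<lambda>m. step_mean a f m t) \<longlonglongrightarrow> rl_conv a f t"
    using AE_integrable_abs_powr[OF a(1) f]
  proof eventually_elim
    case (elim t)
    show ?case
    proof
      assume t: "t \<in> {0..1}"
      show "(\<lambda>m. step_mean a f m t) \<longlonglongrightarrow> rl_conv a f t"
        unfolding step_mean_def mean_def rl_conv_def
      proof (rule integral_dominated_convergence)
        show "integrable lborel (\<lambda>x. C * \<bar>\<bar>t - x\<bar> powr (a - 1) * f x\<bar>)"
          using elim t by (intro integrable_mult_right integrable_abs) auto
        show "AE x in lborel. (\<lambda>m. mean_kernel a m (nat \<lfloor>2 ^ m * t\<rfloor>) x * f x) \<longlonglongrightarrow> rl_kernel a (t - x) * f x"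
          using AE_lborel_singleton[of t]
          by eventually_elim (use t a in \<open>auto intro!: tendsto_mult mean_kernel_tendsto\<close>)
        show "AE x in lborel. norm (mean_kernel a m (nat \<lfloor>2 ^ m * t\<rfloor>) x * f x) \<le> C * \<bar>\<bar>t - x\<bar> powr (a - 1) * f x\<bar>" for m
          using AE_lborel_singleton[of t]
        proof eventually_elim
          case (elim x)
          have "real (nat \<lfloor>2 ^ m * t\<rfloor>) \<le> 2 ^ m * t" "2 ^ m * t < real (nat \<lfloor>2 ^ m * t\<rfloor>) + 1"
            using t by auto
          then have "mean_kernel a m (nat \<lfloor>2 ^ m * t\<rfloor>) x \<le> (1 / Gamma a + 1 / Gamma (a + 1)) * (\<bar>t - x\<bar> / 2) powr (a - 1)"
            using a elim by (intro mean_kernel_le_abs_powr) (auto simp: field_simps)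
          also have "\<dots> = C * \<bar>t - x\<bar> powr (a - 1)"
            using powr_mult[of "\<bar>t - x\<bar>" "1 / 2" "a - 1"] by (simp add: C_def)
          finally have "mean_kernel a m (nat \<lfloor>2 ^ m * t\<rfloor>) x \<le> C * \<bar>t - x\<bar> powr (a - 1)" .
          then have "mean_kernel a m (nat \<lfloor>2 ^ m * t\<rfloor>) x * \<bar>f x\<bar> \<le> C * \<bar>t - x\<bar> powr (a - 1) * \<bar>f x\<bar>"
            by (intro mult_right_mono) auto
          then show ?case
            using mean_kernel_nonneg[OF a(1), of m "nat \<lfloor>2 ^ m * t\<rfloor>" x] by (simp add: abs_mult)
        qed
      qed simp_all
    qed
  qed
qed

section \<open>Nets for the image of the unit ball: order below one\<close>

text \<open>The logarithmic step sizes around the critical level \<open>J\<close>. Below \<open>J\<close> the slope \<open>a + 1\<close> exceeds the decay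
rate \<open>a\<close> of the details, so the errors decrease geometrically from \<open>J\<close> toward coarser levels. Above \<open>J\<close> the slope \<open>\<omega>\<close> has to
satisfy \<open>p \<omega> > 1\<close>, so that the number of nonzero coefficients decreases, and \<open>(1 - p/q) \<omega> < a\<close>, so that
the errors do.\<close>

definition level_shift :: "real \<Rightarrow> real \<Rightarrow> nat \<Rightarrow> nat \<Rightarrow> real" where
  "level_shift a \<omega> J k = (real k - real J) * (if k < J then a + 1 else \<omega>)"

text \<open>Below \<open>J\<close> the uniform error bound of a quantized level, from \<open>J\<close> on the interpolated one; \<open>\<theta>\<close> stands for
the ratio \<open>p/q\<close>.\<close>

definition level_error :: "real \<Rightarrow> real \<Rightarrow> real \<Rightarrow> nat \<Rightarrow> nat \<Rightarrow> real" where
  "level_error a \<theta> \<omega> J k = level_bound a k * 2 powr ((if k < J then 1 else 1 - \<theta>) * level_shift a \<omega> J k)"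

definition level_log_card :: "real \<Rightarrow> real \<Rightarrow> real \<Rightarrow> nat \<Rightarrow> nat \<Rightarrow> real" where
  "level_log_card a p \<omega> J k = (if k < J then 2 ^ k * (5 + p * (a + 1) * (real J - real k))
     else 2 powr (- (p * level_shift a \<omega> J k)) * 2 ^ k * (5 + p * level_shift a \<omega> J k))"

lemma sum_split_le:
  fixes g :: "nat \<Rightarrow> real"
  assumes "\<And>k. 0 \<le> g k"
  shows "(\<Sum>k<M. g k) \<le> (\<Sum>k<J. g k) + (\<Sum>j<M. g (J + j))"
proof -
  have "(\<Sum>k<M. g k) \<le> (\<Sum>k<J + M. g k)"
    using assms by (intro sum_mono2) auto
  also have "\<dots> = (\<Sum>k<J. g k) + (\<Sum>j<M. g (J + j))"
    by (induction M) auto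
  finally show ?thesis .
qed

lemma sum_pow2_le: "(\<Sum>k<J. 2 ^ k :: real) \<le> 2 ^ J"
  by (induction J) auto

lemma sum_pow2_diff_le: "(\<Sum>k<J. 2 ^ k * (real J - real k)) \<le> 2 * 2 ^ J"
proof (induction J)
  case (Suc J)
  have "(\<Sum>k<J. 2 ^ k * (real (Suc J) - real k)) = (\<Sum>k<J. 2 ^ k * (real J - real k) + 2 ^ k)"
    by (intro sum.cong refl) (simp add: algebra_simps)
  then have "(\<Sum>k<Suc J. 2 ^ k * (real (Suc J) - real k)) = (\<Sum>k<J. 2 ^ k * (real J - real k)) + (\<Sum>k<Suc J. 2 ^ k)"
    by (simp add: sum.distrib)
  also have "\<dots> \<le> 2 * 2 ^ J + 2 ^ Suc J"
    using Suc sum_pow2_le[of "Suc J"] by (intro add_mono) auto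
  finally show ?case by simp
qed simp

lemma sum_power_le_geometric:
  fixes r :: real
  assumes "0 \<le> r" "r < 1"
  shows "(\<Sum>j<M. r ^ j) \<le> 1 / (1 - r)"
  using sum_le_suminf[OF summable_geometric, of r "{..<M}"] suminf_geometric[of r] assms by simp

lemma sum_Suc_power_le_geometric:
  fixes r :: real
  assumes "0 \<le> r" "r < 1"
  shows "(\<Sum>j<M. real (Suc j) * r ^ j) \<le> 1 / (1 - r)\<^sup>2"
proof -
  have "(\<lambda>j. real (Suc j) * r ^ j) sums (1 / (1 - r)\<^sup>2)"
    using geometric_deriv_sums[of r] assms by simp
  then show ?thesis
    using sum_le_suminf[of "\<lambda>j. real (Suc j) * r ^ j" "{..<M}"] assms by (simp add: sums_iff)
qed

lemma sum_level_error_le: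
  assumes a: "0 < a" and om: "(1 - \<theta>) * \<omega> < a"
  shows "(\<Sum>k<M. level_error a \<theta> \<omega> J k)
    \<le> level_bound a 0 * (1 + 1 / (1 - 2 powr ((1 - \<theta>) * \<omega> - a))) * 2 powr (- (real J * a))"
proof -
  let ?r = "2 powr ((1 - \<theta>) * \<omega> - a) :: real"
  let ?e = "level_bound a 0 * 2 powr (- (real J * a))"
  have e0: "0 < level_bound a 0" using a by (rule level_bound_pos)
  have r: "0 \<le> ?r" "?r < 1" using om powr_less_mono[of "(1 - \<theta>) * \<omega> - a" 0 "2::real"] by auto
  have low: "level_error a \<theta> \<omega> J k = ?e * (2 ^ k / 2 ^ J)" if "k < J" for k
  proof -
    have "level_error a \<theta> \<omega> J k = level_bound a 0 * (2 powr (- (real k * a)) * 2 powr ((real k - real J) * (a + 1)))"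
      using that by (simp add: level_error_def level_shift_def level_bound_eq[of a k])
    also have "2 powr (- (real k * a)) * 2 powr ((real k - real J) * (a + 1))
        = 2 powr (- (real J * a)) * 2 powr (real k - real J)"
      unfolding powr_add[symmetric] by (simp add: algebra_simps)
    finally show ?thesis by (simp add: powr_diff powr_realpow)
  qed
  have high: "level_error a \<theta> \<omega> J (J + j) = ?e * ?r ^ j" for j
  proof -
    have "level_error a \<theta> \<omega> J (J + j) = level_bound a 0 * (2 powr (- (real (J + j) * a)) * 2 powr ((1 - \<theta>) * (real j * \<omega>)))"
      by (simp add: level_error_def level_shift_def level_bound_eq[of a "J + j"])
    also have "2 powr (- (real (J + j) * a)) * 2 powr ((1 - \<theta>) * (real j * \<omega>))
        = 2 powr (- (real J * a)) * 2 powr (real j * ((1 - \<theta>) * \<omega> - a))"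
      unfolding powr_add[symmetric] by (simp add: algebra_simps)
    also have "2 powr (real j * ((1 - \<theta>) * \<omega> - a)) = ?r ^ j"
      by (simp add: powr_power mult.commute)
    finally show ?thesis by simp
  qed
  have "(\<Sum>k<M. level_error a \<theta> \<omega> J k) \<le> (\<Sum>k<J. level_error a \<theta> \<omega> J k) + (\<Sum>j<M. level_error a \<theta> \<omega> J (J + j))"
    using a by (intro sum_split_le) (simp add: level_error_def level_bound_pos less_imp_le)
  also have "\<dots> = ?e * ((\<Sum>k<J. 2 ^ k) / 2 ^ J) + ?e * (\<Sum>j<M. ?r ^ j)"
    by (simp add: low high sum_distrib_left sum_divide_distrib)
  also have "\<dots> \<le> ?e * 1 + ?e * (1 / (1 - ?r))"
    using e0 sum_pow2_le[of J] by (intro add_mono mult_left_mono sum_power_le_geometric r) auto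
  finally show ?thesis by (simp add: algebra_simps)
qed

lemma sum_level_log_card_le:
  assumes a: "0 < a" and p: "1 \<le> p" and om: "1 < p * \<omega>"
  shows "(\<Sum>k<M. level_log_card a p \<omega> J k)
    \<le> (5 + 2 * (p * (a + 1)) + (5 + p * \<omega>) / (1 - 2 powr (1 - p * \<omega>))\<^sup>2) * 2 ^ J"
proof -
  let ?s = "2 powr (1 - p * \<omega>) :: real"
  have s: "0 \<le> ?s" "?s < 1" using om powr_less_mono[of "1 - p * \<omega>" 0 "2::real"] by auto
  have om0: "0 < p * \<omega>" using om by simp
  then have om1: "0 < \<omega>" using p zero_less_mult_pos[of p \<omega>] by simp
  have high: "level_log_card a p \<omega> J (J + j) \<le> 2 ^ J * (5 + p * \<omega>) * (real (Suc j) * ?s ^ j)" for j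
  proof -
    have "2 powr (- (p * (real j * \<omega>))) * 2 ^ (J + j) = (2 ^ J * ?s ^ j :: real)"
    proof -
      have "?s ^ j = 2 powr (real j) * 2 powr (- (p * (real j * \<omega>)))"
        by (simp add: powr_power flip: powr_add) (simp add: algebra_simps)
      then show ?thesis by (simp add: powr_realpow power_add)
    qed
    then have "level_log_card a p \<omega> J (J + j) = 2 ^ J * ?s ^ j * (5 + p * (real j * \<omega>))"
      by (simp add: level_log_card_def level_shift_def)
    also have "\<dots> \<le> 2 ^ J * ?s ^ j * ((5 + p * \<omega>) * real (Suc j))"
      using om0 s by (intro mult_left_mono) (auto simp: algebra_simps)
    finally show ?thesis by (simp add: algebra_simps)
  qed
  have "(\<Sum>k<M. level_log_card a p \<omega> J k) \<le> (\<Sum>k<J. level_log_card a p \<omega> J k) + (\<Sum>j<M. level_log_card a p \<omega> J (J + j))"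
    using a p om1 by (intro sum_split_le) (auto simp: level_log_card_def level_shift_def)
  also have "(\<Sum>k<J. level_log_card a p \<omega> J k) = 5 * (\<Sum>k<J. 2 ^ k) + p * (a + 1) * (\<Sum>k<J. 2 ^ k * (real J - real k))"
    unfolding sum_distrib_left sum.distrib[symmetric]
    by (intro sum.cong refl) (simp add: level_log_card_def algebra_simps)
  also have "\<dots> \<le> 5 * 2 ^ J + p * (a + 1) * (2 * 2 ^ J)"
    using a p by (intro add_mono mult_left_mono sum_pow2_le sum_pow2_diff_le) auto
  also have "(\<Sum>j<M. level_log_card a p \<omega> J (J + j)) \<le> 2 ^ J * (5 + p * \<omega>) * (\<Sum>j<M. real (Suc j) * ?s ^ j)"
    unfolding sum_distrib_left by (intro sum_mono high)
  also have "\<dots> \<le> 2 ^ J * (5 + p * \<omega>) * (1 / (1 - ?s)\<^sup>2)"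
    using om0 by (intro mult_left_mono sum_Suc_power_le_geometric s) auto
  finally show ?thesis by (simp add: algebra_simps add_divide_distrib)
qed

lemma card_level_le:
  assumes a: "0 < a" and p: "1 \<le> p" and om: "1 < p * \<omega>"
  shows "real (card (lattice_ball (2 ^ k) (2 powr (- (p * level_shift a \<omega> J k)) * 2 ^ k))) \<le> 2 powr level_log_card a p \<omega> J k"
proof (cases "k < J")
  case True
  have "real (card (lattice_ball (2 ^ k) (2 powr (p * (a + 1) * (real J - real k)) * real (2 ^ k))))
      \<le> 2 powr (real (2 ^ k) * (5 + p * (a + 1) * (real J - real k)))"
    using True a p by (intro card_lattice_ball_dense) auto
  moreover have "- (p * level_shift a \<omega> J k) = p * (a + 1) * (real J - real k)"
    using True by (simp add: level_shift_def algebra_simps)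
  ultimately show ?thesis using True by (simp add: level_log_card_def)
next
  case False
  have "0 \<le> p * \<omega>" using om by simp
  moreover have "0 \<le> real k - real J" using False by simp
  ultimately have "0 \<le> p * \<omega> * (real k - real J)" by (rule mult_nonneg_nonneg)
  then have "0 \<le> p * level_shift a \<omega> J k" using False by (simp add: level_shift_def algebra_simps)
  then show ?thesis
    using card_lattice_ball_sparse[of "p * level_shift a \<omega> J k" "2 ^ k"] False by (simp add: level_log_card_def)
qed

lemma abs_mean_0_le:
  assumes a: "0 < a" and p: "1 \<le> p" and f: "unit_supported f" "Lp_le p 1 f"
  shows "\<bar>mean a f 0 0\<bar> \<le> 2 * rl_kernel (a + 1) 1"
proof -
  note [measurable] = unit_supportedD(1)[OF f(1)]
  have int: "integrable lborel f" using p f by (intro Lp_le_integrable)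
  have "Lp_le 1 2 f" using Lp_le_embed[OF _ p f(2)] by simp
  then have "(\<integral>\<^sup>+x. ennreal \<bar>f x\<bar> \<partial>unit_lebesgue) \<le> ennreal 2"
    using Lp_le_finite_iff[of 1 2 f] by (simp add: one_ereal_def)
  moreover have "(\<integral>\<^sup>+x. ennreal \<bar>f x\<bar> \<partial>unit_lebesgue) = (\<integral>\<^sup>+x. ennreal \<bar>f x\<bar> \<partial>lborel)"
    by (rule nn_integral_unit_supported[OF f(1), where \<phi>="\<lambda>y. ennreal \<bar>y\<bar>"]) simp
  ultimately have 2: "(LINT x|lborel. \<bar>f x\<bar>) \<le> 2"
    by (subst integral_eq_nn_integral) (auto intro!: enn2real_leI)
  have G: "0 \<le> rl_kernel (a + 1) 1" using a by (simp add: rl_kernel_nonneg)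
  have "\<bar>mean a f 0 0\<bar> \<le> (LINT x|lborel. \<bar>mean_kernel a 0 0 x * f x\<bar>)"
    unfolding mean_def by (rule integral_abs_bound)
  also have "\<dots> \<le> (LINT x|lborel. rl_kernel (a + 1) 1 * \<bar>f x\<bar>)"
  proof (intro integral_mono' integrable_mult_right integrable_abs int)
    fix x
    show "\<bar>mean_kernel a 0 0 x * f x\<bar> \<le> rl_kernel (a + 1) 1 * \<bar>f x\<bar>"
    proof (cases "x \<in> {0..1}")
      case True
      then have "mean_kernel a 0 0 x = rl_kernel (a + 1) (1 - x)"
        by (simp add: mean_kernel_def rl_kernel_def[of _ "- x"])
      then show ?thesis
        using True a rl_kernel_Suc_mono[of a "1 - x" 1] by (simp add: abs_mult rl_kernel_nonneg mult_right_mono)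
    qed (simp add: unit_supportedD(2)[OF f(1)])
  qed (use G in simp)
  also have "\<dots> \<le> rl_kernel (a + 1) 1 * 2"
    unfolding integral_mult_right_zero using 2 G by (intro mult_left_mono)
  finally show ?thesis by simp
qed

text \<open>The centres are kept as functions while they are assembled level by level; they become elements of
the quotient space only afterwards.\<close>

definition is_fun_net :: "ereal \<Rightarrow> ereal \<Rightarrow> ((real \<Rightarrow> real) \<Rightarrow> real \<Rightarrow> real) \<Rightarrow> real \<Rightarrow> (real \<Rightarrow> real) set \<Rightarrow> bool" where
  "is_fun_net p q T E Y \<longleftrightarrow> finite Y \<and> (\<forall>y\<in>Y. Lp_fun q y) \<and>
    (\<forall>f. unit_supported f \<and> Lp_le p 1 f \<longrightarrow> (\<exists>y\<in>Y. Lp_le q E (\<lambda>t. T f t - y t)))"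

lemma is_fun_netD:
  assumes "is_fun_net p q T E Y"
  shows "finite Y" "y \<in> Y \<Longrightarrow> Lp_fun q y"
    "unit_supported f \<Longrightarrow> Lp_le p 1 f \<Longrightarrow> \<exists>y\<in>Y. Lp_le q E (\<lambda>t. T f t - y t)"
  using assms by (auto simp: is_fun_net_def)

text \<open>At level 0 the step function is one bounded constant, which is rounded to a multiple of \<open>d\<close>.\<close>

lemma step_mean_0_net:
  assumes a: "0 < a" and p: "1 \<le> p" "p \<le> q" and d: "0 < d" "d \<le> 1"
  shows "\<exists>Y. is_fun_net p q (\<lambda>f. step_mean a f 0) d Y \<and> real (card Y) \<le> (4 * rl_kernel (a + 1) 1 + 1) / d"
proof -
  define m where "m = nat \<lfloor>2 * rl_kernel (a + 1) 1 / d\<rfloor>"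
  define Y where "Y = (\<lambda>z::int. (\<lambda>t::real. d * real_of_int z)) ` {- int m..int m}"
  have q: "1 \<le> q" using p by simp
  have G: "0 \<le> rl_kernel (a + 1) 1" using a by (simp add: rl_kernel_nonneg)
  have m: "real m \<le> 2 * rl_kernel (a + 1) 1 / d" using G d by (simp add: m_def)
  show ?thesis
    unfolding is_fun_net_def
  proof (intro exI[of _ Y] conjI allI impI ballI)
    show "finite Y" by (simp add: Y_def)
    have "real (card Y) \<le> real (2 * m + 1)"
      unfolding Y_def by (intro of_nat_mono order_trans[OF card_image_le]) auto
    also have "\<dots> \<le> 2 * (2 * rl_kernel (a + 1) 1 / d) + 1 / d"
    proof -
      have "1 \<le> 1 / d" using d by simp
      then show ?thesis using m by linarith
    qed
    finally show "real (card Y) \<le> (4 * rl_kernel (a + 1) 1 + 1) / d"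
      by (simp add: add_divide_distrib)
    show "Lp_fun q y" if "y \<in> Y" for y
      using that Lp_le_bounded[OF q, of y "\<bar>y 0\<bar>"] by (auto simp: Y_def Lp_le_def)
  next
    fix f assume f: "unit_supported f \<and> Lp_le p 1 f"
    let ?c = "mean a f 0 0"
    obtain z :: int where z: "real_of_int \<bar>z\<bar> \<le> \<bar>?c\<bar> / d" "\<bar>?c - d * real_of_int z\<bar> \<le> d"
      using ex_truncation[OF d(1), of ?c] by blast
    have "real_of_int \<bar>z\<bar> \<le> 2 * rl_kernel (a + 1) 1 / d"
      using z(1) abs_mean_0_le[OF a p(1)] f d by (meson divide_right_mono less_imp_le order_trans)
    then have "\<bar>z\<bar> \<le> \<lfloor>2 * rl_kernel (a + 1) 1 / d\<rfloor>" by (simp only: le_floor_iff)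
    then have "\<bar>z\<bar> \<le> int m" unfolding m_def by linarith
    then have "z \<in> {- int m..int m}" by auto
    then have mem: "(\<lambda>t. d * real_of_int z) \<in> Y" unfolding Y_def by (rule imageI)
    have "Lp_le q d (\<lambda>t. step_mean a f 0 t - d * real_of_int z)"
    proof (rule Lp_le_bounded[OF q])
      show "(\<lambda>t. step_mean a f 0 t - d * real_of_int z) \<in> borel_measurable unit_lebesgue"
        by (rule borel_measurable_unit_lebesgue) simp
      show "AE t in unit_lebesgue. \<bar>step_mean a f 0 t - d * real_of_int z\<bar> \<le> d"
      proof (rule AE_unit_lebesgue_half_openI)
        fix t :: real assume "0 \<le> t" "t < 1"
        then have "\<lfloor>t\<rfloor> = 0" by (simp add: floor_eq_iff)
        then show "\<bar>step_mean a f 0 t - d * real_of_int z\<bar> \<le> d" using z by (simp add: step_mean_def)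
      qed
    qed (use d in simp)
    then show "\<exists>y\<in>Y. Lp_le q d (\<lambda>t. step_mean a f 0 t - y t)"
      using mem by (rule bexI[where x="\<lambda>t. d * real_of_int z"])
  qed
qed

lemma Lp_fun_level_step:
  assumes q: "1 \<le> q"
  shows "Lp_fun q (level_step k \<tau> z)"
proof -
  let ?C = "\<bar>\<tau>\<bar> * (\<Sum>i\<le>2 ^ k. real_of_int \<bar>z i\<bar>)"
  have "\<bar>level_step k \<tau> z t\<bar> \<le> ?C" if "t \<in> {0..1}" for t
  proof -
    have "2 ^ k * t \<le> 2 ^ k * 1" using that by (intro mult_left_mono) auto
    then have "2 ^ k * t \<le> real (2 ^ k)" by simp
    then have "\<lfloor>2 ^ k * t\<rfloor> \<le> int (2 ^ k)" by linarith
    then have "nat \<lfloor>2 ^ k * t\<rfloor> \<le> 2 ^ k" by (simp only: nat_le_iff)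
    then have "real_of_int \<bar>z (nat \<lfloor>2 ^ k * t\<rfloor>)\<bar> \<le> (\<Sum>i\<le>2 ^ k. real_of_int \<bar>z i\<bar>)"
      by (intro member_le_sum) auto
    then show ?thesis
      by (simp add: level_step_def abs_mult mult_left_mono)
  qed
  then have "AE t in unit_lebesgue. \<bar>level_step k \<tau> z t\<bar> \<le> ?C"
    by (intro AE_unit_lebesgueI) auto
  then have "Lp_le q ?C (level_step k \<tau> z)"
    by (intro Lp_le_bounded q borel_measurable_unit_lebesgue mult_nonneg_nonneg sum_nonneg) auto
  then show ?thesis by (simp add: Lp_le_def)
qed

text \<open>Adding one level multiplies the number of centres by the number of admissible integer vectors and
adds the error of that level.\<close>

lemma step_mean_net:
  assumes a: "0 < a" "a \<le> 1" and p: "1 \<le> p" "ereal p \<le> q" and om: "1 < p * \<omega>" and d: "0 < d" "d \<le> 1"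
  shows "\<exists>Y. is_fun_net (ereal p) q (\<lambda>f. step_mean a f M) (d + (\<Sum>k<M. level_error a (exponent_ratio p q) \<omega> J k)) Y
    \<and> real (card Y) \<le> (4 * rl_kernel (a + 1) 1 + 1) / d * 2 powr (\<Sum>k<M. level_log_card a p \<omega> J k)"
proof (induction M)
  case 0
  then show ?case using step_mean_0_net[of a "ereal p" q d] a p d by simp
next
  case (Suc M)
  let ?E = "\<lambda>M. d + (\<Sum>k<M. level_error a (exponent_ratio p q) \<omega> J k)"
  have q: "1 \<le> q" using p by (metis ereal_less_eq(3) one_ereal_def order_trans)
  obtain Y where Y: "finite Y" "real (card Y) \<le> (4 * rl_kernel (a + 1) 1 + 1) / d * 2 powr (\<Sum>k<M. level_log_card a p \<omega> J k)"
    "\<And>y. y \<in> Y \<Longrightarrow> Lp_fun q y"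
    "\<And>f. unit_supported f \<Longrightarrow> Lp_le (ereal p) 1 f \<Longrightarrow> \<exists>y\<in>Y. Lp_le q (?E M) (\<lambda>t. step_mean a f M t - y t)"
    using Suc.IH unfolding is_fun_net_def by blast
  let ?\<nu> = "level_shift a \<omega> J M"
  let ?\<tau> = "level_bound a M * 2 powr ?\<nu>"
  let ?Z = "lattice_ball (2 ^ M) (2 powr (- (p * ?\<nu>)) * 2 ^ M)"
  define Y' where "Y' = (\<lambda>(y, z) t. y t + level_step M ?\<tau> z t) ` (Y \<times> ?Z)"
  show ?case
    unfolding is_fun_net_def
  proof (intro exI[of _ Y'] conjI allI impI ballI)
    show "finite Y'" unfolding Y'_def using Y(1) finite_lattice_ball by simp
    have "real (card Y') \<le> real (card (Y \<times> ?Z))"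
      unfolding Y'_def using Y(1) finite_lattice_ball by (intro of_nat_mono card_image_le) simp
    also have "\<dots> = real (card Y) * real (card ?Z)"
      by (simp add: card_cartesian_product)
    also have "\<dots> \<le> ((4 * rl_kernel (a + 1) 1 + 1) / d * 2 powr (\<Sum>k<M. level_log_card a p \<omega> J k)) * 2 powr level_log_card a p \<omega> J M"
      using a d by (intro mult_mono Y card_level_le p om) (auto simp: rl_kernel_nonneg)
    finally show "real (card Y') \<le> (4 * rl_kernel (a + 1) 1 + 1) / d * 2 powr (\<Sum>k<Suc M. level_log_card a p \<omega> J k)"
      by (simp add: powr_add)
    show "Lp_fun q y" if "y \<in> Y'" for y
      using that Y(3) Lp_triangle_fun(1)[OF q _ Lp_fun_level_step[OF q]] by (auto simp: Y'_def)
  next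
    fix f assume f: "unit_supported f \<and> Lp_le (ereal p) 1 f"
    then obtain y where y: "y \<in> Y" "Lp_le q (?E M) (\<lambda>t. step_mean a f M t - y t)"
      using Y(4) by blast
    obtain z where z: "z \<in> ?Z"
      "Lp_le q ?\<tau> (\<lambda>t. step_mean a f (Suc M) t - step_mean a f M t - level_step M ?\<tau> z t)"
      "Lp_le q (level_bound a M * 2 powr ((1 - exponent_ratio p q) * ?\<nu>))
        (\<lambda>t. step_mean a f (Suc M) t - step_mean a f M t - level_step M ?\<tau> z t)"
      using level_quantization[OF a p, of f M ?\<nu>] f by blast
    have "Lp_le q (level_error a (exponent_ratio p q) \<omega> J M)
        (\<lambda>t. step_mean a f (Suc M) t - step_mean a f M t - level_step M ?\<tau> z t)"
      using z by (cases "M < J") (auto simp: level_error_def)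
    from Lp_le_add[OF q y(2) this]
    have "Lp_le q (?E (Suc M)) (\<lambda>t. step_mean a f (Suc M) t - (y t + level_step M ?\<tau> z t))"
      by (simp add: algebra_simps)
    moreover have "(\<lambda>t. y t + level_step M ?\<tau> z t) \<in> Y'"
      unfolding Y'_def using y z by force
    ultimately show "\<exists>y\<in>Y'. Lp_le q (?E (Suc M)) (\<lambda>t. step_mean a f (Suc M) t - y t)"
      by (rule bexI[where x="\<lambda>t. y t + level_step M ?\<tau> z t"])
  qed
qed

text \<open>From some level \<open>M\<close> on no coefficients are stored, so the centres built up to level \<open>M\<close> serve all
later levels with uniformly bounded error, and the bound passes to the limit by Fatou's lemma.\<close>

lemma rl_conv_net:
  assumes a: "0 < a" "a < 1" and p: "1 \<le> p" "ereal p \<le> q" and om: "1 < p * \<omega>" "(1 - exponent_ratio p q) * \<omega> < a"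
  shows "\<exists>C L. \<forall>J. \<exists>Y. is_fun_net (ereal p) q (rl_conv a) (C * 2 powr (- (real J * a))) Y \<and> card Y \<le> 2 ^ (L * 2 ^ J)"
proof -
  let ?\<theta> = "exponent_ratio p q"
  define C where "C = 1 + level_bound a 0 * (1 + 1 / (1 - 2 powr ((1 - ?\<theta>) * \<omega> - a)))"
  define L1 where "L1 = 5 + 2 * (p * (a + 1)) + (5 + p * \<omega>) / (1 - 2 powr (1 - p * \<omega>))\<^sup>2"
  define G where "G = 4 * rl_kernel (a + 1) 1 + 1"
  have G: "1 \<le> G" using a by (simp add: G_def rl_kernel_nonneg)
  define L where "L = nat \<lceil>log 2 G + a + L1\<rceil>"
  have q: "1 \<le> q" using p by (metis ereal_less_eq(3) one_ereal_def order_trans)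
  have "\<exists>Y. is_fun_net (ereal p) q (rl_conv a) (C * 2 powr (- (real J * a))) Y \<and> card Y \<le> 2 ^ (L * 2 ^ J)" for J
  proof -
    define d where "d = 2 powr (- (real J * a))"
    have d: "0 < d" "d \<le> 1" using a powr_mono[of "- (real J * a)" 0 "2::real"] by (auto simp: d_def)
    have "\<exists>M\<ge>J. \<forall>k\<ge>M. 2 powr (- (p * level_shift a \<omega> J k)) * 2 ^ k < 1"
    proof -
      define s where "s = (2::real) powr (1 - p * \<omega>)"
      have s: "0 \<le> s" "s < 1" using om powr_less_mono[of "1 - p * \<omega>" 0 "2::real"] by (auto simp: s_def)
      have "(\<lambda>j. 2 ^ J * s ^ j) \<longlonglongrightarrow> 0"
        using s by (intro tendsto_mult_right_zero LIMSEQ_power_zero) auto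
      then have "eventually (\<lambda>j. 2 ^ J * s ^ j < 1) sequentially"
        by (rule order_tendstoD) simp
      then obtain j0 where j0: "\<And>j. j0 \<le> j \<Longrightarrow> 2 ^ J * s ^ j < 1"
        unfolding eventually_sequentially by blast
      have sparse: "2 powr (- (p * level_shift a \<omega> J k)) * 2 ^ k < 1" if k: "J + j0 \<le> k" for k
      proof -
        define j where "j = k - J"
        have kj: "k = J + j" using k by (simp add: j_def)
        have "s ^ j = 2 powr (real j) * 2 powr (- (p * (real j * \<omega>)))"
          by (simp add: s_def powr_power flip: powr_add) (simp add: algebra_simps)
        then have "2 powr (- (p * level_shift a \<omega> J k)) * 2 ^ k = 2 ^ J * s ^ j"
          by (simp add: kj level_shift_def powr_realpow power_add)
        also have "\<dots> < 1" using k by (intro j0) (simp add: j_def)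
        finally show ?thesis .
      qed
      show ?thesis
        by (rule exI[of _ "J + j0"]) (intro conjI allI impI sparse le_add1)
    qed
    then obtain M where M: "J \<le> M" "\<And>k. M \<le> k \<Longrightarrow> 2 powr (- (p * level_shift a \<omega> J k)) * 2 ^ k < 1"
      by blast
    let ?err = "level_error a ?\<theta> \<omega> J"
    obtain Y where Y: "finite Y" "real (card Y) \<le> G / d * 2 powr (\<Sum>k<M. level_log_card a p \<omega> J k)"
      "\<And>y. y \<in> Y \<Longrightarrow> Lp_fun q y"
      "\<And>f. unit_supported f \<Longrightarrow> Lp_le (ereal p) 1 f \<Longrightarrow>
        \<exists>y\<in>Y. Lp_le q (d + (\<Sum>k<M. ?err k)) (\<lambda>t. step_mean a f M t - y t)"
      using step_mean_net[OF a(1) less_imp_le[OF a(2)] p om(1) d, where M=M and J=J] unfolding G_def is_fun_net_def by blast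
    have sum_err: "d + (\<Sum>k<m. ?err k) \<le> C * d" for m
      using sum_level_error_le[OF a(1) om(2), where M=m and J=J] by (simp add: C_def d_def algebra_simps)
    show ?thesis
      unfolding is_fun_net_def
    proof (intro exI[of _ Y] conjI allI impI ballI Y(1,3))
      have "G / d = 2 powr (log 2 G + real J * a)"
        using G by (simp add: d_def powr_add powr_minus divide_inverse)
      then have "G / d * 2 powr (\<Sum>k<M. level_log_card a p \<omega> J k)
          = 2 powr (log 2 G + real J * a + (\<Sum>k<M. level_log_card a p \<omega> J k))"
        by (simp add: powr_add)
      also have "\<dots> \<le> 2 powr (real L * 2 ^ J)"
      proof (rule powr_mono)
        have J: "real J \<le> 2 ^ J" "(1::real) \<le> 2 ^ J"
          using of_nat_less_two_power[of J, where ?'a=real] by (auto intro: less_imp_le)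
        \<comment> \<open>Both the constant and the term linear in \<open>J\<close> are absorbed by \<open>2\<^sup>J\<close>.\<close>
        have "log 2 G * 1 \<le> log 2 G * 2 ^ J" using G J by (intro mult_left_mono) auto
        moreover have "real J * a \<le> 2 ^ J * a" using a J by (intro mult_right_mono) auto
        moreover have "(\<Sum>k<M. level_log_card a p \<omega> J k) \<le> L1 * 2 ^ J"
          unfolding L1_def by (rule sum_level_log_card_le[OF a(1) p(1) om(1)])
        ultimately have "log 2 G + real J * a + (\<Sum>k<M. level_log_card a p \<omega> J k) \<le> (log 2 G + a + L1) * 2 ^ J"
          by (simp add: algebra_simps)
        also have "\<dots> \<le> real L * 2 ^ J"
          unfolding L_def by (intro mult_right_mono real_nat_ceiling_ge) auto
        finally show "log 2 G + real J * a + (\<Sum>k<M. level_log_card a p \<omega> J k) \<le> real L * 2 ^ J" .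
      qed simp
      also have "\<dots> = real (2 ^ (L * 2 ^ J))"
        using powr_realpow[of 2 "L * 2 ^ J"] by simp
      finally have "real (card Y) \<le> real (2 ^ (L * 2 ^ J))"
        using Y(2) by (rule order_trans[rotated])
      then show "card Y \<le> 2 ^ (L * 2 ^ J)" by (simp only: of_nat_le_iff)
    next
      fix f assume f': "unit_supported f \<and> Lp_le (ereal p) 1 f"
      then have f: "unit_supported f" "Lp_le (ereal p) 1 f" by auto
      have int: "integrable lborel f"
        using p f by (intro Lp_le_integrable[of "ereal p"]) auto
      obtain y where y: "y \<in> Y" "Lp_le q (d + (\<Sum>k<M. ?err k)) (\<lambda>t. step_mean a f M t - y t)"
        using Y(4) f by blast
      have ym: "y \<in> borel_measurable unit_lebesgue" using Y(3)[OF y(1)] by (simp add: Lp_fun_def)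
      have net: "Lp_le q (d + (\<Sum>k<M + m. ?err k)) (\<lambda>t. step_mean a f (M + m) t - y t)" for m
      proof (induction m)
        case (Suc m)
        have "Lp_le q (?err (M + m)) (\<lambda>t. step_mean a f (Suc (M + m)) t - step_mean a f (M + m) t)"
          using level_tail[OF a(1) less_imp_le[OF a(2)] p f M(2), of "M + m"] M(1) by (simp add: level_error_def)
        from Lp_le_add[OF q Suc this] show ?case by (simp add: algebra_simps)
      qed (use y in simp)
      have "Lp_le q (C * d) (\<lambda>t. rl_conv a f t - y t)"
      proof (rule Lp_le_liminf[OF q])
        show "Lp_le q (C * d) (\<lambda>t. step_mean a f (M + m) t - y t)" for m
          using net[of m] sum_err by (rule Lp_le_mono)
        show "(\<lambda>t. rl_conv a f t - y t) \<in> borel_measurable unit_lebesgue"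
          using borel_measurable_unit_lebesgue[OF rl_conv_measurable[OF unit_supportedD(1)[OF f(1)]]] ym
          by (rule borel_measurable_diff)
        show "AE t in unit_lebesgue. (\<lambda>m. step_mean a f (M + m) t - y t) \<longlonglongrightarrow> rl_conv a f t - y t"
          using AE_step_mean_tendsto[OF a f(1) int]
        proof eventually_elim
          case (elim t)
          then have "(\<lambda>m. step_mean a f (m + M) t) \<longlonglongrightarrow> rl_conv a f t"
            by (rule LIMSEQ_ignore_initial_segment)
          then show ?case by (intro tendsto_diff tendsto_const) (simp add: add.commute)
        qed
      qed
      then show "\<exists>y\<in>Y. Lp_le q (C * 2 powr (- (real J * a))) (\<lambda>t. rl_conv a f t - y t)"
        using y(1) unfolding d_def by blast
    qed
  qed
  then show ?thesis by blast
qed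

section \<open>Nets for operators and their composition\<close>

definition is_net :: "ereal \<Rightarrow> ereal \<Rightarrow> (L0 \<Rightarrow> L0) \<Rightarrow> real \<Rightarrow> L0 set \<Rightarrow> bool" where
  "is_net p q T E Y \<longleftrightarrow> finite Y \<and> (\<forall>G\<in>Y. in_Lp q G) \<and>
     (\<forall>F\<in>Lp_unit_ball p. \<exists>G\<in>Y. in_Lp q (T F) \<and> Lp_norm q (T F - G) \<le> E)"

lemma is_netD:
  assumes "is_net p q T E Y"
  shows "finite Y" "G \<in> Y \<Longrightarrow> in_Lp q G"
    "F \<in> Lp_unit_ball p \<Longrightarrow> \<exists>G\<in>Y. in_Lp q (T F) \<and> Lp_norm q (T F - G) \<le> E"
  using assms by (auto simp: is_net_def)

lemma is_net_mono: "is_net p q T E Y \<Longrightarrow> E \<le> E' \<Longrightarrow> is_net p q T E' Y"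
  unfolding is_net_def by (meson order_trans)

text \<open>Entropy of order \<open>a\<close> in a dyadic form: radius of order \<open>2\<^sup>-\<^sup>J\<^sup>a\<close> with \<open>2 ^ (L * 2 ^ J)\<close> centres. Multiplying
numbers of centres, as in a composition, only enlarges \<open>L\<close>.\<close>

definition has_nets :: "ereal \<Rightarrow> ereal \<Rightarrow> (L0 \<Rightarrow> L0) \<Rightarrow> real \<Rightarrow> bool" where
  "has_nets p q T a \<longleftrightarrow> (\<exists>C L. 0 < C \<and> (\<forall>J. \<exists>Y. is_net p q T (C * 2 powr (- (real J * a))) Y \<and> card Y \<le> 2 ^ (L * 2 ^ J)))"

lemma has_netsI:
  assumes "\<And>J. \<exists>Y. is_net p q T (C * 2 powr (- (real J * a))) Y \<and> card Y \<le> 2 ^ (L * 2 ^ J)"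
  shows "has_nets p q T a"
  unfolding has_nets_def
proof (intro exI[of _ "\<bar>C\<bar> + 1"] exI[of _ L] conjI allI)
  fix J
  have "C * 2 powr (- (real J * a)) \<le> (\<bar>C\<bar> + 1) * 2 powr (- (real J * a))"
    by (intro mult_right_mono) auto
  then show "\<exists>Y. is_net p q T ((\<bar>C\<bar> + 1) * 2 powr (- (real J * a))) Y \<and> card Y \<le> 2 ^ (L * 2 ^ J)"
    using assms[of J] is_net_mono by blast
qed simp

lemma in_Lp_scaleR: "1 \<le> p \<Longrightarrow> in_Lp p F \<Longrightarrow> in_Lp p (c *\<^sub>R F)"
  and Lp_norm_scaleR: "1 \<le> p \<Longrightarrow> in_Lp p F \<Longrightarrow> Lp_norm p (c *\<^sub>R F) \<le> \<bar>c\<bar> * Lp_norm p F"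
proof -
  have "in_Lp p (c *\<^sub>R F) \<and> Lp_norm p (c *\<^sub>R F) \<le> \<bar>c\<bar> * Lp_norm p F" if "1 \<le> p" "in_Lp p F"
    using that
  proof transfer
    fix p f c assume "1 \<le> p" "ae_eq f f" "Lp_fun p f"
    then show "Lp_fun p (\<lambda>x. c * f x) \<and> Lp_norm_fun p (\<lambda>x. c * f x) \<le> \<bar>c\<bar> * Lp_norm_fun p f"
      using Lp_le_cmult[of p "Lp_norm_fun p f" f c] by (auto simp: Lp_le_def)
  qed
  then show "1 \<le> p \<Longrightarrow> in_Lp p F \<Longrightarrow> in_Lp p (c *\<^sub>R F)"
    "1 \<le> p \<Longrightarrow> in_Lp p F \<Longrightarrow> Lp_norm p (c *\<^sub>R F) \<le> \<bar>c\<bar> * Lp_norm p F" by auto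
qed

lemma in_Lp_embed:
  assumes "1 \<le> p" "p \<le> q" "in_Lp q F"
  shows "in_Lp p F"
proof -
  obtain f where f: "ae_eq f f" "F = abs_L0 f"
    using L0_borel_representative[of F] by blast
  then have "Lp_le q (Lp_norm_fun q f + 1) f"
    using assms by (simp add: in_Lp_abs_L0 Lp_le_def)
  then have "Lp_le p (2 * (Lp_norm_fun q f + 1)) f"
    using assms Lp_norm_fun_nonneg[of q f] by (intro Lp_le_embed) auto
  then show ?thesis using f by (simp add: in_Lp_abs_L0 Lp_le_def)
qed

lemma Lp_unit_ball_embed:
  assumes "1 \<le> p" "p \<le> q" "F \<in> Lp_unit_ball q"
  shows "(1 / 2) *\<^sub>R F \<in> Lp_unit_ball p"
proof -
  obtain f where f: "ae_eq f f" "F = abs_L0 f"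
    using L0_borel_representative[of F] by blast
  then have "Lp_le q 1 f"
    using assms(3) by (simp add: Lp_unit_ball_def in_Lp_abs_L0 Lp_norm.abs_eq Lp_le_def)
  then have "Lp_le p 2 f"
    using assms Lp_le_embed[of p q 1 f] by simp
  then have "Lp_le p 1 (\<lambda>x. 1 / 2 * f x)"
    using assms Lp_le_cmult[of p 2 f "1 / 2"] by simp
  moreover have "ae_eq (\<lambda>x. 1 / 2 * f x) (\<lambda>x. 1 / 2 * f x)"
    using f(1) by (auto simp: ae_eq_def)
  ultimately show ?thesis
    using f(1) by (simp only: f(2) scaleR_L0.abs_eq) (simp add: Lp_unit_ball_def in_Lp_abs_L0 Lp_norm.abs_eq Lp_le_def)
qed

text \<open>The admissible slopes \<open>\<omega>\<close> form the interval between \<open>1/p\<close> and \<open>a / (1 - p/q)\<close> (unbounded if \<open>p = q\<close>),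
which is nonempty exactly because \<open>1/p - 1/q < a\<close>.\<close>

lemma riemann_liouville_nets_base:
  assumes a: "0 < a" "a < 1" and p: "1 \<le> p" "ereal p \<le> q" and pq: "1 / p - real_of_ereal (1 / q) < a"
  shows "has_nets (ereal p) q (riemann_liouville a) a"
proof -
  define \<theta> where "\<theta> = exponent_ratio p q"
  have th: "\<theta> \<le> 1" "(1 - \<theta>) / p < a"
  proof -
    show "\<theta> \<le> 1"
      using p by (cases q) (auto simp: \<theta>_def exponent_ratio_def one_ereal_def)
    have "(1 - \<theta>) / p = 1 / p - real_of_ereal (1 / q)"
      using p by (simp add: \<theta>_def exponent_ratio_def field_simps)
    then show "(1 - \<theta>) / p < a" using pq by simp
  qed
  \<comment> \<open>Half of the slack in \<open>(1 - \<theta>) / p = 1/p - 1/q < a\<close>; as \<open>1 - \<theta> \<le> 1\<close>, it may be added to \<open>1/p\<close>.\<close>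
  define e where "e = (a - (1 - \<theta>) / p) / 2"
  define \<omega> where "\<omega> = 1 / p + e"
  have midpoint: "b + (a - b) / 2 < a" if "b < a" for b :: real
    using that by (simp add: field_simps)
  have e: "0 < e" using th by (simp add: e_def)
  have om1: "1 < p * \<omega>" using p e by (simp add: \<omega>_def distrib_left)
  have th0: "0 \<le> \<theta>"
    using p by (cases q) (auto simp: \<theta>_def exponent_ratio_def one_ereal_def)
  have "(1 - \<theta>) * e \<le> 1 * e" using th0 e by (intro mult_right_mono) auto
  moreover have "(1 - \<theta>) * \<omega> = (1 - \<theta>) / p + (1 - \<theta>) * e"
    unfolding \<omega>_def distrib_left by simp
  ultimately have "(1 - \<theta>) * \<omega> \<le> (1 - \<theta>) / p + e" by simp
  also have "\<dots> < a" unfolding e_def by (rule midpoint[OF th(2)])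
  finally have om2: "(1 - \<theta>) * \<omega> < a" .
  obtain C L where net: "\<forall>J. \<exists>Y. is_fun_net (ereal p) q (rl_conv a) (C * 2 powr (- (real J * a))) Y \<and> card Y \<le> 2 ^ (L * 2 ^ J)"
    using rl_conv_net[OF a p om1 om2[unfolded \<theta>_def]] by (elim exE) (rule that)
  have q: "1 \<le> q" using p by (metis ereal_less_eq(3) one_ereal_def order_trans)
  show ?thesis
  proof (rule has_netsI)
    fix J
    obtain Y where Y: "is_fun_net (ereal p) q (rl_conv a) (C * 2 powr (- (real J * a))) Y" "card Y \<le> 2 ^ (L * 2 ^ J)"
      using net by blast
    note Yfin = is_fun_netD(1)[OF Y(1)] and Yin = is_fun_netD(2)[OF Y(1)] and near = is_fun_netD(3)[OF Y(1)]
    have ae: "ae_eq y y" if "y \<in> Y" for y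
      using Yin[OF that] by (simp add: Lp_fun_def ae_eq_def)
    show "\<exists>Y. is_net (ereal p) q (riemann_liouville a) (C * 2 powr (- (real J * a))) Y \<and> card Y \<le> 2 ^ (L * 2 ^ J)"
      unfolding is_net_def
    proof (intro exI[of _ "abs_L0 ` Y"] conjI ballI)
      show "finite (abs_L0 ` Y)" using Yfin by simp
      show "card (abs_L0 ` Y) \<le> 2 ^ (L * 2 ^ J)" using Y(2) card_image_le[OF Yfin, of abs_L0] by simp
      show "in_Lp q G" if "G \<in> abs_L0 ` Y" for G
        using that Yin ae by (auto simp: in_Lp_abs_L0)
    next
      fix F assume F: "F \<in> Lp_unit_ball (ereal p)"
      obtain f where f: "unit_supported f" "ae_eq f f" "F = abs_L0 f"
        using L0_borel_representative[of F] by blast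
      have "Lp_le (ereal p) 1 f"
        using F f by (simp add: Lp_unit_ball_def in_Lp_abs_L0 Lp_norm.abs_eq Lp_le_def)
      then obtain y where y: "y \<in> Y" "Lp_le q (C * 2 powr (- (real J * a))) (\<lambda>t. rl_conv a f t - y t)"
        using near f by blast
      have R: "riemann_liouville a F = abs_L0 (rl_conv a f)"
        using unit_supportedD[OF f(1)] f by (simp add: riemann_liouville_abs_L0)
      have uu: "ae_eq (rl_conv a f) (rl_conv a f)"
        using unit_supportedD(1)[OF f(1)] by (simp add: ae_eq_def borel_measurable_unit_lebesgue)
      have dd: "ae_eq (\<lambda>t. rl_conv a f t - y t) (\<lambda>t. rl_conv a f t - y t)"
        using Lp_le_measurable[OF y(2)] by (simp add: ae_eq_def)
      have "Lp_fun q (\<lambda>t. (rl_conv a f t - y t) + y t)"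
        using y Yin q by (intro Lp_triangle_fun(1)) (auto simp: Lp_le_def)
      then have "in_Lp q (riemann_liouville a F)" using R uu by (simp add: in_Lp_abs_L0)
      moreover have "Lp_norm q (riemann_liouville a F - abs_L0 y) \<le> C * 2 powr (- (real J * a))"
        using y uu dd ae by (simp add: R minus_L0.abs_eq Lp_norm.abs_eq Lp_le_def)
      ultimately show "\<exists>G\<in>abs_L0 ` Y. in_Lp q (riemann_liouville a F) \<and> Lp_norm q (riemann_liouville a F - G) \<le> C * 2 powr (- (real J * a))"
        using y(1) by blast
    qed
  qed
qed

lemma has_nets_in_Lp:
  assumes T: "has_nets p q T a" and hom: "\<And>c F. T (c *\<^sub>R F) = c *\<^sub>R T F" and p: "1 \<le> p" and q: "1 \<le> q" and F: "in_Lp p F"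
  shows "in_Lp q (T F)"
proof -
  define c where "c = 1 / (Lp_norm p F + 1)"
  have c: "0 < c" using Lp_norm_nonneg[of p F] by (simp add: c_def)
  have "Lp_norm p (c *\<^sub>R F) \<le> c * Lp_norm p F"
    using Lp_norm_scaleR[OF p F, of c] c by simp
  also have "\<dots> \<le> 1" using Lp_norm_nonneg[of p F] by (simp add: c_def)
  finally have "c *\<^sub>R F \<in> Lp_unit_ball p"
    using in_Lp_scaleR[OF p F] by (simp add: Lp_unit_ball_def)
  then have "in_Lp q (T (c *\<^sub>R F))"
    using T unfolding has_nets_def is_net_def by blast
  then have "in_Lp q ((1 / c) *\<^sub>R T (c *\<^sub>R F))"
    by (rule in_Lp_scaleR[OF q])
  then show ?thesis using c by (simp add: hom)
qed

text \<open>The residual \<open>S F - y\<close>, rescaled to the unit ball, is mapped close to a net for \<open>T\<close>. The radii multiply, so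
the orders add.\<close>

lemma has_nets_compose:
  assumes S: "has_nets p q S a" and T: "has_nets q r T b" and p: "1 \<le> p" and q: "1 \<le> q" and r: "1 \<le> r"
    and hom: "\<And>c F. T (c *\<^sub>R F) = c *\<^sub>R T F"
    and add: "\<And>F G. in_Lp q F \<Longrightarrow> in_Lp q G \<Longrightarrow> T (F + G) = T F + T G"
  shows "has_nets p r (\<lambda>F. T (S F)) (a + b)"
proof -
  obtain C L where C: "0 < C" and S': "\<And>J. \<exists>Y. is_net p q S (C * 2 powr (- (real J * a))) Y \<and> card Y \<le> 2 ^ (L * 2 ^ J)"
    using S unfolding has_nets_def by blast
  obtain C' L' where C': "0 < C'" and T': "\<And>J. \<exists>Y. is_net q r T (C' * 2 powr (- (real J * b))) Y \<and> card Y \<le> 2 ^ (L' * 2 ^ J)"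
    using T unfolding has_nets_def by blast
  note Tin = has_nets_in_Lp[OF T hom q r]
  show ?thesis
  proof (rule has_netsI[where L="L + L'" and C="C * C'"])
    fix J
    define d where "d = C * 2 powr (- (real J * a))"
    have d: "0 < d" using C by (simp add: d_def)
    obtain Y where Y: "finite Y" "card Y \<le> 2 ^ (L * 2 ^ J)" "\<And>G. G \<in> Y \<Longrightarrow> in_Lp q G"
      "\<And>F. F \<in> Lp_unit_ball p \<Longrightarrow> \<exists>G\<in>Y. in_Lp q (S F) \<and> Lp_norm q (S F - G) \<le> d"
      using S'[of J] unfolding d_def is_net_def by blast
    obtain Z where Z: "finite Z" "card Z \<le> 2 ^ (L' * 2 ^ J)" "\<And>G. G \<in> Z \<Longrightarrow> in_Lp r G"
      "\<And>F. F \<in> Lp_unit_ball q \<Longrightarrow> \<exists>G\<in>Z. in_Lp r (T F) \<and> Lp_norm r (T F - G) \<le> C' * 2 powr (- (real J * b))"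
      using T'[of J] unfolding is_net_def by blast
    let ?W = "(\<lambda>(y, z). T y + d *\<^sub>R z) ` (Y \<times> Z)"
    show "\<exists>W. is_net p r (\<lambda>F. T (S F)) (C * C' * 2 powr (- (real J * (a + b)))) W \<and> card W \<le> 2 ^ ((L + L') * 2 ^ J)"
      unfolding is_net_def
    proof (intro exI[of _ ?W] conjI ballI)
      show "finite ?W" using Y Z by simp
      have "card ?W \<le> card Y * card Z"
        using card_image_le[of "Y \<times> Z"] Y Z by (simp add: card_cartesian_product)
      also have "\<dots> \<le> 2 ^ (L * 2 ^ J) * 2 ^ (L' * 2 ^ J)"
        by (intro mult_mono Y Z) auto
      finally show "card ?W \<le> 2 ^ ((L + L') * 2 ^ J)"
        by (simp add: power_add add_mult_distrib)
      show "in_Lp r G" if "G \<in> ?W" for G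
        using that Y Z Tin r by (auto intro!: in_Lp_add in_Lp_scaleR)
    next
      fix F assume F: "F \<in> Lp_unit_ball p"
      obtain y where y: "y \<in> Y" "in_Lp q (S F)" "Lp_norm q (S F - y) \<le> d"
        using Y(4)[OF F] by blast
      define v where "v = (1 / d) *\<^sub>R (S F - y)"
      have diff: "in_Lp q (S F - y)" using y Y q by (intro in_Lp_diff) auto
      have "Lp_norm q v \<le> 1 / d * Lp_norm q (S F - y)"
        using Lp_norm_scaleR[OF q diff, of "1 / d"] d by (simp add: v_def)
      also have "\<dots> \<le> 1" using d y by simp
      finally have v: "v \<in> Lp_unit_ball q"
        using in_Lp_scaleR[OF q diff] by (simp add: Lp_unit_ball_def v_def)
      obtain z where z: "z \<in> Z" "in_Lp r (T v)" "Lp_norm r (T v - z) \<le> C' * 2 powr (- (real J * b))"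
        using Z(4)[OF v] by blast
      have "S F = y + d *\<^sub>R v" using d by (simp add: v_def)
      moreover have "in_Lp q (d *\<^sub>R v)" using v by (auto simp: Lp_unit_ball_def intro: in_Lp_scaleR q)
      ultimately have TSF: "T (S F) = T y + d *\<^sub>R T v"
        using add[OF Y(3)[OF y(1)]] by (simp add: hom)
      have "in_Lp r (T v - z)" using z Z r by (intro in_Lp_diff) auto
      then have "Lp_norm r (d *\<^sub>R (T v - z)) \<le> d * (C' * 2 powr (- (real J * b)))"
        using Lp_norm_scaleR[OF r, of "T v - z" d] d z(3) by (smt (verit) mult_left_mono)
      also have "\<dots> = C * C' * 2 powr (- (real J * (a + b)))"
        by (simp add: d_def powr_add distrib_left minus_add_distrib[symmetric] mult.assoc mult.left_commute)
          (simp flip: powr_add)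
      finally have "Lp_norm r (T (S F) - (T y + d *\<^sub>R z)) \<le> C * C' * 2 powr (- (real J * (a + b)))"
        by (simp add: TSF algebra_simps)
      moreover have "in_Lp r (T (S F))" using Tin y by blast
      ultimately show "\<exists>G\<in>?W. in_Lp r (T (S F)) \<and> Lp_norm r (T (S F) - G) \<le> C * C' * 2 powr (- (real J * (a + b)))"
        using y(1) z(1) by force
    qed
  qed
qed

lemma has_nets_cong:
  assumes "has_nets p q T a" "\<And>F. F \<in> Lp_unit_ball p \<Longrightarrow> T F = T' F"
  shows "has_nets p q T' a"
  using assms unfolding has_nets_def is_net_def by (metis (no_types, lifting))

text \<open>Halving: both factors have order \<open>a/2\<close>, and through the midpoint \<open>1/s\<close> of \<open>1/p\<close> and \<open>1/q\<close> each of them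
bridges half of the gap. The intermediate exponent \<open>s\<close> is finite because \<open>p\<close> is.\<close>

lemma riemann_liouville_nets_finite:
  assumes "0 < a" "a < 2 ^ m" and "1 \<le> p" "ereal p \<le> q" and "1 / p - real_of_ereal (1 / q) < a"
  shows "has_nets (ereal p) q (riemann_liouville a) a"
  using assms
proof (induction m arbitrary: a p q)
  case 0
  then show ?case by (intro riemann_liouville_nets_base) auto
next
  case (Suc m)
  note p = \<open>1 \<le> p\<close> \<open>ereal p \<le> q\<close>
  define iq where "iq = real_of_ereal (1 / q)"
  have iq: "0 \<le> iq" "iq \<le> 1 / p"
    using p by (cases q; auto simp: iq_def one_ereal_def frac_le)+
  define s where "s = 2 / (1 / p + iq)"
  have p0: "0 < 1 / p" using p by simp
  have s_inv: "1 / s = (1 / p + iq) / 2" by (simp add: s_def)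
  have s_pos: "0 < s" using p0 iq by (simp add: s_def add_pos_nonneg)
  have ps: "p \<le> s"
  proof -
    have "1 / s \<le> 1 / p" using s_inv iq by simp
    then show ?thesis using s_pos p by (simp add: field_simps)
  qed
  have sq: "ereal s \<le> q"
  proof (cases q)
    case (real q')
    then have "iq = 1 / q'" "0 < q'" using p by (auto simp: iq_def one_ereal_def)
    then have "1 / q' \<le> 1 / s" using s_inv iq by simp
    then show ?thesis using real s_pos \<open>0 < q'\<close> by (simp add: field_simps)
  qed (use p in auto)
  have q: "1 \<le> q" using p by (metis ereal_less_eq(3) one_ereal_def order_trans)
  have "has_nets (ereal p) (ereal s) (riemann_liouville (a / 2)) (a / 2)"
    using Suc.prems ps s_inv s_pos by (intro Suc.IH) (auto simp: one_ereal_def iq_def)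
  moreover have "has_nets (ereal s) q (riemann_liouville (a / 2)) (a / 2)"
    using Suc.prems ps sq s_inv by (intro Suc.IH) (auto simp: iq_def)
  ultimately have "has_nets (ereal p) q (\<lambda>F. riemann_liouville (a / 2) (riemann_liouville (a / 2) F)) (a / 2 + a / 2)"
  proof (rule has_nets_compose)
    fix F G assume "in_Lp (ereal s) F" "in_Lp (ereal s) G"
    then show "riemann_liouville (a / 2) (F + G) = riemann_liouville (a / 2) F + riemann_liouville (a / 2) G"
      using Suc.prems p ps by (intro riemann_liouville_add in_Lp_embed[of 1 "ereal s"]) (auto simp: one_ereal_def)
  qed (use p ps q in \<open>auto simp: riemann_liouville_scaleR one_ereal_def\<close>)
  then have "has_nets (ereal p) q (riemann_liouville (a / 2 + a / 2)) (a / 2 + a / 2)"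
  proof (rule has_nets_cong)
    fix F assume "F \<in> Lp_unit_ball (ereal p)"
    then have "in_Lp 1 F"
      using p by (intro in_Lp_embed[of 1 "ereal p"]) (auto simp: Lp_unit_ball_def one_ereal_def)
    then show "riemann_liouville (a / 2) (riemann_liouville (a / 2) F) = riemann_liouville (a / 2 + a / 2) F"
      using Suc.prems by (intro riemann_liouville_semigroup) auto
  qed
  then show ?case by simp
qed

text \<open>The unit ball of \<open>L\<^sub>p\<close> is contained in twice that of \<open>L\<^sub>r\<close> for \<open>r \<le> p\<close>. If \<open>p\<close> or \<open>q\<close> is finite, \<open>r = min p q\<close>
keeps the hypothesis on the order; if both are infinite, every sufficiently large finite \<open>r\<close> does.\<close>

lemma riemann_liouville_nets:
  assumes p: "1 \<le> p" and q: "1 \<le> q" and a: "max (1 / p - 1 / q) 0 < ereal a"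
  shows "has_nets p q (riemann_liouville a) a"
proof -
  have a0: "0 < a" and pq: "1 / p - 1 / q < ereal a" using a by auto
  obtain r where r: "1 \<le> r" "ereal r \<le> p" "ereal r \<le> q" "1 / r - real_of_ereal (1 / q) < a"
  proof (cases "p = \<infinity> \<and> q = \<infinity>")
    case True
    define r where "r = max 1 (2 / a)"
    have "1 / r < a"
    proof -
      have "1 / r \<le> a / 2" using a0 by (simp add: r_def field_simps max_def)
      then show ?thesis using a0 by linarith
    qed
    then show ?thesis using True by (intro that[of r]) (auto simp: r_def)
  next
    case False
    define r where "r = real_of_ereal (min p q)"
    have r: "ereal r = min p q"
      using False p q by (cases p; cases q) (auto simp: r_def min_def)
    have "1 / r - real_of_ereal (1 / q) < a"
      using pq a0 r p q by (cases p; cases q) (auto simp: min_def one_ereal_def split: if_splits)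
    then show ?thesis
      using r p q by (intro that[of r]) (auto simp: one_ereal_def simp flip: ereal_less_eq(3))
  qed
  obtain m where "a < 2 ^ m" using real_arch_pow[of 2 a] by auto
  then have "has_nets (ereal r) q (riemann_liouville a) a"
    using a0 r by (intro riemann_liouville_nets_finite) auto
  then obtain C L where C: "0 < C" and nets: "\<And>J. \<exists>Y. is_net (ereal r) q (riemann_liouville a) (C * 2 powr (- (real J * a))) Y \<and> card Y \<le> 2 ^ (L * 2 ^ J)"
    unfolding has_nets_def by blast
  show ?thesis
  proof (rule has_netsI[where L=L and C="2 * C"])
    fix J
    obtain Y where Y: "finite Y" "card Y \<le> 2 ^ (L * 2 ^ J)" "\<And>G. G \<in> Y \<Longrightarrow> in_Lp q G"
      "\<And>F. F \<in> Lp_unit_ball (ereal r) \<Longrightarrow> \<exists>G\<in>Y. in_Lp q (riemann_liouville a F) \<and> Lp_norm q (riemann_liouville a F - G) \<le> C * 2 powr (- (real J * a))"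
      using nets[of J] unfolding is_net_def by blast
    show "\<exists>Y. is_net p q (riemann_liouville a) (2 * C * 2 powr (- (real J * a))) Y \<and> card Y \<le> 2 ^ (L * 2 ^ J)"
      unfolding is_net_def
    proof (intro exI[of _ "(\<lambda>G. 2 *\<^sub>R G) ` Y"] conjI ballI)
      show "finite ((\<lambda>G. 2 *\<^sub>R G) ` Y)" using Y by simp
      show "card ((\<lambda>G. 2 *\<^sub>R G) ` Y) \<le> 2 ^ (L * 2 ^ J)" using Y card_image_le[of Y] by (meson order_trans)
      show "in_Lp q G" if "G \<in> (\<lambda>G. 2 *\<^sub>R G) ` Y" for G
        using that Y q by (auto intro: in_Lp_scaleR)
    next
      fix F assume "F \<in> Lp_unit_ball p"
      then have "(1 / 2) *\<^sub>R F \<in> Lp_unit_ball (ereal r)"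
        using r by (intro Lp_unit_ball_embed[of "ereal r" p]) (auto simp: one_ereal_def)
      then obtain G where G: "G \<in> Y" "in_Lp q (riemann_liouville a ((1 / 2) *\<^sub>R F))"
        "Lp_norm q (riemann_liouville a ((1 / 2) *\<^sub>R F) - G) \<le> C * 2 powr (- (real J * a))"
        using Y(4) by blast
      have R: "riemann_liouville a F = 2 *\<^sub>R riemann_liouville a ((1 / 2) *\<^sub>R F)"
        by (simp add: riemann_liouville_scaleR)
      have "in_Lp q (riemann_liouville a ((1 / 2) *\<^sub>R F) - G)"
        using G Y q by (intro in_Lp_diff) auto
      from Lp_norm_scaleR[OF q this, of 2]
      have "Lp_norm q (riemann_liouville a F - 2 *\<^sub>R G) \<le> 2 * C * 2 powr (- (real J * a))"
        using G(3) unfolding R scaleR_right_diff_distrib[symmetric] by simp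
      moreover have "in_Lp q (riemann_liouville a F)"
        unfolding R by (intro in_Lp_scaleR q G)
      ultimately show "\<exists>G\<in>(\<lambda>G. 2 *\<^sub>R G) ` Y. in_Lp q (riemann_liouville a F) \<and> Lp_norm q (riemann_liouville a F - G) \<le> 2 * C * 2 powr (- (real J * a))"
        using G(1) by blast
    qed
  qed
qed

section \<open>From nets to entropy numbers\<close>

lemma in_Lp_0: "1 \<le> q \<Longrightarrow> in_Lp q 0"
proof transfer
  fix q :: ereal assume "1 \<le> q"
  then show "Lp_fun q (\<lambda>_. 0)"
    using Lp_le_bounded[of q "\<lambda>_. 0" 0] by (simp add: Lp_le_def)
qed

lemma operator_entropy_number_le_net:
  assumes p: "1 \<le> p" and q: "1 \<le> q" and Y: "is_net p q T E Y" "card Y \<le> 2 ^ (n - 1)" and E: "0 \<le> E"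
  shows "operator_entropy_number p q T n \<le> ennreal E"
proof -
  note net = is_netD[OF Y(1)]
  have "(0::L0) \<in> Lp_unit_ball p"
    using p by (simp add: Lp_unit_ball_def in_Lp_0)
  then have "Y \<noteq> {}" using net(3) by blast
  obtain h where h: "bij_betw h {0..<card Y} Y"
    using ex_bij_betw_nat_finite[OF net(1)] by blast
  define x where "x i = h (if i - 1 < card Y then i - 1 else 0)" for i
  have card0: "0 < card Y" using net(1) \<open>Y \<noteq> {}\<close> by (simp add: card_gt_0_iff)
  have x: "x i \<in> Y" for i
    using card0 h by (auto simp: x_def bij_betw_def)
  have surj: "\<exists>i\<in>{1..2 ^ (n - 1)}. x i = G" if "G \<in> Y" for G
  proof -
    have "G \<in> h ` {0..<card Y}" using that h by (simp add: bij_betw_def)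
    then obtain j where j: "j < card Y" "h j = G" by auto
    then have "Suc j \<in> {1..2 ^ (n - 1)}" "x (Suc j) = G"
      using Y(2) by (auto simp: x_def)
    then show ?thesis by blast
  qed
  have "T ` Lp_unit_ball p \<subseteq> (\<Union>i\<in>{1..2 ^ (n - 1)}. mcball_of (Lp_metric q) (x i) E)"
  proof
    fix G assume "G \<in> T ` Lp_unit_ball p"
    then obtain F where F: "F \<in> Lp_unit_ball p" "G = T F" by blast
    obtain H where H: "H \<in> Y" "in_Lp q (T F)" "Lp_norm q (T F - H) \<le> E"
      using net(3)[OF F(1)] by blast
    obtain i where i: "i \<in> {1..2 ^ (n - 1)}" "x i = H"
      using surj[OF H(1)] by blast
    have "Lp_norm q (H - T F) = Lp_norm q (T F - H)"
      using Lp_norm_uminus[of q "T F - H"] by simp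
    then have "G \<in> mcball_of (Lp_metric q) (x i) E"
      using H i F net(2)[OF H(1)] q by (simp add: mspace_Lp_metric mdist_Lp_metric)
    then show "G \<in> (\<Union>i\<in>{1..2 ^ (n - 1)}. mcball_of (Lp_metric q) (x i) E)"
      using i(1) by blast
  qed
  moreover have "\<forall>i\<in>{1..2 ^ (n - 1)}. x i \<in> mspace (Lp_metric q)"
    using x net(2) q by (simp add: mspace_Lp_metric)
  ultimately show ?thesis
    unfolding operator_entropy_number_def dyadic_entropy_number_def entropy_number_def
    using E by (intro Inf_lower) blast
qed

text \<open>For large \<open>n\<close> use the net with the largest \<open>J\<close> whose cardinality bound fits into \<open>2\<^sup>n\<^sup>-\<^sup>1\<close>; for the
finitely many small \<open>n\<close> a single ball around 0 suffices, since an image with a finite net is bounded.\<close>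

lemma has_nets_operator_entropy_number:
  assumes p: "1 \<le> p" and q: "1 \<le> q" and a: "0 < a" and T: "has_nets p q T a"
  shows "\<exists>C>0. \<forall>n\<ge>1. operator_entropy_number p q T n \<le> ennreal (C * real n powr - a)"
proof -
  obtain C L where C: "0 < C" and nets: "\<And>J. \<exists>Y. is_net p q T (C * 2 powr (- (real J * a))) Y \<and> card Y \<le> 2 ^ (L * 2 ^ J)"
    using T unfolding has_nets_def by blast
  \<comment> \<open>Positive even if \<open>L = 0\<close>, so that the set of admissible \<open>J\<close> is bounded.\<close>
  define K where "K = Suc L"
  obtain E where E: "0 \<le> E" and bounded: "\<And>n. operator_entropy_number p q T n \<le> ennreal E"
  proof -
    obtain Y0 where "is_net p q T C Y0" using nets[of 0] by auto
    note Y = is_netD[OF this]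
    define E where "E = C + (\<Sum>G\<in>Y0. Lp_norm q G)"
    have E0: "0 \<le> E" using C by (simp add: E_def Lp_norm_nonneg sum_nonneg)
    have "operator_entropy_number p q T n \<le> ennreal E" for n
    proof (rule operator_entropy_number_le_net[OF p q])
      show "is_net p q T E {0}"
        unfolding is_net_def
      proof (intro conjI ballI)
        fix F assume "F \<in> Lp_unit_ball p"
        then obtain G where G: "G \<in> Y0" "in_Lp q (T F)" "Lp_norm q (T F - G) \<le> C"
          using Y(3) by blast
        have "Lp_norm q ((T F - G) + G) \<le> Lp_norm q (T F - G) + Lp_norm q G"
          using G Y(2) q by (intro Lp_norm_triangle in_Lp_diff) auto
        moreover have "Lp_norm q G \<le> (\<Sum>G\<in>Y0. Lp_norm q G)"
          using G Y(1) by (intro member_le_sum) (auto simp: Lp_norm_nonneg)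
        ultimately have "Lp_norm q (T F - 0) \<le> E" using G(3) by (simp add: E_def)
        then show "\<exists>G\<in>{0}. in_Lp q (T F) \<and> Lp_norm q (T F - G) \<le> E"
          using G(2) by blast
      qed (use q in \<open>auto simp: in_Lp_0\<close>)
    qed (use E0 in auto)
    then show ?thesis using that E0 by blast
  qed
  define D where "D = C * (2 * real K) powr a + E * real K powr a"
  show ?thesis
  proof (intro exI[of _ D] conjI allI impI)
    show "0 < D" using C E by (simp add: D_def K_def add_pos_nonneg)
    fix n :: nat assume n: "1 \<le> n"
    show "operator_entropy_number p q T n \<le> ennreal (D * real n powr - a)"
    proof (cases "n \<le> K")
      case True
      have "1 \<le> real K powr a * real n powr - a"
        using True n a powr_mono2[of a "real n" "real K"] by (simp add: powr_minus field_simps)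
      then have "E * 1 \<le> E * (real K powr a * real n powr - a)"
        using E by (rule mult_left_mono)
      also have "\<dots> \<le> D * real n powr - a"
        using C by (simp add: D_def distrib_right)
      finally show ?thesis
        using bounded[of n] by (simp add: ennreal_leI order_trans)
    next
      case False
      define J where "J = (GREATEST J. K * 2 ^ J \<le> n - 1)"
      have bound: "J \<le> n" if "K * 2 ^ J \<le> n - 1" for J
      proof -
        have "J \<le> 2 ^ J" by (rule less_imp_le[OF less_exp])
        also have "\<dots> \<le> K * 2 ^ J" by (simp add: K_def)
        finally show ?thesis using that by linarith
      qed
      have "K * 2 ^ 0 \<le> n - 1" using False by simp
      then have J: "K * 2 ^ J \<le> n - 1"
        unfolding J_def by (rule GreatestI_nat) (rule bound)
      have "\<not> K * 2 ^ Suc J \<le> n - 1"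
      proof
        assume "K * 2 ^ Suc J \<le> n - 1"
        then have "Suc J \<le> J" unfolding J_def by (rule Greatest_le_nat) (rule bound)
        then show False by simp
      qed
      then have "n \<le> 2 * K * 2 ^ J" by simp
      then have "real n \<le> real (2 * K * 2 ^ J)" by (rule of_nat_mono)
      then have n_le: "real n \<le> 2 * real K * 2 ^ J" by simp
      obtain Y where Y: "is_net p q T (C * 2 powr (- (real J * a))) Y" "card Y \<le> 2 ^ (L * 2 ^ J)"
        using nets[of J] by blast
      have "L * 2 ^ J \<le> n - 1" using J by (simp add: K_def)
      then have "card Y \<le> 2 ^ (n - 1)"
        using Y(2) by (meson one_le_numeral order_trans power_increasing)
      then have "operator_entropy_number p q T n \<le> ennreal (C * 2 powr (- (real J * a)))"
        using C by (intro operator_entropy_number_le_net[OF p q Y(1)]) auto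
      also have "\<dots> \<le> ennreal (D * real n powr - a)"
      proof (rule ennreal_leI)
        have "real n powr a \<le> (2 * real K) powr a * 2 powr (real J * a)"
          using powr_mono2[of a "real n" "2 * real K * 2 ^ J"] n_le a
          by (simp add: powr_mult powr_powr flip: powr_realpow)
        then have "2 powr (- (real J * a)) \<le> (2 * real K) powr a * real n powr - a"
          using n by (simp add: powr_minus field_simps)
        then have "C * 2 powr (- (real J * a)) \<le> C * ((2 * real K) powr a * real n powr - a)"
          using C by simp
        also have "\<dots> \<le> D * real n powr - a"
          using E by (simp add: D_def distrib_right)
        finally show "C * 2 powr (- (real J * a)) \<le> D * real n powr - a" .
      qed
      finally show ?thesis .
    qed
  qed
qed

theorem theorem5p21:
  fixes p q :: ereal and \<alpha> :: real
  assumes "1 \<le> p" and "1 \<le> q"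
    and "max (1 / p - 1 / q) 0 < ereal \<alpha>"
  shows "operator_entropy_number p q (riemann_liouville \<alpha>) \<asymp> (\<lambda>n. ennreal (real n powr - \<alpha>))"
proof -
  have a: "0 < \<alpha>" using assms(3) by auto
  define c where "c = 4 powr (- \<alpha> - 1) / (4 * Gamma (\<alpha> + 2))"
  have c: "0 < c" using a by (simp add: c_def)
  obtain C where C: "0 < C"
    "\<And>n. 1 \<le> n \<Longrightarrow> operator_entropy_number p q (riemann_liouville \<alpha>) n \<le> ennreal (C * real n powr - \<alpha>)"
    using has_nets_operator_entropy_number[OF assms(1,2) a riemann_liouville_nets[OF assms]] by blast
  show ?thesis
    unfolding weakly_equiv_def
  proof (rule exI[of _ c], rule exI[of _ C], intro conjI allI impI)
    fix n :: nat assume n: "1 \<le> n"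
    show "ennreal c * ennreal (real n powr - \<alpha>) \<le> operator_entropy_number p q (riemann_liouville \<alpha>) n"
      using operator_entropy_number_ge[OF assms(1,2) a n, folded c_def] c by (simp add: ennreal_mult)
    show "operator_entropy_number p q (riemann_liouville \<alpha>) n \<le> ennreal C * ennreal (real n powr - \<alpha>)"
      using C(2)[OF n] C(1) by (simp add: ennreal_mult)
  qed (use c C in auto)
qed

end
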